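(* The number of flagpole partitions of size $n$ is $$\sum_{j=0}^{\lfloor (n-4)/2\rfloor}2p(j),$$ where $p(j)$ is the number of integer partitions of size $j$.
   Context: A quasi-Dyck vector (QDV) is an integer sequence $v=v_1v_2\cdots v_n$ with $v_1=0$ and $v_{i+1}\le v_i+1$ for all $i<n$. We use word notation; $i^c$ means $c$ copies of the symbol $i$; $W^{+}$ adds $1$ to each entry of $W$. Dyck classes $[v]$ are the equivalence classes of the equivalence relation on QDVs generated by $v\sim 0v^+$. An integer partition $\lambda$ (with $\ell(\lambda)$ positive parts and $\lambda_i=0$ for $i>\ell(\lambda)$; the zero partition $\langle 0\rangle=[0]$ is allowed) is identified with the Dyck class consisting of all QDVs $\mathrm{QDV}_n(\lambda)=(0-\lambda_n,1-\lambda_{n-1},\ldots,n-1-\lambda_1)$, $n>\ell(\lambda)$; this is a bijection between partitions and Dyck classes. $\mathrm{min}_{\Delta}(\lambda)$ is the least $n>\ell(\lambda)$ such that $\mathrm{QDV}_n(\lambda)$ has all entries nonnegative. The maps. $\mathrm{NU}_1$ is defined on $D_1=\{\gamma:\gamma_1\le\ell(\gamma)+2\}$ by $\mathrm{NU}_1(\gamma)=\langle\ell+1,\gamma_1-1,\ldots,\gamma_\ell-1\rangle$, $\ell=\ell(\gamma)$ (zero parts dropped); it is a bijection from $D_1$ onto $C_1=\{\gamma\ne\langle 0\rangle:\gamma_1\ge\ell(\gamma)\}$. $\mathrm{NU}_2$ is defined by two rules. Rule (a): $\mathrm{NU}_2([012^hA(-1)^{h-1}])=[00^{h-1}1A1^h]$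 for $h\ge 2$ and $A=A_1\cdots A_s$ a list of integers that is empty or satisfies all $A_i\le 2$, $A_s\ge 0$, $A_{i+1}\le A_i+1$ for $i<s$. Rule (b): $\mathrm{NU}_2([012^kB(-1)^k])=[00^kB01^k]$ for $k\ge 1$ and $B=B_1\cdots B_s$ a list of integers that is empty or satisfies all $B_i\le 2$, $B_1\le 1$, $B_s\ge -1$, $B_{i+1}\le B_i+1$ for $i<s$. $\mathrm{NU}_2$ is a bijection from its domain $D_2$ onto its image $C_2$, with $D_1\cap D_2=\emptyset=C_1\cap C_2$; $\mathrm{NU}$ is the combined bijection $D_1\cup D_2\to C_1\cup C_2$ and $\mathrm{ND}$ is its inverse. For nonzero $\mu=\langle r^{n_r}\cdots 2^{n_2}1^{n_1}\rangle$ with $n_r>0$ ($n_i$ parts equal to $i$), $B_\mu=01^{n_1}01^{n_2}\cdots 01^{n_r}$; $B_{\langle 0\rangle}$ is empty; $\mathrm{TI}(\mu)=[0B_\mu]$. $\mathrm{TI}_2(\mu)$ is the Dyck class obtained by starting at $\mathrm{TI}(\mu)$ and iterating $\mathrm{ND}$ as many times as possible (this always terminates). A flagpole partition is an integer partition $\mu$ with $|\mu|+8\le 2\,\mathrm{min}_{\Delta}(\mathrm{TI}_2(\mu))$. An empty sum is $0$. *)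

theory Defs
  imports Complex_Main
begin

text \<open>An integer partition is the weakly decreasing list of its positive parts; the zero
  partition is the empty list. Parts are numbered from 1.\<close>

definition is_partition :: "nat list \<Rightarrow> bool" where
  "is_partition \<nu> \<longleftrightarrow> sorted_wrt (\<ge>) \<nu> \<and> 0 \<notin> set \<nu>"

definition part :: "nat list \<Rightarrow> nat \<Rightarrow> nat" where
  "part \<nu> i = (if 1 \<le> i \<and> i \<le> length \<nu> then \<nu> ! (i - 1) else 0)"

definition partitions_of :: "nat \<Rightarrow> nat list set" where
  "partitions_of n = {\<nu>. is_partition \<nu> \<and> sum_list \<nu> = n}"

definition num_partitions :: "nat \<Rightarrow> nat" where
  "num_partitions n = card (partitions_of n)"


definition rises_by_at_most_1 :: "int list \<Rightarrow> bool" where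
  "rises_by_at_most_1 v \<longleftrightarrow> successively (\<lambda>a b. b \<le> a + 1) v"

definition is_QDV :: "int list \<Rightarrow> bool" where
  "is_QDV v \<longleftrightarrow> v \<noteq> [] \<and> hd v = 0 \<and> rises_by_at_most_1 v"

definition raise :: "int list \<Rightarrow> int list" where
  "raise v = map (\<lambda>x. x + 1) v"

definition dyck_equiv :: "int list \<Rightarrow> int list \<Rightarrow> bool" where
  "dyck_equiv = equivclp (\<lambda>v w. is_QDV v \<and> w = 0 # raise v)"

definition dyck_class :: "int list \<Rightarrow> int list set" where
  "dyck_class v = {w. is_QDV w \<and> dyck_equiv v w}"


text \<open>The entry at position \<open>i\<close> (counted from 0) is \<open>i - \<nu>\<^sub>n\<^sub>-\<^sub>i\<close>.\<close>

definition QDV :: "nat \<Rightarrow> nat list \<Rightarrow> int list" where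
  "QDV n \<nu> = map (\<lambda>i. int i - int (part \<nu> (n - i))) [0..<n]"

text \<open>The identification of partitions with Dyck classes, in both directions.\<close>

definition class_of_partition :: "nat list \<Rightarrow> int list set" where
  "class_of_partition \<nu> = {QDV n \<nu> |n. n > length \<nu>}"

definition partition_of_class :: "int list set \<Rightarrow> nat list" where
  "partition_of_class C = (THE \<nu>. is_partition \<nu> \<and> class_of_partition \<nu> = C)"

definition min_Delta :: "nat list \<Rightarrow> nat" where
  "min_Delta \<nu> = (LEAST n. n > length \<nu> \<and> (\<forall>x\<in>set (QDV n \<nu>). 0 \<le> x))"


text \<open>The partial maps \<open>NU\<^sub>1\<close>, \<open>NU\<^sub>2\<close>, \<open>NU\<close> and \<open>ND\<close> are represented by their graphs on Dyck classes.\<close>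

definition NU1_fun :: "nat list \<Rightarrow> nat list" where
  "NU1_fun \<gamma> = filter (\<lambda>x. x > 0) ((length \<gamma> + 1) # map (\<lambda>x. x - 1) \<gamma>)"

definition NU1 :: "(int list set \<times> int list set) set" where
  "NU1 = {(class_of_partition \<gamma>, class_of_partition (NU1_fun \<gamma>)) |\<gamma>.
            is_partition \<gamma> \<and> part \<gamma> 1 \<le> length \<gamma> + 2}"

inductive_set NU2 :: "(int list set \<times> int list set) set" where
  rule_a: "(dyck_class ([0, 1] @ replicate h 2 @ A @ replicate (h - 1) (- 1)),
            dyck_class ([0] @ replicate (h - 1) 0 @ [1] @ A @ replicate h 1)) \<in> NU2"
    if "h \<ge> 2"
      and "A = [] \<or> (\<forall>x\<in>set A. x \<le> 2) \<and> last A \<ge> 0 \<and> rises_by_at_most_1 A"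
| rule_b: "(dyck_class ([0, 1] @ replicate k 2 @ B @ replicate k (- 1)),
            dyck_class ([0] @ replicate k 0 @ B @ [0] @ replicate k 1)) \<in> NU2"
    if "k \<ge> 1"
      and "B = [] \<or> (\<forall>x\<in>set B. x \<le> 2) \<and> hd B \<le> 1 \<and> last B \<ge> - 1 \<and> rises_by_at_most_1 B"

definition NU :: "(int list set \<times> int list set) set" where
  "NU = NU1 \<union> NU2"

definition ND :: "(int list set \<times> int list set) set" where
  "ND = NU\<inverse>"


text \<open>For \<open>\<mu> \<noteq> []\<close> the largest part is \<open>hd \<mu>\<close>, and \<open>count_list \<mu> i\<close> is the multiplicity \<open>n\<^sub>i\<close>.\<close>

definition B_word :: "nat list \<Rightarrow> int list" where
  "B_word \<mu> = (if \<mu> = [] then []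
     else concat (map (\<lambda>i. 0 # replicate (count_list \<mu> i) 1) [1..<hd \<mu> + 1]))"

definition TI :: "nat list \<Rightarrow> int list set" where
  "TI \<mu> = dyck_class (0 # B_word \<mu>)"

text \<open>Since \<open>ND\<close> is single-valued and its iteration terminates, exactly one class is reachable
  from \<open>TI \<mu>\<close> at which \<open>ND\<close> is undefined.\<close>

definition TI2 :: "nat list \<Rightarrow> int list set" where
  "TI2 \<mu> = (THE C. (TI \<mu>, C) \<in> ND\<^sup>* \<and> C \<notin> Domain ND)"

definition flagpole :: "nat list \<Rightarrow> bool" where
  "flagpole \<mu> \<longleftrightarrow> is_partition \<mu> \<and>
     sum_list \<mu> + 8 \<le> 2 * min_Delta (partition_of_class (TI2 \<mu>))"

end

(*
Represent a Dyck class by its words. The size grows by one under NU and the deficit is constant,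
so ND terminates and TI2 mu is a terminal class of deficit |mu|. In a word of nonnegative integers
the deficit is the number of bad pairs of positions, those that count neither for the area nor for
dinv. If twice the length exceeds the deficit by at least 8, counting bad pairs forces a terminal
word to start with 0 0 1 2, and then either it has an entry at least 3 or it is
0 0 1 W or 0 0 1 W 1 with W over {1,2} starting and ending in 2.
In the first case NU stops after one step, whereas NU acts forever on every TI mu. In the second
case explicit NU moves on words 0 0 1 P Q, with P over {1,2} and Q over {0,1}, consume P and end at
some TI mu. So flagpole partitions of n correspond to these words with deficit n; the word W encodes
a partition of some j, its length is determined by n, j and the optional final 1, and the length
condition becomes 2j + 4 <= n.
*)
theory Submission
  imports Defs
begin

section \<open>Dyck classes and partitions\<close>

text \<open>The constant 8 is what a charging argument can afford. A few reference positions (the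
  first two, the last one, last occurrences of small values) are chosen so that every other position
  lies in two bad pairs with them. Together with the bad pairs among the references this gives at
  least twice the length minus 7 bad pairs, which contradicts a margin of 8.

  The count needs nonnegative entries, and \<open>min_Delta\<close> measures the shortest
  nonnegative word of a class. Whether \<open>ND\<close> applies is visible on the reduced word
  instead. The two may differ: the nonnegative word then starts with 0 1 and contains a second 0,
  and that case is refuted by counting in the lift while the rules are tested on the reduced word.

  \<open>TI2\<close> is injective because only \<open>NU1\<close> acts after a \<open>TI\<close>
  class and no \<open>TI\<close> class is in the range of \<open>NU1\<close>; so a forward orbit
  meets at most one of them. The rules themselves pass through words with entries -1, so the deficit
  has to be defined for words with negative entries too.\<close>

definition lift :: "int list \<Rightarrow> int list" where
  "lift v = 0 # raise v"

text \<open>Inverse of \<open>QDV\<close>. Reading from the right puts the largest part first, so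
  the zeros to be dropped come at the end.\<close>

definition word_partition :: "int list \<Rightarrow> nat list" where
  "word_partition v = filter (\<lambda>x. x > 0) (map (\<lambda>i. nat (int i - v ! i)) (rev [0..<length v]))"

lemma length_raise [simp]: "length (raise v) = length v"
  by (simp add: raise_def)

lemma length_lift [simp]: "length (lift v) = Suc (length v)"
  by (simp add: lift_def)

lemma raise_eq_Nil [simp]: "raise v = [] \<longleftrightarrow> v = []"
  by (simp add: raise_def)

lemma raise_append [simp]: "raise (v @ w) = raise v @ raise w"
  by (simp add: raise_def)

lemma raise_Cons [simp]: "raise (x # v) = (x + 1) # raise v"
  by (simp add: raise_def)

lemma raise_Nil [simp]: "raise [] = []"
  by (simp add: raise_def)

lemma nth_raise [simp]: "i < length v \<Longrightarrow> raise v ! i = v ! i + 1"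
  by (simp add: raise_def)

lemma rises_simps [simp]:
  "rises_by_at_most_1 []"
  "rises_by_at_most_1 [x]"
  "rises_by_at_most_1 (x # y # v) \<longleftrightarrow> y \<le> x + 1 \<and> rises_by_at_most_1 (y # v)"
  by (auto simp: rises_by_at_most_1_def)

lemma rises_Cons: "rises_by_at_most_1 (x # v) \<longleftrightarrow> v = [] \<or> hd v \<le> x + 1 \<and> rises_by_at_most_1 v"
  by (cases v) auto

lemma rises_append: "rises_by_at_most_1 (v @ w) \<longleftrightarrow> rises_by_at_most_1 v \<and> rises_by_at_most_1 w \<and>
    (v = [] \<or> w = [] \<or> hd w \<le> last v + 1)"
  by (auto simp: rises_by_at_most_1_def successively_append_iff)

lemma rises_raise [simp]: "rises_by_at_most_1 (raise v) \<longleftrightarrow> rises_by_at_most_1 v"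
  by (simp add: rises_by_at_most_1_def raise_def successively_map add.commute)

lemma rises_conv_nth:
  "rises_by_at_most_1 v \<longleftrightarrow> (\<forall>i. Suc i < length v \<longrightarrow> v ! Suc i \<le> v ! i + 1)"
  by (induction v rule: induct_list012) (auto simp: nth_Cons split: nat.splits)

lemma rises_nth_le:
  assumes "rises_by_at_most_1 v" "i \<le> j" "j < length v"
  shows "v ! j \<le> v ! i + int (j - i)"
  using assms(2,3)
proof (induction j rule: dec_induct)
  case (step j)
  then have "v ! Suc j \<le> v ! j + 1" using assms(1) by (auto simp: rises_conv_nth)
  with step show ?case by (simp add: Suc_diff_le)
qed auto

lemma is_QDV_Cons: "is_QDV (x # v) \<longleftrightarrow> x = 0 \<and> (v = [] \<or> hd v \<le> 1 \<and> rises_by_at_most_1 v)"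
  by (auto simp: is_QDV_def rises_Cons)

lemma is_QDV_E:
  assumes "is_QDV v" obtains w where "v = 0 # w"
  using assms by (cases v) (auto simp: is_QDV_def)

lemma is_QDV_lift: "is_QDV v \<Longrightarrow> is_QDV (lift v)"
  unfolding is_QDV_def lift_def rises_Cons[of 0] by (auto simp: hd_map raise_def) (metis raise_def rises_raise)

lemma is_QDV_nth_le: "is_QDV v \<Longrightarrow> i < length v \<Longrightarrow> v ! i \<le> int i"
  using rises_nth_le[of v 0 i] by (auto simp: is_QDV_def hd_conv_nth)

text \<open>In a weakly decreasing list the zeros form a final segment; dropping them shifts
  nothing, and \<open>part\<close> is 0 beyond the end anyway.\<close>

lemma part_filter_pos:
  assumes "sorted_wrt (\<ge>) xs" "1 \<le> k" "k \<le> length xs"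
  shows "part (filter (\<lambda>x. x > 0) xs) k = xs ! (k - 1)"
  using assms
proof (induction xs arbitrary: k)
  case (Cons x xs)
  show ?case
  proof (cases "x = 0")
    case True
    then have *: "\<forall>y\<in>set (x # xs). y = 0" using Cons.prems(1) by auto
    then have "filter (\<lambda>x. x > 0) (x # xs) = []" by (auto simp: filter_empty_conv)
    moreover have "(x # xs) ! (k - 1) \<in> set (x # xs)" using Cons.prems by (intro nth_mem) auto
    then have "(x # xs) ! (k - 1) = 0" using * by blast
    ultimately show ?thesis by (simp add: part_def)
  next
    case False
    show ?thesis
    proof (cases "k = 1")
      case False2: False
      then have "part (filter (\<lambda>x. x > 0) xs) (k - 1) = xs ! (k - 1 - 1)"
        using Cons.prems by (intro Cons.IH) auto
      moreover obtain l where "k = Suc (Suc l)" using False2 Cons.prems by (metis One_nat_def Suc_le_D Suc_le_mono not0_implies_Suc)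
      ultimately show ?thesis using False by (auto simp: part_def)
    qed (use False in \<open>auto simp: part_def\<close>)
  qed
qed auto

text \<open>Rising by at most 1 means that \<open>i - v ! i\<close> never decreases with
  \<open>i\<close>.\<close>

lemma sorted_word_partition_aux:
  assumes "is_QDV v"
  shows "sorted_wrt (\<ge>) (map (\<lambda>i. nat (int i - v ! i)) (rev [0..<length v]))"
  unfolding sorted_wrt_iff_nth_less
proof (intro allI impI)
  fix i j assume ij: "i < j" "j < length (map (\<lambda>i. nat (int i - v ! i)) (rev [0..<length v]))"
  let ?n = "length v"
  have "v ! (?n - Suc i) \<le> v ! (?n - Suc j) + int ((?n - Suc i) - (?n - Suc j))"
    using ij assms by (intro rises_nth_le) (auto simp: is_QDV_def)
  then show "map (\<lambda>i. nat (int i - v ! i)) (rev [0..<?n]) ! i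
      \<ge> map (\<lambda>i. nat (int i - v ! i)) (rev [0..<?n]) ! j"
    using ij by (simp add: rev_nth)
qed

lemma part_word_partition:
  assumes "is_QDV v" "1 \<le> k" "k \<le> length v"
  shows "int (part (word_partition v) k) = int (length v - k) - v ! (length v - k)"
proof -
  have "part (word_partition v) k = nat (int (length v - k) - v ! (length v - k))"
    unfolding word_partition_def using part_filter_pos[OF sorted_word_partition_aux[OF assms(1)], of k] assms
    by (simp add: rev_nth)
  then show ?thesis using is_QDV_nth_le[OF assms(1), of "length v - k"] assms by auto
qed

lemma is_partition_word_partition: "is_QDV v \<Longrightarrow> is_partition (word_partition v)"
  unfolding is_partition_def word_partition_def
  by (auto intro: sorted_wrt_filter sorted_word_partition_aux)

lemma part_eq_0_iff: "is_partition \<nu> \<Longrightarrow> 1 \<le> k \<Longrightarrow> part \<nu> k = 0 \<longleftrightarrow> length \<nu> < k"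
  by (cases k) (auto simp: part_def is_partition_def intro!: gr0I, metis Suc_le_lessD nth_mem)

lemma part_antimono: "is_partition \<nu> \<Longrightarrow> 1 \<le> i \<Longrightarrow> i \<le> j \<Longrightarrow> part \<nu> j \<le> part \<nu> i"
  by (cases "i = j") (auto simp: part_def is_partition_def sorted_wrt_iff_nth_less)

lemma partition_eqI:
  assumes "is_partition \<mu>" "is_partition \<nu>" "\<And>k. 1 \<le> k \<Longrightarrow> part \<mu> k = part \<nu> k"
  shows "\<mu> = \<nu>"
proof (rule nth_equalityI)
  have "length \<mu> < k \<longleftrightarrow> length \<nu> < k" if "1 \<le> k" for k
    using assms(1,2) assms(3)[OF that] part_eq_0_iff that by metis
  from this[of "Suc (length \<mu>)"] this[of "Suc (length \<nu>)"] show *: "length \<mu> = length \<nu>" by auto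
  show "\<mu> ! i = \<nu> ! i" if "i < length \<mu>" for i
    using assms(3)[of "Suc i"] that * by (auto simp: part_def)
qed

text \<open>The 0 in position 0 contributes a zero part, which makes the inequality strict.\<close>

lemma length_word_partition:
  assumes "is_QDV v" shows "length (word_partition v) < length v"
proof -
  have "v \<noteq> []" "v ! 0 = 0" using assms by (auto simp: is_QDV_def hd_conv_nth)
  then show ?thesis
  using part_eq_0_iff[OF is_partition_word_partition[OF assms], of "length v"]
    part_word_partition[OF assms, of "length v"] assms by (simp add: Suc_leI)
qed

lemma length_QDV [simp]: "length (QDV n \<nu>) = n"
  by (simp add: QDV_def)

lemma nth_QDV [simp]: "i < n \<Longrightarrow> QDV n \<nu> ! i = int i - int (part \<nu> (n - i))"
  by (simp add: QDV_def)

lemma QDV_word_partition: "is_QDV v \<Longrightarrow> QDV (length v) (word_partition v) = v"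
  by (rule nth_equalityI) (auto simp: part_word_partition)

lemma is_QDV_QDV:
  assumes "is_partition \<nu>" "length \<nu> < n" shows "is_QDV (QDV n \<nu>)"
proof -
  have "n \<noteq> 0" "QDV n \<nu> \<noteq> []" using assms(2) length_QDV[of n \<nu>] by (auto simp del: length_QDV)
  moreover have "QDV n \<nu> ! 0 = 0" using assms by (simp add: part_def)
  moreover have "rises_by_at_most_1 (QDV n \<nu>)"
    using part_antimono[OF assms(1)] by (auto simp: rises_conv_nth)
  ultimately show ?thesis by (simp add: is_QDV_def hd_conv_nth)
qed

lemma word_partition_QDV:
  assumes "is_partition \<nu>" "length \<nu> < n" shows "word_partition (QDV n \<nu>) = \<nu>"
proof (rule partition_eqI[OF is_partition_word_partition[OF is_QDV_QDV[OF assms]] assms(1)])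
  fix k :: nat assume k: "1 \<le> k"
  show "part (word_partition (QDV n \<nu>)) k = part \<nu> k"
  proof (cases "k \<le> n")
    case True
    then show ?thesis using part_word_partition[OF is_QDV_QDV[OF assms], of k] k by auto
  next
    case False
    then show ?thesis using length_word_partition[OF is_QDV_QDV[OF assms]] assms by (simp add: part_def)
  qed
qed

lemma QDV_Suc: "length \<nu> < n \<Longrightarrow> QDV (Suc n) \<nu> = lift (QDV n \<nu>)"
  by (rule nth_equalityI) (auto simp: lift_def nth_Cons part_def split: nat.splits)

lemma word_partition_lift:
  assumes "is_QDV v" shows "word_partition (lift v) = word_partition v"
  using word_partition_QDV[OF is_partition_word_partition[OF assms], of "Suc (length v)"]
    QDV_Suc[OF length_word_partition[OF assms]] QDV_word_partition[OF assms]
    length_word_partition[OF assms] by simp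

lemma dyck_equiv_lift: "is_QDV v \<Longrightarrow> dyck_equiv v (lift v)"
  unfolding dyck_equiv_def by (rule r_into_equivclp) (simp add: lift_def)

lemma dyck_equiv_funpow_lift: "is_QDV v \<Longrightarrow> is_QDV ((lift ^^ i) v) \<and> dyck_equiv v ((lift ^^ i) v)"
proof (induction i)
  case (Suc i)
  then show ?case using dyck_equiv_lift[of "(lift ^^ i) v"] is_QDV_lift
    by (auto simp: dyck_equiv_def intro: equivclp_trans)
qed (simp add: dyck_equiv_def)

lemma word_partition_dyck_equiv:
  assumes "dyck_equiv v w" "is_QDV v" shows "is_QDV w \<and> word_partition w = word_partition v"
  using assms(1)[unfolded dyck_equiv_def]
proof (induction rule: equivclp_induct)
  case (step y z)
  then show ?case using is_QDV_lift word_partition_lift unfolding lift_def by metis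
qed (simp add: assms(2))

lemma funpow_lift_eq_QDV:
  assumes "is_QDV v" shows "(lift ^^ i) v = QDV (length v + i) (word_partition v)"
proof (induction i)
  case 0 then show ?case by (simp add: QDV_word_partition[OF assms])
next
  case (Suc i)
  then show ?case using QDV_Suc[of "word_partition v" "length v + i"] length_word_partition[OF assms] by simp
qed

text \<open>Lifting does not change the partition, and of two words with the same partition the
  shorter one lifts to the longer one, since each is the \<open>QDV\<close> of its length.\<close>

lemma dyck_class_eq:
  assumes "is_QDV v" shows "dyck_class v = class_of_partition (word_partition v)"
proof (intro set_eqI iffI)
  fix w assume "w \<in> dyck_class v"
  then have "is_QDV w" "word_partition w = word_partition v"
    using word_partition_dyck_equiv assms by (auto simp: dyck_class_def)
  then show "w \<in> class_of_partition (word_partition v)"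
    using QDV_word_partition[of w] length_word_partition[of w] unfolding class_of_partition_def by force
next
  let ?\<nu> = "word_partition v"
  fix w assume "w \<in> class_of_partition ?\<nu>"
  then obtain n where n: "w = QDV n ?\<nu>" "n > length ?\<nu>" by (auto simp: class_of_partition_def)
  have w: "is_QDV w" using n is_QDV_QDV is_partition_word_partition[OF assms] by auto
  show "w \<in> dyck_class v"
  proof (cases "length v \<le> n")
    case True
    then have "(lift ^^ (n - length v)) v = w" using funpow_lift_eq_QDV[OF assms] n by simp
    then show ?thesis using dyck_equiv_funpow_lift[OF assms, of "n - length v"] by (auto simp: dyck_class_def)
  next
    case False
    then have "(lift ^^ (length v - n)) w = v"
      using funpow_lift_eq_QDV[OF w] n QDV_word_partition[OF assms] word_partition_QDV[of ?\<nu> n]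
        is_partition_word_partition[OF assms] by simp
    then show ?thesis using dyck_equiv_funpow_lift[OF w, of "length v - n"] w
      by (auto simp: dyck_class_def dyck_equiv_def intro: equivclp_sym)
  qed
qed

lemma self_in_dyck_class: "is_QDV v \<Longrightarrow> v \<in> dyck_class v"
  by (simp add: dyck_class_def dyck_equiv_def)

lemma word_partition_in_class:
  "is_partition \<nu> \<Longrightarrow> v \<in> class_of_partition \<nu> \<Longrightarrow> is_QDV v \<and> word_partition v = \<nu>"
  by (auto simp: class_of_partition_def is_QDV_QDV word_partition_QDV)

lemma class_of_partition_inj:
  assumes "is_partition \<mu>" "is_partition \<nu>" "class_of_partition \<mu> = class_of_partition \<nu>"
  shows "\<mu> = \<nu>"
proof -
  have "QDV (Suc (length \<mu>)) \<mu> \<in> class_of_partition \<mu>" by (auto simp: class_of_partition_def)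
  then show ?thesis using assms word_partition_in_class by metis
qed

lemma partition_of_class_of_partition:
  "is_partition \<nu> \<Longrightarrow> partition_of_class (class_of_partition \<nu>) = \<nu>"
  unfolding partition_of_class_def by (rule the_equality) (auto intro: class_of_partition_inj)

lemma dyck_class_eq_iff:
  "is_QDV v \<Longrightarrow> is_QDV w \<Longrightarrow> dyck_class v = dyck_class w \<longleftrightarrow> word_partition v = word_partition w"
  using dyck_class_eq class_of_partition_inj is_partition_word_partition by metis

lemma dyck_class_lift: "is_QDV v \<Longrightarrow> dyck_class (lift v) = dyck_class v"
  by (simp add: dyck_class_eq_iff is_QDV_lift word_partition_lift)

lemma dyck_class_funpow_lift: "is_QDV v \<Longrightarrow> dyck_class ((lift ^^ i) v) = dyck_class v"
  by (induction i) (auto simp: dyck_class_lift dyck_equiv_funpow_lift)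

text \<open>A class is a chain under \<open>lift\<close>; this dichotomy is how two words of a class
  are compared later.\<close>

lemma dyck_class_eqD:
  assumes "is_QDV v" "is_QDV w" "dyck_class v = dyck_class w"
  shows "(\<exists>i. w = (lift ^^ i) v) \<or> (\<exists>i. v = (lift ^^ i) w)"
proof -
  have eq: "word_partition v = word_partition w" using assms dyck_class_eq_iff by blast
  show ?thesis
  proof (cases "length v \<le> length w")
    case True
    then have "(lift ^^ (length w - length v)) v = w"
      using funpow_lift_eq_QDV[OF assms(1)] QDV_word_partition[OF assms(2)] eq by simp
    then show ?thesis by metis
  next
    case False
    then have "(lift ^^ (length v - length w)) w = v"
      using funpow_lift_eq_QDV[OF assms(2)] QDV_word_partition[OF assms(1)] eq by simp
    then show ?thesis by metis
  qed
qed

text \<open>Every Dyck class has exactly one reduced word; the other words of the class are its lifts.\<close>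

definition reduced :: "int list \<Rightarrow> bool" where
  "reduced v \<longleftrightarrow> is_QDV v \<and> (\<forall>w. v = 0 # w \<longrightarrow> w = [] \<or> hd w \<le> 0)"

lemma reduced_Cons: "reduced (0 # w) \<longleftrightarrow> w = [] \<or> hd w \<le> 0 \<and> rises_by_at_most_1 w"
  by (auto simp: reduced_def is_QDV_Cons)

lemma not_reduced_lift: "is_QDV v \<Longrightarrow> \<not> reduced (lift v)"
  by (auto simp: reduced_def lift_def elim!: is_QDV_E)

lemma reduced_eqD:
  assumes "reduced v" "reduced w" "dyck_class v = dyck_class w" shows "v = w"
proof -
  have q: "is_QDV v" "is_QDV w" using assms by (auto simp: reduced_def)
  have "i = 0" if "reduced ((lift ^^ i) u)" "is_QDV u" for i u
    using that not_reduced_lift dyck_equiv_funpow_lift[of u] by (cases i) auto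
  then show ?thesis using dyck_class_eqD[OF q assms(3)] assms q by fastforce
qed

text \<open>A word that is not reduced starts with 0 1, so subtracting 1 after the initial 0 leaves
  a word that again starts with 0.\<close>

lemma lift_cases:
  assumes "is_QDV v" "\<not> reduced v" obtains u where "is_QDV u" "v = lift u"
proof -
  from assms obtain w where v: "v = 0 # w" "w \<noteq> []" "hd w = 1" "rises_by_at_most_1 w"
    by (cases v) (auto simp: reduced_def is_QDV_Cons)
  define u where "u = map (\<lambda>x. x - 1) w"
  have wu: "w = raise u" by (simp add: u_def raise_def o_def)
  then have "is_QDV u" using v by (auto simp: is_QDV_def raise_def hd_map)
      (metis raise_def rises_raise)
  then show ?thesis using that[of u] v wu by (simp add: lift_def)
qed

lemma reduced_ex:
  assumes "is_QDV v" shows "\<exists>u i. reduced u \<and> v = (lift ^^ i) u"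
  using assms
proof (induction "length v" arbitrary: v rule: less_induct)
  case less
  show ?case
  proof (cases "reduced v")
    case True then show ?thesis by (intro exI[of _ v] exI[of _ 0]) simp
  next
    case False
    then obtain u where u: "is_QDV u" "v = lift u" using lift_cases less.prems by metis
    with less.hyps[of u] obtain w i where "reduced w" "u = (lift ^^ i) w" by auto
    then show ?thesis using u by (intro exI[of _ w] exI[of _ "Suc i"]) simp
  qed
qed

section \<open>The maps on words\<close>

lemma part_NU1_fun:
  assumes "is_partition \<gamma>" "part \<gamma> 1 \<le> length \<gamma> + 2"
  shows "is_partition (NU1_fun \<gamma>)"
    and "1 \<le> k \<Longrightarrow> part (NU1_fun \<gamma>) k = (if k = 1 then length \<gamma> + 1 else part \<gamma> (k - 1) - 1)"
proof -
  let ?xs = "(length \<gamma> + 1) # map (\<lambda>x. x - 1) \<gamma>"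
  have "x \<le> part \<gamma> 1" if "x \<in> set \<gamma>" for x
    using that assms(1) by (cases \<gamma>) (auto simp: part_def is_partition_def)
  then have s: "sorted_wrt (\<ge>) ?xs"
    using assms by (force simp: is_partition_def sorted_wrt_map intro: sorted_wrt_mono_rel[of _ "(\<ge>)"])
  then show "is_partition (NU1_fun \<gamma>)"
    unfolding NU1_fun_def is_partition_def using sorted_wrt_filter[OF s] by (auto simp del: sorted_wrt.simps filter.simps)
  assume k: "1 \<le> k"
  show "part (NU1_fun \<gamma>) k = (if k = 1 then length \<gamma> + 1 else part \<gamma> (k - 1) - 1)"
  proof (cases "k \<le> length \<gamma> + 1")
    case True
    then have "part (NU1_fun \<gamma>) k = ?xs ! (k - 1)"
      unfolding NU1_fun_def using k s by (intro part_filter_pos) auto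
    moreover obtain j where "k = Suc j" using k by (cases k) auto
    ultimately show ?thesis using True by (cases j) (auto simp: part_def)
  next
    case False
    have "length (NU1_fun \<gamma>) \<le> length ?xs" unfolding NU1_fun_def by (rule length_filter_le)
    then show ?thesis using False by (auto simp: part_def)
  qed
qed

text \<open>On words the first map sends 0 1 w to 0 w 0. Deleting the 1 moves each entry of
  \<open>w\<close> one position to the left and so lowers its part by 1; the appended 0 creates the
  new first part, equal to the number of positions before it.\<close>

lemma NU1_fun_word:
  assumes u: "is_QDV (0 # w @ [0])"
  defines "\<gamma> \<equiv> word_partition (0 # 1 # w)"
  shows "is_QDV (0 # 1 # w)" "part \<gamma> 1 \<le> length \<gamma> + 2" "NU1_fun \<gamma> = word_partition (0 # w @ [0])"
proof -
  let ?u = "0 # w @ [0]" and ?v = "0 # 1 # w" and ?m = "length w"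
  let ?\<delta> = "word_partition ?u"
  show v: "is_QDV ?v" using u by (cases "w = []") (auto simp: is_QDV_Cons rises_append rises_Cons)
  have \<gamma>: "is_partition \<gamma>" and \<delta>: "is_partition ?\<delta>"
    using u v is_partition_word_partition unfolding \<gamma>_def by auto
  have p\<gamma>: "int (part \<gamma> k) = int (?m + 2 - k) - ?v ! (?m + 2 - k)" if "1 \<le> k" "k \<le> ?m + 2" for k
    using part_word_partition[OF v, of k] that unfolding \<gamma>_def by simp
  have p\<delta>: "int (part ?\<delta> k) = int (?m + 2 - k) - ?u ! (?m + 2 - k)" if "1 \<le> k" "k \<le> ?m + 2" for k
    using part_word_partition[OF u, of k] that by simp
  have shift: "part ?\<delta> k + 1 = part \<gamma> (k - 1)" if "2 \<le> k" "k \<le> ?m + 1" for k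
  proof -
    obtain j where j: "?m + 2 - k = Suc j" "j < ?m" "?m + 2 - (k - 1) = Suc (Suc j)"
      using \<open>2 \<le> k\<close> \<open>k \<le> ?m + 1\<close> by (intro that[of "?m + 1 - k"]) auto
    have "1 \<le> k - 1" "k - 1 \<le> ?m + 2" "1 \<le> k" "k \<le> ?m + 2" using that by auto
    then show ?thesis using p\<gamma>[of "k - 1"] p\<delta>[of k] j by (simp only: j(1,3)) (simp add: nth_append)
  qed
  \<comment> \<open>The 1 in position 1 yields a zero part, while an entry in position 2 is at most
    1 and yields a positive one; so \<open>\<gamma>\<close> has exactly \<open>length w\<close>
    parts.\<close>
  have "part \<gamma> (?m + 1) = 0" using p\<gamma>[of "?m + 1"] by simp
  then have "length \<gamma> \<le> ?m" using part_eq_0_iff[OF \<gamma>] by fastforce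
  moreover have "part \<gamma> ?m \<noteq> 0" if "1 \<le> ?m" using shift[of "?m + 1"] that by simp
  ultimately have len: "length \<gamma> = ?m" using part_eq_0_iff[OF \<gamma>, of ?m] by (cases ?m) force+
  have d1: "part ?\<delta> 1 = ?m + 1" using p\<delta>[of 1] by (simp add: nth_append)
  show D: "part \<gamma> 1 \<le> length \<gamma> + 2"
  proof (cases "?m = 0")
    case False
    then have "1 \<le> ?m" by linarith
    then show ?thesis using shift[of 2] d1 part_antimono[OF \<delta>, of 1 2] len by simp
  qed (use len in \<open>simp add: part_def\<close>)
  show "NU1_fun \<gamma> = ?\<delta>"
  proof (rule partition_eqI[OF part_NU1_fun(1)[OF \<gamma> D] \<delta>])
    fix k :: nat assume k: "1 \<le> k"
    consider "k = 1" | "2 \<le> k" "k \<le> ?m + 1" | "k = ?m + 2" | "k > ?m + 2" using k by linarith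
    then show "part (NU1_fun \<gamma>) k = part ?\<delta> k"
    proof cases
      case 2 then show ?thesis using part_NU1_fun(2)[OF \<gamma> D k] shift[of k] by simp
    next
      case 3
      then show ?thesis using part_NU1_fun(2)[OF \<gamma> D k] p\<delta>[of k] len by (simp add: part_def)
    next
      case 4
      then have "\<not> k - 1 \<le> length \<gamma>" using len by linarith
      with 4 show ?thesis using part_NU1_fun(2)[OF \<gamma> D k] length_word_partition[OF u] len by (simp add: part_def)
    qed (use part_NU1_fun(2)[OF \<gamma> D k] d1 len in simp)
  qed
qed

lemma NU1_word:
  assumes "is_QDV (0 # w @ [0])"
  shows "(dyck_class (0 # 1 # w), dyck_class (0 # w @ [0])) \<in> NU1"
  using NU1_fun_word[OF assms] dyck_class_eq[OF assms] dyck_class_eq[OF NU1_fun_word(1)[OF assms]]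
    is_partition_word_partition[OF NU1_fun_word(1)[OF assms]] unfolding NU1_def by force

lemma NU1_cases:
  assumes "(C, D) \<in> NU1"
  obtains w where "C = dyck_class (0 # 1 # w)" "D = dyck_class (0 # w @ [0])" "is_QDV (0 # w @ [0])"
    "is_QDV (0 # 1 # w)"
proof -
  from assms obtain \<gamma> where \<gamma>: "is_partition \<gamma>" "part \<gamma> 1 \<le> length \<gamma> + 2"
    "C = class_of_partition \<gamma>" "D = class_of_partition (NU1_fun \<gamma>)" unfolding NU1_def by auto
  \<comment> \<open>At this length the word starts 0 1 and continues with at most 1. The domain
    condition then says that the last entry is at least -1, as appending 0 requires.\<close>
  define v where "v = QDV (length \<gamma> + 2) \<gamma>"
  define w where "w = drop 2 v"
  have v: "is_QDV v" unfolding v_def using is_QDV_QDV \<gamma> by simp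
  have lv: "length v = length \<gamma> + 2" by (simp add: v_def)
  have v01: "v ! 0 = 0" "v ! 1 = 1" by (auto simp: v_def part_def)
  have vw: "v = 0 # 1 # w" using v01 lv unfolding w_def
    by (metis (no_types) Cons_nth_drop_Suc One_nat_def Suc_1 add_2_eq_Suc' drop0 zero_less_Suc Suc_less_eq)
  have u: "is_QDV (0 # w @ [0])"
  proof (cases "w = []")
    case False
    then have l: "length \<gamma> > 0" using lv vw by auto
    have "hd w = v ! 2" using vw False by (simp add: hd_conv_nth numeral_2_eq_2)
    moreover have "v ! 2 \<le> 1" using l part_eq_0_iff[OF \<gamma>(1), of "length \<gamma>"] by (simp add: v_def Suc_le_eq)
    moreover have "last w = v ! (length \<gamma> + 1)" using vw False lv by (cases "length \<gamma>") (auto simp: last_conv_nth)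
    moreover have "v ! (length \<gamma> + 1) \<ge> -1" using \<gamma>(2) by (simp add: v_def)
    moreover have "rises_by_at_most_1 w" using v vw by (auto simp: is_QDV_Cons rises_Cons)
    ultimately show ?thesis using False by (auto simp: is_QDV_Cons rises_append)
  qed (simp add: is_QDV_Cons)
  have "word_partition v = \<gamma>" unfolding v_def using word_partition_QDV \<gamma>(1) by simp
  then show ?thesis using that[of w] u \<gamma> v vw NU1_fun_word[OF u] dyck_class_eq by metis
qed

definition lower :: "int list \<Rightarrow> int list" where
  "lower v = map (\<lambda>x. x - 1) v"

lemma lower_simps [simp]: "lower [] = []" "lower (x # v) = (x - 1) # lower v"
  "lower (v @ w) = lower v @ lower w" "raise (lower v) = v" "lower (raise v) = v"
  "length (lower v) = length v" "lower v = [] \<longleftrightarrow> v = []" "lower (replicate m x) = replicate m (x - 1)"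
  "raise (replicate m x) = replicate m (x + 1)"
  by (auto simp: lower_def raise_def o_def)

lemma hd_last_raise_lower: "v \<noteq> [] \<Longrightarrow> hd (raise v) = hd v + 1" "v \<noteq> [] \<Longrightarrow> last (raise v) = last v + 1"
  "v \<noteq> [] \<Longrightarrow> hd (lower v) = hd v - 1" "v \<noteq> [] \<Longrightarrow> last (lower v) = last v - 1"
  by (auto simp: lower_def raise_def hd_map last_map)

lemma rises_lower [simp]: "rises_by_at_most_1 (lower v) \<longleftrightarrow> rises_by_at_most_1 v"
  using rises_raise[of "lower v"] by simp

lemma lift_lower: "lift (0 # lower w) = 0 # 1 # w"
  by (simp add: lift_def)

lemma is_QDV_lower: "is_QDV (0 # lower w) \<longleftrightarrow> is_QDV (0 # 1 # w)"
  by (cases w) (auto simp: is_QDV_Cons rises_Cons hd_last_raise_lower)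

lemma dyck_class_lower: "is_QDV (0 # 1 # w) \<Longrightarrow> dyck_class (0 # 1 # w) = dyck_class (0 # lower w)"
  using dyck_class_lift[of "0 # lower w"] by (simp add: is_QDV_lower lift_lower)

lemma dyck_class_raise: "is_QDV (0 # w) \<Longrightarrow> dyck_class (0 # w) = dyck_class (0 # 1 # raise w)"
  using dyck_class_lift[of "0 # w"] by (simp add: lift_def)

lemma reduced_lower: "is_QDV (0 # 1 # w) \<Longrightarrow> w = [] \<or> hd w \<le> 1 \<Longrightarrow> reduced (0 # lower w)"
  by (auto simp: reduced_Cons hd_last_raise_lower is_QDV_Cons rises_Cons)

lemma dyck_class_012:
  assumes "is_QDV (0 # 1 # 2 # x)" "x = [] \<or> hd x \<le> 2"
  shows "dyck_class (0 # 1 # 2 # x) = dyck_class (0 # lower (lower x))" "reduced (0 # lower (lower x))"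
proof -
  have q: "is_QDV (0 # 1 # lower x)" using is_QDV_lower[of "2 # x"] assms(1) by simp
  show "dyck_class (0 # 1 # 2 # x) = dyck_class (0 # lower (lower x))"
    using dyck_class_lower[OF assms(1)] dyck_class_lower[OF q] by simp
  show "reduced (0 # lower (lower x))"
    using reduced_lower[OF q] assms(2) by (cases x) auto
qed

lemma inj_lower: "lower v = lower w \<longleftrightarrow> v = w"
  by (metis lower_simps(4))

lemma last_funpow_lift: "v \<noteq> [] \<Longrightarrow> (lift ^^ i) v \<noteq> [] \<and> last ((lift ^^ i) v) = last v + int i"
  by (induction i) (auto simp: lift_def hd_last_raise_lower)

definition lead :: "int \<Rightarrow> int list \<Rightarrow> nat" where
  "lead c v = length (takeWhile (\<lambda>x. x = c) v)"

definition trail :: "int \<Rightarrow> int list \<Rightarrow> nat" where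
  "trail c v = lead c (rev v)"

lemma lead_replicate_append: "lead c (replicate m c @ w) = m + lead c w"
  by (induction m) (auto simp: lead_def)

lemma trail_append_replicate: "trail c (w @ replicate m c) = m + trail c w"
  by (simp add: trail_def lead_replicate_append)

lemma lead_eq_0: "w = [] \<or> hd w \<noteq> c \<Longrightarrow> lead c w = 0"
  by (cases w) (auto simp: lead_def)

lemma trail_eq_0: "w = [] \<or> last w \<noteq> c \<Longrightarrow> trail c w = 0"
  by (auto simp: trail_def hd_rev intro: lead_eq_0)

text \<open>A word \<open>0 1 2\<^sup>h\<dots>\<close> is the only word of its class starting with \<open>0 1 2\<close>
  and not continuing with \<open>3\<close>, so its tail determines which rule applies and with which data.\<close>

definition NU2_tail_a :: "nat \<Rightarrow> int list \<Rightarrow> int list" where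
  "NU2_tail_a h A = replicate (h - 1) 2 @ A @ replicate (h - 1) (- 1)"

definition NU2_tail_b :: "nat \<Rightarrow> int list \<Rightarrow> int list" where
  "NU2_tail_b k B = replicate (k - 1) 2 @ B @ replicate k (- 1)"

definition NU2_cond_a :: "nat \<Rightarrow> int list \<Rightarrow> bool" where
  "NU2_cond_a h A \<longleftrightarrow> h \<ge> 2 \<and> (A = [] \<or> (\<forall>x\<in>set A. x \<le> 2) \<and> last A \<ge> 0 \<and> rises_by_at_most_1 A)"

definition NU2_cond_b :: "nat \<Rightarrow> int list \<Rightarrow> bool" where
  "NU2_cond_b k B \<longleftrightarrow> k \<ge> 1 \<and>
     (B = [] \<or> (\<forall>x\<in>set B. x \<le> 2) \<and> hd B \<le> 1 \<and> last B \<ge> - 1 \<and> rises_by_at_most_1 B)"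

definition NU2_image_a :: "nat \<Rightarrow> int list \<Rightarrow> int list" where
  "NU2_image_a h A = 0 # replicate (h - 1) 0 @ [1] @ A @ replicate h 1"

definition NU2_image_b :: "nat \<Rightarrow> int list \<Rightarrow> int list" where
  "NU2_image_b k B = 0 # replicate k 0 @ B @ [0] @ replicate k 1"

lemma NU2_word_a:
  "NU2_cond_a h A \<Longrightarrow> (dyck_class (0 # 1 # 2 # NU2_tail_a h A), dyck_class (NU2_image_a h A)) \<in> NU2"
  using rule_a[of h A] unfolding NU2_cond_a_def NU2_tail_a_def NU2_image_a_def by (cases h) auto

lemma NU2_word_b:
  "NU2_cond_b k B \<Longrightarrow> (dyck_class (0 # 1 # 2 # NU2_tail_b k B), dyck_class (NU2_image_b k B)) \<in> NU2"
  using rule_b[of k B] unfolding NU2_cond_b_def NU2_tail_b_def NU2_image_b_def by (cases k) auto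

lemma NU2_cases:
  assumes "(C, D) \<in> NU2"
  obtains (a) h A where "NU2_cond_a h A" "C = dyck_class (0 # 1 # 2 # NU2_tail_a h A)"
      "D = dyck_class (NU2_image_a h A)"
  | (b) k B where "NU2_cond_b k B" "C = dyck_class (0 # 1 # 2 # NU2_tail_b k B)"
      "D = dyck_class (NU2_image_b k B)"
  using assms
proof (cases rule: NU2.cases)
  case (rule_a h A)
  then show ?thesis by (intro a[of h A]; cases h) (auto simp: NU2_cond_a_def NU2_tail_a_def NU2_image_a_def)
next
  case (rule_b k B)
  then show ?thesis by (intro b[of k B]; cases k) (auto simp: NU2_cond_b_def NU2_tail_b_def NU2_image_b_def)
qed

lemma rises_replicate [simp]: "rises_by_at_most_1 (replicate m x)"
  by (auto simp: rises_conv_nth)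

lemma hd_le: "\<forall>x\<in>set A. x \<le> c \<Longrightarrow> A \<noteq> [] \<Longrightarrow> hd A \<le> (c :: int)"
  by (cases A) auto

text \<open>\<open>last A \<ge> 0\<close> makes the number of trailing -1 exact, while
  \<open>A\<close> may prolong the leading block of 2. So there are at least as many leading 2 as
  trailing -1.\<close>

lemma NU2_tail_a:
  assumes "NU2_cond_a h A"
  defines "x \<equiv> NU2_tail_a h A"
  shows "is_QDV (0 # 1 # 2 # x)" "\<forall>y\<in>set x. y \<le> 2" "x \<noteq> []" "last x = -1"
    "trail (-1) x = h - 1" "lead 2 x \<ge> h - 1"
proof -
  have A: "h \<ge> 2" "A = [] \<or> (\<forall>x\<in>set A. x \<le> 2) \<and> last A \<ge> 0 \<and> rises_by_at_most_1 A"
    using assms(1) by (auto simp: NU2_cond_a_def)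
  then show "\<forall>y\<in>set x. y \<le> 2" "x \<noteq> []" "last x = -1" by (auto simp: x_def NU2_tail_a_def)
  show "trail (-1) x = h - 1" using A unfolding x_def NU2_tail_a_def append_assoc[symmetric] trail_append_replicate
    by (subst trail_eq_0) (auto simp: last_append)
  show "lead 2 x \<ge> h - 1" by (simp add: x_def NU2_tail_a_def lead_replicate_append)
  show "is_QDV (0 # 1 # 2 # x)"
    using A hd_le[of A 2] hd_le[of A 3]
    by (fastforce simp: x_def NU2_tail_a_def is_QDV_Cons rises_Cons rises_append hd_append)
qed

text \<open>Here \<open>hd B \<le> 1\<close> makes the number of leading 2 exact and the trailing
  block is longer, the opposite of rule (a). This comparison separates the two rules.\<close>

lemma NU2_tail_b:
  assumes "NU2_cond_b k B"
  defines "x \<equiv> NU2_tail_b k B"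
  shows "is_QDV (0 # 1 # 2 # x)" "\<forall>y\<in>set x. y \<le> 2" "x \<noteq> []" "last x = -1"
    "lead 2 x = k - 1" "trail (-1) x \<ge> k"
proof -
  have B: "k \<ge> 1" "B = [] \<or> (\<forall>x\<in>set B. x \<le> 2) \<and> hd B \<le> 1 \<and> last B \<ge> -1 \<and> rises_by_at_most_1 B"
    using assms(1) by (auto simp: NU2_cond_b_def)
  then show "\<forall>y\<in>set x. y \<le> 2" "x \<noteq> []" "last x = -1" by (auto simp: x_def NU2_tail_b_def)
  show "lead 2 x = k - 1" using B unfolding x_def NU2_tail_b_def lead_replicate_append
    by (subst lead_eq_0) (auto simp: hd_append)
  show "trail (-1) x \<ge> k" 
    unfolding x_def NU2_tail_b_def append_assoc[symmetric] trail_append_replicate by simp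
  show "is_QDV (0 # 1 # 2 # x)"
    using B by (auto simp: x_def NU2_tail_b_def is_QDV_Cons rises_Cons rises_append hd_append)
qed

text \<open>On the image side leading 0 and trailing 1 play the same role: rule (a) gives no more
  leading 0 than trailing 1, rule (b) strictly more.\<close>

lemma NU2_image_a:
  assumes "NU2_cond_a h A"
  defines "v \<equiv> NU2_image_a h A"
  shows "reduced v" "last v = 1" "lead 0 v = h" "trail 1 v \<ge> h"
proof -
  have A: "h \<ge> 2" "A = [] \<or> (\<forall>x\<in>set A. x \<le> 2) \<and> last A \<ge> 0 \<and> rises_by_at_most_1 A"
    using assms(1) by (auto simp: NU2_cond_a_def)
  have v: "v = replicate h 0 @ [1] @ A @ replicate h 1"
    using A by (cases h) (auto simp: v_def NU2_image_a_def)
  show "last v = 1" using A v by simp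
  show "lead 0 v = h" unfolding v lead_replicate_append by (simp add: lead_def)
  show "trail 1 v \<ge> h" unfolding v append_assoc[symmetric] trail_append_replicate by simp
  show "reduced v" using A hd_le[of A 2] unfolding v_def NU2_image_a_def
    by (auto simp: reduced_Cons rises_append rises_Cons hd_append)
qed

lemma NU2_image_b:
  assumes "NU2_cond_b k B"
  defines "v \<equiv> NU2_image_b k B"
  shows "reduced v" "last v = 1" "lead 0 v \<ge> k + 1" "trail 1 v = k"
proof -
  have B: "k \<ge> 1" "B = [] \<or> (\<forall>x\<in>set B. x \<le> 2) \<and> hd B \<le> 1 \<and> last B \<ge> -1 \<and> rises_by_at_most_1 B"
    using assms(1) by (auto simp: NU2_cond_b_def)
  have v: "v = replicate (k + 1) 0 @ B @ [0] @ replicate k 1"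
    by (auto simp: v_def NU2_image_b_def)
  show "last v = 1" using B v by simp
  show "lead 0 v \<ge> k + 1" unfolding v lead_replicate_append by simp
  show "trail 1 v = k" unfolding v append_assoc[symmetric] trail_append_replicate
    by (simp add: trail_def lead_def)
  show "reduced v" using B unfolding v_def NU2_image_b_def
    by (auto simp: reduced_Cons rises_append rises_Cons hd_append)
qed

lemma dyck_class_012_inj:
  assumes "is_QDV (0 # 1 # 2 # x)" "\<forall>y\<in>set x. y \<le> 2" "is_QDV (0 # 1 # 2 # x')" "\<forall>y\<in>set x'. y \<le> 2"
    "dyck_class (0 # 1 # 2 # x) = dyck_class (0 # 1 # 2 # x')"
  shows "x = x'"
proof -
  have "x = [] \<or> hd x \<le> 2" "x' = [] \<or> hd x' \<le> 2" using assms hd_le by blast+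
  then have "0 # lower (lower x) = 0 # lower (lower x')"
    using dyck_class_012[of x] dyck_class_012[of x'] assms reduced_eqD by metis
  then show ?thesis by (simp add: inj_lower)
qed

lemma NU2_tail_cancel:
  assumes "NU2_cond_a h A" "NU2_cond_a h' A'" "NU2_tail_a h A = NU2_tail_a h' A'" shows "h = h' \<and> A = A'"
proof -
  have "h = h'" using NU2_tail_a(5)[OF assms(1)] NU2_tail_a(5)[OF assms(2)] assms by (auto simp: NU2_cond_a_def)
  then show ?thesis using assms(3) by (auto simp: NU2_tail_a_def)
qed

lemma NU2_tail_cancel_b:
  assumes "NU2_cond_b k B" "NU2_cond_b k' B'" "NU2_tail_b k B = NU2_tail_b k' B'" shows "k = k' \<and> B = B'"
proof -
  have "k = k'" using NU2_tail_b(5)[OF assms(1)] NU2_tail_b(5)[OF assms(2)] assms by (auto simp: NU2_cond_b_def)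
  then show ?thesis using assms(3) by (auto simp: NU2_tail_b_def)
qed

lemma NU2_tail_a_neq_b: "NU2_cond_a h A \<Longrightarrow> NU2_cond_b k B \<Longrightarrow> NU2_tail_a h A \<noteq> NU2_tail_b k B"
  using NU2_tail_a(5,6)[of h A] NU2_tail_b(5,6)[of k B] by (auto simp: NU2_cond_b_def)

text \<open>The reduced word comes from removing one lift on the \<open>NU1\<close> side and two on
  the \<open>NU2\<close> side. Equating both forces \<open>w\<close> to end in -2, after which no 0
  may follow.\<close>

lemma NU1_NU2_domain_disjoint:
  assumes "(C, D) \<in> NU1" "(C, D') \<in> NU2" shows False
proof -
  from assms(1) obtain w where w: "C = dyck_class (0 # 1 # w)" "is_QDV (0 # w @ [0])" "is_QDV (0 # 1 # w)"
    by (rule NU1_cases)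
  from assms(2) obtain x where x: "is_QDV (0 # 1 # 2 # x)" "\<forall>y\<in>set x. y \<le> 2" "x \<noteq> []" "last x = -1"
    "C = dyck_class (0 # 1 # 2 # x)"
    by (cases rule: NU2_cases) (metis NU2_tail_a(1-4), metis NU2_tail_b(1-4))
  have "w = [] \<or> hd w \<le> 1" using w(2) by (cases w) (auto simp: is_QDV_Cons)
  then have "reduced (0 # lower w)" "dyck_class (0 # lower w) = C" 
    using reduced_lower dyck_class_lower w by auto
  moreover have "reduced (0 # lower (lower x))" "dyck_class (0 # lower (lower x)) = C"
    using dyck_class_012[OF x(1)] hd_le[OF x(2,3)] x(5) by auto
  ultimately have "lower w = lower (lower x)" using reduced_eqD by fastforce
  then have "w = lower x" by (simp add: inj_lower)
  then have "last w = -2" "w \<noteq> []" using x by (auto simp: hd_last_raise_lower)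
  then show False using w(2) by (auto simp: is_QDV_Cons rises_append)
qed

lemma NU_single_valued:
  assumes "(C, D) \<in> NU" "(C, D') \<in> NU" shows "D = D'"
proof -
  consider "(C, D) \<in> NU1" "(C, D') \<in> NU1" | "(C, D) \<in> NU2" "(C, D') \<in> NU2"
    using assms NU1_NU2_domain_disjoint unfolding NU_def by blast
  then show ?thesis
  proof cases
    case 1 then show ?thesis unfolding NU1_def using class_of_partition_inj by blast
  next
    case 2
    show ?thesis
    proof (cases rule: NU2_cases[OF 2(1)])
      case a: (1 h A)
      note A = NU2_tail_a[OF a(1)]
      show ?thesis
      proof (cases rule: NU2_cases[OF 2(2)])
        case (1 h' A')
        then show ?thesis using NU2_tail_cancel[OF a(1)] dyck_class_012_inj[OF A(1,2)] NU2_tail_a(1,2) a by metis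
      next
        case (2 k B)
        then show ?thesis using NU2_tail_a_neq_b[OF a(1)] dyck_class_012_inj[OF A(1,2)] NU2_tail_b(1,2) a by metis
      qed
    next
      case b: (2 k B)
      note B = NU2_tail_b[OF b(1)]
      show ?thesis
      proof (cases rule: NU2_cases[OF 2(2)])
        case (1 h A)
        then show ?thesis using NU2_tail_a_neq_b[OF _ b(1)] dyck_class_012_inj[OF B(1,2)] NU2_tail_a(1,2) b by metis
      next
        case (2 k' B')
        then show ?thesis using NU2_tail_cancel_b[OF b(1)] dyck_class_012_inj[OF B(1,2)] NU2_tail_b(1,2) b by metis
      qed
    qed
  qed
qed

text \<open>A class in the range of \<open>NU1\<close> contains a word ending in 0. Lifting
  increases the last entry, so its reduced word ends in a number at most 0, whereas
  \<open>NU2\<close> produces reduced words ending in 1.\<close>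

lemma NU1_NU2_range_disjoint:
  assumes "(C, D) \<in> NU1" "reduced v" "last v \<ge> 1" shows "D \<noteq> dyck_class v"
proof
  assume D: "D = dyck_class v"
  from assms(1) obtain w where w: "D = dyck_class (0 # w @ [0])" "is_QDV (0 # w @ [0])"
    by (rule NU1_cases)
  obtain u i where u: "reduced u" "0 # w @ [0] = (lift ^^ i) u" using reduced_ex[OF w(2)] by blast
  then have "u \<noteq> []" "dyck_class u = D"
    using dyck_class_funpow_lift[of u i] w by (auto simp: reduced_def is_QDV_def)
  then have "u = v" using reduced_eqD u(1) assms(2) D by blast
  then show False using last_funpow_lift[OF \<open>u \<noteq> []\<close>, of i] assms(3) unfolding u(2)[symmetric] by simp
qed

lemma NU_injective:
  assumes "(C, D) \<in> NU" "(C', D) \<in> NU" shows "C = C'"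
proof -
  have mixed: "False" if "(C, D) \<in> NU1" "(C', D) \<in> NU2" for C C'
    using that(2) NU1_NU2_range_disjoint[OF that(1)]
    by (cases rule: NU2_cases) (metis NU2_image_a(1,2) order_refl, metis NU2_image_b(1,2) order_refl)
  have ab: "False" if "NU2_cond_a h A" "NU2_cond_b k B" "NU2_image_a h A = NU2_image_b k B" for h A k B
    using NU2_image_a(3,4)[OF that(1)] NU2_image_b(3,4)[OF that(2)] that(3) by auto
  consider "(C, D) \<in> NU1" "(C', D) \<in> NU1" | "(C, D) \<in> NU2" "(C', D) \<in> NU2"
    using assms mixed unfolding NU_def by blast
  then show ?thesis
  proof cases
    case 1
    from 1(1) obtain w where w: "C = dyck_class (0 # 1 # w)" "D = dyck_class (0 # w @ [0])" "is_QDV (0 # w @ [0])"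
      by (rule NU1_cases)
    from 1(2) obtain w' where w': "C' = dyck_class (0 # 1 # w')" "D = dyck_class (0 # w' @ [0])" "is_QDV (0 # w' @ [0])"
      by (rule NU1_cases)
    \<comment> \<open>Lifting changes the last entry, so a class has at most one word ending in 0,
      and that word determines \<open>w\<close>.\<close>
    have "i = 0" if "0 # x @ [0] = (lift ^^ i) (0 # y @ [0])" for i x y
      using last_funpow_lift[of "0 # y @ [0]" i] unfolding that[symmetric] by simp
    then have "0 # w @ [0] = 0 # w' @ [0]" using dyck_class_eqD[OF w(3) w'(3)] w w' by (metis funpow_0)
    then show ?thesis using w w' by simp
  next
    case 2
    show ?thesis
    proof (cases rule: NU2_cases[OF 2(1)])
      case a: (1 h A)
      show ?thesis
      proof (cases rule: NU2_cases[OF 2(2)])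
        case (1 h' A')
        then have eq: "NU2_image_a h A = NU2_image_a h' A'" using a NU2_image_a(1) reduced_eqD by metis
        then have "h = h'" using NU2_image_a(3) a 1 by metis
        with eq have "A = A'" by (auto simp: NU2_image_a_def)
        with \<open>h = h'\<close> show ?thesis using a 1 by simp
      next
        case b: (2 k B)
        then show ?thesis using a ab NU2_image_a(1) NU2_image_b(1) reduced_eqD by metis
      qed
    next
      case b: (2 k B)
      show ?thesis
      proof (cases rule: NU2_cases[OF 2(2)])
        case a: (1 h A)
        then show ?thesis using b ab NU2_image_a(1) NU2_image_b(1) reduced_eqD by metis
      next
        case (2 k' B')
        then have eq: "NU2_image_b k B = NU2_image_b k' B'" using b NU2_image_b(1) reduced_eqD by metis
        then have "k = k'" using NU2_image_b(4) b 2 by metis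
        with eq have "B = B'" by (auto simp: NU2_image_b_def)
        with \<open>k = k'\<close> show ?thesis using b 2 by simp
      qed
    qed
  qed
qed

section \<open>Size and deficit\<close>

text \<open>On words of nonnegative integers, the size minus the deficit is the number of pairs \<open>i < j\<close> with
  \<open>v\<^sub>i - v\<^sub>j \<in> {0, 1}\<close>; the negative entries need the correction \<open>neg_weight\<close>
  for the statistic to be constant on Dyck classes.\<close>

definition dinv_pair :: "int \<Rightarrow> int \<Rightarrow> int" where
  "dinv_pair x y = (if x = y \<or> x = y + 1 then 1 else 0)"

definition dinv_from :: "int \<Rightarrow> int list \<Rightarrow> int" where
  "dinv_from x ys = (\<Sum>y\<leftarrow>ys. dinv_pair x y)"

fun dinv_pairs :: "int list \<Rightarrow> int" where
  "dinv_pairs [] = 0"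
| "dinv_pairs (x # xs) = dinv_from x xs + dinv_pairs xs"

text \<open>The number of future lifts whose new 0 will form a dinv pair with this entry: the lift
  that raises it to -1 and the one that raises it to 0, as far as they are still ahead.\<close>

definition neg_weight :: "int \<Rightarrow> int" where
  "neg_weight y = (if y = - 1 then 1 else if y \<le> - 2 then 2 else 0)"

definition triangle :: "nat \<Rightarrow> int" where
  "triangle n = int (n choose 2)"

text \<open>The sum of \<open>i - v ! i\<close> over all positions; for a quasi-Dyck vector this is
  the size of its partition.\<close>

definition word_size :: "int list \<Rightarrow> int" where
  "word_size v = triangle (length v) - sum_list v"

definition word_deficit :: "int list \<Rightarrow> int" where
  "word_deficit v = word_size v - dinv_pairs v - (\<Sum>y\<leftarrow>v. neg_weight y)"

lemma triangle_simps [simp]: "triangle 0 = 0" "triangle (Suc n) = int n + triangle n"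
  by (auto simp: triangle_def numeral_2_eq_2)

text \<open>Turns a count by the right end \<open>c\<close> into a count by the left end
  \<open>c + 1\<close>, so that all sums over pairs reduce to \<open>dinv_from\<close>.\<close>

lemma dinv_pair_flip: "dinv_pair x c = dinv_pair (c + 1) x"
  by (auto simp: dinv_pair_def)

lemma sum_list_replicate_int [simp]: "sum_list (replicate m (x :: int)) = int m * x"
  by (induction m) (auto simp: algebra_simps)

lemma dinv_from_simps [simp]:
  "dinv_from x [] = 0" "dinv_from x (y # ys) = dinv_pair x y + dinv_from x ys"
  "dinv_from x (ys @ zs) = dinv_from x ys + dinv_from x zs"
  "dinv_from x (replicate m y) = int m * dinv_pair x y"
  by (auto simp: dinv_from_def)

lemma dinv_pairs_append:
  "dinv_pairs (xs @ ys) = dinv_pairs xs + dinv_pairs ys + (\<Sum>x\<leftarrow>xs. dinv_from x ys)"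
  by (induction xs) auto

lemma dinv_pairs_replicate [simp]: "dinv_pairs (replicate m x) = triangle m"
  by (induction m) (auto simp: dinv_pair_def)

lemma sum_dinv_pair: "(\<Sum>x\<leftarrow>xs. dinv_pair x c) = dinv_from (c + 1) xs"
  by (simp add: dinv_from_def dinv_pair_flip[of _ c])

lemma neg_weight_simps [simp]: "neg_weight 0 = 0" "neg_weight 1 = 0" "neg_weight 2 = 0" "neg_weight (- 1) = 1"
  by (auto simp: neg_weight_def)

lemma dinv_pair_numerals: "dinv_pair (- 1) (- 1) = 1" "dinv_pair 0 0 = 1" "dinv_pair 0 1 = 0" "dinv_pair 0 2 = 0" "dinv_pair 0 (- 1) = 1"
  "dinv_pair 1 0 = 1" "dinv_pair 1 1 = 1" "dinv_pair 1 2 = 0" "dinv_pair 1 (- 1) = 0"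
  "dinv_pair 2 0 = 0" "dinv_pair 2 1 = 1" "dinv_pair 2 2 = 1" "dinv_pair 2 (- 1) = 0"
  by (auto simp: dinv_pair_def)

lemmas dinv_expand = dinv_pairs_append sum_list_addf sum_list_const_mult sum_dinv_pair dinv_pair_numerals

lemma dinv_pairs_raise [simp]: "dinv_pairs (raise v) = dinv_pairs v"
proof -
  have "dinv_from (x + 1) (raise v) = dinv_from x v" for x v
    by (induction v) (auto simp: dinv_pair_def)
  then show ?thesis by (induction v) auto
qed

lemma sum_list_raise: "sum_list (raise v) = sum_list v + int (length v)"
  by (induction v) auto

lemma word_size_lift [simp]: "word_size (lift v) = word_size v"
  by (simp add: word_size_def lift_def sum_list_raise)

lemma word_deficit_lift [simp]: "word_deficit (lift v) = word_deficit v"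
proof -
  have "dinv_from 0 (raise v) + (\<Sum>y\<leftarrow>raise v. neg_weight y) = (\<Sum>y\<leftarrow>v. neg_weight y)"
    by (induction v) (auto simp: dinv_pair_def neg_weight_def)
  then show ?thesis using word_size_lift[of v] unfolding word_deficit_def by (simp add: lift_def)
qed

lemma NU1_stats:
  "word_size (0 # w @ [0]) = word_size (0 # 1 # w) + 1"
  "word_deficit (0 # w @ [0]) = word_deficit (0 # 1 # w)"
  by (auto simp: word_size_def word_deficit_def dinv_expand)

lemma NU2_stats_a:
  assumes "NU2_cond_a h A"
  shows "word_size (NU2_image_a h A) = word_size (0 # 1 # 2 # NU2_tail_a h A) + 1"
    "word_deficit (NU2_image_a h A) = word_deficit (0 # 1 # 2 # NU2_tail_a h A)"
proof -
  obtain m where m: "h = Suc m" using assms by (cases h) (auto simp: NU2_cond_a_def)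
  show *: "word_size (NU2_image_a h A) = word_size (0 # 1 # 2 # NU2_tail_a h A) + 1"
    by (simp add: m word_size_def NU2_image_a_def NU2_tail_a_def)
  show "word_deficit (NU2_image_a h A) = word_deficit (0 # 1 # 2 # NU2_tail_a h A)"
    unfolding word_deficit_def *
    by (simp add: m NU2_image_a_def NU2_tail_a_def dinv_expand algebra_simps)
qed

lemma NU2_stats_b:
  assumes "NU2_cond_b k B"
  shows "word_size (NU2_image_b k B) = word_size (0 # 1 # 2 # NU2_tail_b k B) + 1"
    "word_deficit (NU2_image_b k B) = word_deficit (0 # 1 # 2 # NU2_tail_b k B)"
proof -
  obtain m where m: "k = Suc m" using assms by (cases k) (auto simp: NU2_cond_b_def)
  show *: "word_size (NU2_image_b k B) = word_size (0 # 1 # 2 # NU2_tail_b k B) + 1"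
    by (simp add: m word_size_def NU2_image_b_def NU2_tail_b_def)
  show "word_deficit (NU2_image_b k B) = word_deficit (0 # 1 # 2 # NU2_tail_b k B)"
    unfolding word_deficit_def *
    by (simp add: m NU2_image_b_def NU2_tail_b_def dinv_expand algebra_simps)
qed

lemma NU_words:
  assumes "(C, D) \<in> NU"
  obtains v w where "is_QDV v" "is_QDV w" "C = dyck_class v" "D = dyck_class w"
    "word_size w = word_size v + 1" "word_deficit w = word_deficit v"
  using assms unfolding NU_def
proof (elim UnE)
  assume "(C, D) \<in> NU1"
  then show thesis using NU1_stats by (elim NU1_cases) (metis that)
next
  assume "(C, D) \<in> NU2"
  then show thesis
  proof (cases rule: NU2_cases)
    case (a h A)
    then show ?thesis using that NU2_tail_a(1) NU2_image_a(1) NU2_stats_a reduced_def by metis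
  next
    case (b k B)
    then show ?thesis using that NU2_tail_b(1) NU2_image_b(1) NU2_stats_b reduced_def by metis
  qed
qed

text \<open>The choice of a word is harmless for statistics invariant under \<open>lift\<close>,
  because a class is a chain of lifts.\<close>

definition class_stat :: "(int list \<Rightarrow> int) \<Rightarrow> int list set \<Rightarrow> int" where
  "class_stat f C = f (SOME v. v \<in> C)"

lemma class_stat_eq:
  assumes "is_QDV v" "\<And>w. f (lift w) = f w" shows "class_stat f (dyck_class v) = f v"
proof -
  define w where "w = (SOME w. w \<in> dyck_class v)"
  have "w \<in> dyck_class v" unfolding w_def using self_in_dyck_class[OF assms(1)] by (rule someI)
  then have w: "is_QDV w" "word_partition w = word_partition v"
    using word_partition_dyck_equiv assms(1) by (auto simp: dyck_class_def)
  then have "dyck_class w = dyck_class v" using dyck_class_eq_iff assms(1) by simp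
  moreover have "f ((lift ^^ i) x) = f x" for i x by (induction i) (auto simp: assms(2))
  ultimately have "f w = f v" using dyck_class_eqD[OF w(1) assms(1)] by metis
  then show ?thesis by (simp add: class_stat_def w_def)
qed

lemma word_size_nonneg:
  assumes "is_QDV v" shows "word_size v \<ge> 0"
proof -
  have "sum_list v \<le> triangle (length v)" if "\<And>i. i < length v \<Longrightarrow> v ! i \<le> int i" for v
    using that
  proof (induction v rule: rev_induct)
    case (snoc x v)
    have "v ! i \<le> int i" if "i < length v" for i using snoc.prems[of i] that by (simp add: nth_append)
    moreover have "x \<le> int (length v)" using snoc.prems[of "length v"] by simp
    ultimately show ?case using snoc.IH by simp
  qed simp
  then show ?thesis using is_QDV_nth_le[OF assms] by (simp add: word_size_def)
qed

lemma ND_size: "(C, D) \<in> ND \<Longrightarrow> class_stat word_size D + 1 = class_stat word_size C \<and> class_stat word_size D \<ge> 0"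
  unfolding ND_def by (auto elim!: NU_words simp: class_stat_eq word_size_nonneg)

lemma ND_deficit: "(C, D) \<in> ND \<Longrightarrow> class_stat word_deficit D = class_stat word_deficit C"
  unfolding ND_def by (auto elim!: NU_words simp: class_stat_eq)

lemma ND_rtrancl_deficit: "(C, D) \<in> ND\<^sup>* \<Longrightarrow> class_stat word_deficit D = class_stat word_deficit C"
  by (induction rule: rtrancl_induct) (auto simp: ND_deficit)

lemma ND_terminates: "\<exists>D. (C, D) \<in> ND\<^sup>* \<and> D \<notin> Domain ND"
proof (induction "nat (class_stat word_size C)" arbitrary: C rule: less_induct)
  case less
  show ?case
  proof (cases "C \<in> Domain ND")
    case True
    then obtain D where D: "(C, D) \<in> ND" by blast
    then have "nat (class_stat word_size D) < nat (class_stat word_size C)" using ND_size by fastforce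
    then show ?thesis using less D by (meson converse_rtrancl_into_rtrancl)
  qed blast
qed

lemma ND_single_valued: "single_valued ND"
  using NU_injective unfolding ND_def single_valued_def by blast

lemma TI2_eqI: "(TI \<mu>, C) \<in> ND\<^sup>* \<Longrightarrow> C \<notin> Domain ND \<Longrightarrow> TI2 \<mu> = C"
  unfolding TI2_def
proof (rule the_equality)
  fix D assume C: "(TI \<mu>, C) \<in> ND\<^sup>*" "C \<notin> Domain ND" and D: "(TI \<mu>, D) \<in> ND\<^sup>* \<and> D \<notin> Domain ND"
  from C(1) D have "(C, D) \<in> ND\<^sup>* \<or> (D, C) \<in> ND\<^sup>*" using single_valued_confluent[OF ND_single_valued] by blast
  then show "D = C" using C(2) D by (metis DomainI converse_rtranclE)
qed simp

lemma TI2: "(TI \<mu>, TI2 \<mu>) \<in> ND\<^sup>*" "TI2 \<mu> \<notin> Domain ND"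
  using ND_terminates[of "TI \<mu>"] TI2_eqI by metis+

section \<open>Orbits\<close>

definition band :: "int \<Rightarrow> int list \<Rightarrow> bool" where
  "band c v \<longleftrightarrow> (\<forall>x\<in>set v. x = c \<or> x = c + 1)"

lemma band_simps [simp]: "band c []" "band c (x # v) \<longleftrightarrow> (x = c \<or> x = c + 1) \<and> band c v"
  "band c (v @ w) \<longleftrightarrow> band c v \<and> band c w"
  by (auto simp: band_def)

lemma band_lower: "band c v \<Longrightarrow> band (c - 1) (lower v)"
  by (auto simp: band_def lower_def)

lemma band_rises: "band c v \<Longrightarrow> rises_by_at_most_1 v"
  by (induction v rule: induct_list012) auto

lemma band_hd_last: "band c v \<Longrightarrow> v \<noteq> [] \<Longrightarrow> hd v = c \<or> hd v = c + 1"
  "band c v \<Longrightarrow> v \<noteq> [] \<Longrightarrow> last v = c \<or> last v = c + 1"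
  by (auto simp: band_def dest: hd_in_set last_in_set)

text \<open>The first map is a rotation: a letter 0 or 1 after the initial 0 goes to the end,
  lowered by 1. For \<open>x = 0\<close> it is applied to the lift 0 1 1 u^+, whose image 0 1 u^+ 0
  is the lift of 0 u -1.\<close>

lemma NU1_rotate:
  assumes "x = 0 \<or> x = 1" "is_QDV (0 # u @ [x - 1])"
  shows "(dyck_class (0 # x # u), dyck_class (0 # u @ [x - 1])) \<in> NU1"
proof (cases "x = 1")
  case False
  then have x: "x = 0" using assms by simp
  have "is_QDV (0 # 0 # u)" using assms x by (cases "u = []") (auto simp: is_QDV_Cons rises_append rises_Cons)
  then have "dyck_class (0 # 0 # u) = dyck_class (0 # 1 # 1 # raise u)"
    using dyck_class_raise[of "0 # u"] by simp
  moreover have "dyck_class (0 # u @ [-1]) = dyck_class (0 # (1 # raise u) @ [0])"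
    using dyck_class_raise[of "u @ [-1]"] assms x by simp
  moreover have "is_QDV (0 # (1 # raise u) @ [0])"
    using is_QDV_lift[OF assms(2)] x by (simp add: lift_def)
  ultimately show ?thesis using NU1_word[of "1 # raise u"] x by simp
qed (use assms NU1_word in simp)

lemma NU_rotate: "x = 0 \<or> x = 1 \<Longrightarrow> is_QDV (0 # u @ [x - 1]) \<Longrightarrow>
    (dyck_class (0 # x # u), dyck_class (0 # u @ [x - 1])) \<in> NU"
  using NU1_rotate by (simp add: NU_def)

lemma NU_rotate_band:
  assumes "band 0 z" "is_QDV (0 # z @ u)" "is_QDV (0 # u @ lower z)"
  shows "(dyck_class (0 # z @ u), dyck_class (0 # u @ lower z)) \<in> NU\<^sup>*"
  using assms
proof (induction z arbitrary: u)
  case (Cons x z)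
  have x: "x = 0 \<or> x = 1" and z: "band 0 z" using Cons.prems(1) by auto
  have q: "is_QDV (0 # (z @ u) @ [x - 1])"
    using Cons.prems(2,3) x band_hd_last[OF z] band_rises[OF z]
    by (cases "z = []"; cases "u = []")
       (auto simp: is_QDV_Cons rises_append rises_Cons hd_append last_append)
  then have "(dyck_class (0 # (x # z) @ u), dyck_class (0 # z @ u @ [x - 1])) \<in> NU"
    using NU_rotate[OF x, of "z @ u"] by simp
  moreover have "(dyck_class (0 # z @ u @ [x - 1]), dyck_class (0 # (u @ [x - 1]) @ lower z)) \<in> NU\<^sup>*"
    using Cons.IH[OF z, of "u @ [x - 1]"] q Cons.prems(3) by simp
  ultimately show ?case by (simp add: converse_rtrancl_into_rtrancl)
qed simp

text \<open>The steps are rotations, interleaved with changes of the representative by a lift. Since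
  \<open>P\<close> has the form 1 P', the result reads 0 0 1 P' 1 Q 0: a leading 1 of
  \<open>P\<close> is consumed and \<open>Q\<close> grows to 1 Q 0.\<close>

lemma NU_cycle:
  assumes P: "band 1 P" "P \<noteq> []" "hd P = 1" and Q: "band 0 Q"
  shows "(dyck_class (0 # 0 # 1 # P @ Q), dyck_class (0 # 0 # P @ 1 # Q @ [0])) \<in> NU\<^sup>*"
proof -
  note r = band_rises[OF P(1)] band_rises[OF Q] band_hd_last[OF P(1)] band_hd_last[OF Q]
  have lP: "last P \<ge> 1" "last P \<le> 2" using r P by auto
  have hQ: "hd Q \<ge> 0" "hd Q \<le> 1" "last Q \<ge> 0" "last Q \<le> 1" if "Q \<noteq> []" using r that by auto
  note S = is_QDV_Cons rises_append rises_Cons hd_append last_append hd_last_raise_lower P(2,3) r(1,2)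
  have "(dyck_class (0 # 0 # 1 # P @ Q), dyck_class (0 # 1 # P @ Q @ [-1])) \<in> NU"
    using NU_rotate[of 0 "1 # P @ Q"] hQ lP by (cases "Q = []") (auto simp: S)
  also have "dyck_class (0 # 1 # P @ Q @ [-1]) = dyck_class (0 # lower P @ lower Q @ [-2])"
    using dyck_class_lower[of "P @ Q @ [-1]"] hQ lP by (cases "Q = []") (auto simp: S)
  also have "(dyck_class (0 # lower P @ lower Q @ [-2]), dyck_class (0 # (lower Q @ [-2]) @ lower (lower P))) \<in> NU\<^sup>*"
    using hQ lP band_lower[OF P(1)] by (intro NU_rotate_band; cases "Q = []") (auto simp: S)
  also have "dyck_class (0 # (lower Q @ [-2]) @ lower (lower P)) = dyck_class (0 # (1 # Q) @ (-1) # lower P)"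
    using dyck_class_raise[of "lower Q @ [-2] @ lower (lower P)"] hQ lP by (cases "Q = []") (auto simp: S)
  also have "(dyck_class (0 # (1 # Q) @ (-1) # lower P), dyck_class (0 # ((-1) # lower P) @ lower (1 # Q))) \<in> NU\<^sup>*"
    using hQ lP Q by (intro NU_rotate_band; cases "Q = []") (auto simp: S)
  also have "dyck_class (0 # ((-1) # lower P) @ lower (1 # Q)) = dyck_class (0 # 1 # 0 # P @ 1 # Q)"
    using dyck_class_raise[of "(-1) # lower P @ lower (1 # Q)"] hQ lP by (cases "Q = []") (auto simp: S)
  also have "(dyck_class (0 # 1 # 0 # P @ 1 # Q), dyck_class (0 # 0 # P @ 1 # Q @ [0])) \<in> NU"
    using NU_rotate[of 1 "0 # P @ 1 # Q"] hQ lP by (cases "Q = []") (auto simp: S)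
  finally show ?thesis .
qed

text \<open>Rotating one 0 produces the trailing -1 that rule (a) with h = 2 expects.\<close>

lemma NU_drop_22:
  assumes "A = [] \<or> (\<forall>x\<in>set A. x \<le> 2) \<and> last A \<ge> 0 \<and> rises_by_at_most_1 A"
  shows "(dyck_class (0 # 0 # 1 # 2 # 2 # A), dyck_class (0 # 0 # 1 # A @ [1, 1])) \<in> NU\<^sup>*"
proof -
  have "NU2_cond_a 2 A" using assms by (auto simp: NU2_cond_a_def)
  then have 1: "(dyck_class (0 # 1 # 2 # 2 # A @ [-1]), dyck_class (0 # 0 # 1 # A @ [1, 1])) \<in> NU"
    using NU2_word_a[of 2 A] by (simp add: NU_def NU2_tail_a_def NU2_image_a_def numeral_2_eq_2)
  have "(dyck_class (0 # 0 # 1 # 2 # 2 # A), dyck_class (0 # 1 # 2 # 2 # A @ [-1])) \<in> NU"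
    using NU_rotate[of 0 "1 # 2 # 2 # A"] assms hd_le[of A 2] hd_le[of A 3]
    by (cases "A = []") (fastforce simp: is_QDV_Cons rises_append rises_Cons hd_append)+
  with 1 show ?thesis by auto
qed

text \<open>Rotating one 0 produces the trailing -1 that rule (b) with k = 1 expects.\<close>

lemma NU_drop_2:
  assumes "B = [] \<or> (\<forall>x\<in>set B. x \<le> 2) \<and> hd B \<le> 1 \<and> last B \<ge> -1 \<and> rises_by_at_most_1 B"
    "B = [] \<or> last B \<ge> 0"
  shows "(dyck_class (0 # 0 # 1 # 2 # B), dyck_class (0 # 0 # B @ [0, 1])) \<in> NU\<^sup>*"
proof -
  have "NU2_cond_b 1 B" using assms by (auto simp: NU2_cond_b_def)
  then have 1: "(dyck_class (0 # 1 # 2 # B @ [-1]), dyck_class (0 # 0 # B @ [0, 1])) \<in> NU"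
    using NU2_word_b[of 1 B] by (simp add: NU_def NU2_tail_b_def NU2_image_b_def)
  have "(dyck_class (0 # 0 # 1 # 2 # B), dyck_class (0 # 1 # 2 # B @ [-1])) \<in> NU"
    using NU_rotate[of 0 "1 # 2 # B"] assms
    by (cases "B = []") (auto simp: is_QDV_Cons rises_append rises_Cons hd_append)
  with 1 show ?thesis by auto
qed

text \<open>These are the words \<open>B_word \<mu>\<close>: the final letter is 1 because the
  largest part occurs.\<close>

definition TI_word :: "int list \<Rightarrow> bool" where
  "TI_word z \<longleftrightarrow> band 0 z \<and> (z = [] \<or> hd z = 0 \<and> last z = 1)"

text \<open>The words \<open>0 0 1 P Q\<close> with \<open>P\<close> over \<open>{1,2}\<close> and \<open>Q\<close> over \<open>{0,1}\<close> are mapped to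
  words of the same kind with shorter \<open>P\<close>.\<close>

lemma NU_reaches_TI_word:
  assumes "band 1 P" "P = [] \<or> last P = 2" "band 0 Q" "P = [] \<longrightarrow> Q = [] \<or> last Q = 1"
  shows "\<exists>z. TI_word z \<and> (dyck_class (0 # 0 # 1 # P @ Q), dyck_class (0 # z)) \<in> NU\<^sup>*"
  using assms
proof (induction "length P" arbitrary: P Q rule: less_induct)
  case less
  have lQ: "Q \<noteq> [] \<Longrightarrow> last Q \<ge> 0 \<and> last Q \<le> 1 \<and> hd Q \<ge> 0 \<and> hd Q \<le> 1" using band_hd_last[OF less.prems(3)] by auto
  \<comment> \<open>A leading 1 is consumed by \<open>NU_cycle\<close>, 2 2 by rule (a), and a 2
    followed by 1 or by the end of \<open>P\<close> by rule (b). The last hypothesis guarantees that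
    once \<open>P\<close> is exhausted \<open>Q\<close> is empty or ends in 1, as
    \<open>TI_word\<close> demands.\<close>
  consider "P = []" | P' where "P = 1 # P'" "P' \<noteq> []" | P' where "P = 2 # 2 # P'" | "P = [2]"
    | P' where "P = 2 # 1 # P'" "P' \<noteq> []"
  proof (cases P)
    case (Cons x P')
    then have x: "x = 1 \<or> x = 2" using less.prems(1) by auto
    show ?thesis
    proof (cases P')
      case Nil then show ?thesis using less.prems(2) Cons that(4) by simp
    next
      case Cons': (Cons y P'')
      then have "y = 1 \<or> y = 2" using less.prems(1) Cons by auto
      moreover have "y = 1 \<longrightarrow> P'' \<noteq> []" using less.prems(2) Cons Cons' by auto
      ultimately show ?thesis using x Cons Cons' that(2,3,5) by blast
    qed
  qed
  then show ?case
  proof cases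
    case 1
    then have "TI_word (0 # 1 # Q)" using less.prems by (auto simp: TI_word_def)
    then show ?thesis using 1 by (intro exI[of _ "0 # 1 # Q"]) simp
  next
    case 2
    have "hd P' = 1 \<or> hd P' = 2" using band_hd_last(1)[of 1 P'] 2 less.prems(1) by auto
    have "(dyck_class (0 # 0 # 1 # P @ Q), dyck_class (0 # 0 # 1 # P' @ 1 # Q @ [0])) \<in> NU\<^sup>*"
      using NU_cycle[of P Q] less.prems 2 by simp
    moreover have "\<exists>z. TI_word z \<and> (dyck_class (0 # 0 # 1 # P' @ (1 # Q @ [0])), dyck_class (0 # z)) \<in> NU\<^sup>*"
      using less.prems 2 by (intro less.hyps) auto
    ultimately show ?thesis by (metis append_assoc append_Cons rtrancl_trans)
  next
    case 3
    have le: "\<forall>x\<in>set (P' @ Q). x \<le> 2" using less.prems 3 by (fastforce simp: band_def)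
    have P': "band 1 P'" using less.prems 3 by simp
    have "rises_by_at_most_1 (P' @ Q)" "P' @ Q \<noteq> [] \<Longrightarrow> last (P' @ Q) \<ge> 0"
      using lQ band_rises[OF P'] band_rises[OF less.prems(3)] band_hd_last[OF P']
      by (cases "P' = []"; cases "Q = []"; auto simp: rises_append last_append)+
    then have "(dyck_class (0 # 0 # 1 # P @ Q), dyck_class (0 # 0 # 1 # (P' @ Q) @ [1, 1])) \<in> NU\<^sup>*"
      using NU_drop_22[of "P' @ Q"] le 3 by auto
    moreover have "\<exists>z. TI_word z \<and> (dyck_class (0 # 0 # 1 # P' @ (Q @ [1, 1])), dyck_class (0 # z)) \<in> NU\<^sup>*"
      using less.prems 3 by (intro less.hyps) (auto split: if_splits)
    ultimately show ?thesis by (metis append_assoc rtrancl_trans)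
  next
    case 4
    have "\<forall>x\<in>set Q. x \<le> 2" using less.prems by (fastforce simp: band_def)
    then have "(dyck_class (0 # 0 # 1 # P @ Q), dyck_class (0 # 0 # Q @ [0, 1])) \<in> NU\<^sup>*"
      using NU_drop_2[of Q] 4 lQ band_rises[OF less.prems(3)] by (cases "Q = []") auto
    moreover have "TI_word (0 # Q @ [0, 1])" using less.prems by (auto simp: TI_word_def)
    ultimately show ?thesis by blast
  next
    case 5
    have le: "\<forall>x\<in>set (1 # P' @ Q). x \<le> 2" using less.prems 5 by (fastforce simp: band_def)
    have P': "band 1 P'" using less.prems 5 by simp
    have "rises_by_at_most_1 (1 # P' @ Q)" "last (1 # P' @ Q) \<ge> 0"
      using 5(2) lQ band_rises[OF P'] band_rises[OF less.prems(3)] band_hd_last[OF P']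
      by (cases "Q = []"; auto simp: rises_append rises_Cons last_append hd_append)+
    then have "(dyck_class (0 # 0 # 1 # P @ Q), dyck_class (0 # 0 # 1 # (P' @ Q) @ [0, 1])) \<in> NU\<^sup>*"
      using NU_drop_2[of "1 # P' @ Q"] le 5 by auto
    moreover have "\<exists>z. TI_word z \<and> (dyck_class (0 # 0 # 1 # P' @ (Q @ [0, 1])), dyck_class (0 # z)) \<in> NU\<^sup>*"
      using less.prems 5 by (intro less.hyps) auto
    ultimately show ?thesis by (metis append_assoc rtrancl_trans)
  qed
qed

text \<open>The forward orbits of the classes \<open>TI \<mu>\<close> stay in this set, on which only \<open>NU\<^sub>1\<close> acts.\<close>

definition tail_classes :: "int list set set" where
  "tail_classes = {dyck_class (0 # u @ lower z) |u z. band 0 u \<and> band 0 z}"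

text \<open>Rotation moves the head of \<open>u\<close> to the lowered tail. When \<open>u\<close>
  is used up, the word 0 z^- lifts to 0 1 z, which supplies a new nonempty head; so the orbit never
  stops.\<close>

lemma tail_classes_step:
  assumes "C \<in> tail_classes" shows "\<exists>D\<in>tail_classes. (C, D) \<in> NU1"
proof -
  have *: "\<exists>D\<in>tail_classes. (dyck_class (0 # u @ lower z), D) \<in> NU1" if "band 0 u" "band 0 z" "u \<noteq> []" for u z
  proof -
    from \<open>u \<noteq> []\<close> obtain x u' where u: "u = x # u'" by (cases u) auto
    with \<open>band 0 u\<close> have x: "x = 0 \<or> x = 1" "band 0 u'" by auto
    have "is_QDV (0 # (u' @ lower z) @ [x - 1])"
      using x band_rises[OF x(2)] band_rises[OF \<open>band 0 z\<close>] band_hd_last[OF x(2)] band_hd_last[OF \<open>band 0 z\<close>]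
      by (cases "u' = []"; cases "z = []")
         (auto simp: is_QDV_Cons rises_append rises_Cons hd_append last_append hd_last_raise_lower)
    then have "(dyck_class (0 # u @ lower z), dyck_class (0 # u' @ lower (z @ [x]))) \<in> NU1"
      using NU1_rotate[OF x(1), of "u' @ lower z"] u by simp
    moreover have "band 0 (z @ [x])" using that x by simp
    ultimately show ?thesis using x(2) unfolding tail_classes_def by blast
  qed
  from assms obtain u z where uz: "C = dyck_class (0 # u @ lower z)" "band 0 u" "band 0 z"
    by (auto simp: tail_classes_def)
  show ?thesis
  proof (cases "u = []")
    case True
    have "is_QDV (0 # lower z)" using band_rises[OF uz(3)] band_hd_last(1)[OF uz(3)]
      by (cases "z = []") (auto simp: is_QDV_Cons hd_last_raise_lower)
    then have "C = dyck_class (0 # (1 # z) @ lower [])" using dyck_class_raise[of "lower z"] uz True by simp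
    then show ?thesis using *[of "1 # z" "[]"] uz by simp
  qed (use * uz in simp)
qed

lemma tail_classes_NU:
  assumes "C \<in> tail_classes" "(C, D) \<in> NU" shows "D \<in> tail_classes \<and> (C, D) \<in> NU1"
  using tail_classes_step[OF assms(1)] assms(2) NU_single_valued by (auto simp: NU_def)

lemma TI_word_tail: "TI_word z \<Longrightarrow> dyck_class (0 # z) \<in> tail_classes"
  unfolding tail_classes_def TI_word_def by (metis (mono_tags, lifting) append.right_neutral band_simps(1) lower_simps(1) mem_Collect_eq)

lemma TI_word_reduced: "TI_word z \<Longrightarrow> reduced (0 # z)"
  by (auto simp: TI_word_def reduced_Cons band_rises)

text \<open>For nonempty \<open>z\<close> the reduced word ends in 1. The class of [0] has size 0,
  so a preimage would have negative size.\<close>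

lemma TI_word_not_NU1_range:
  assumes "TI_word z" shows "(C, dyck_class (0 # z)) \<notin> NU1"
proof
  assume *: "(C, dyck_class (0 # z)) \<in> NU1"
  show False
  proof (cases "z = []")
    case False
    then show ?thesis using NU1_NU2_range_disjoint[OF * TI_word_reduced[OF assms]] assms by (simp add: TI_word_def)
  next
    case True
    have "(dyck_class (0 # z), C) \<in> ND" using * by (simp add: ND_def NU_def)
    then have "class_stat word_size (dyck_class [0]) > 0" using ND_size True by fastforce
    moreover have "class_stat word_size (dyck_class [0]) = word_size [0]"
      by (rule class_stat_eq) (auto simp: is_QDV_Cons)
    ultimately show ?thesis by (simp add: word_size_def)
  qed
qed

text \<open>As \<open>NU\<close> is single-valued, one of the two classes reaches the other. Every
  class strictly after a \<open>TI\<close> class is in the range of \<open>NU1\<close>, where no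
  \<open>TI\<close> class lies.\<close>

lemma TI_word_orbit_unique:
  assumes "(C, dyck_class (0 # z)) \<in> NU\<^sup>*" "(C, dyck_class (0 # z')) \<in> NU\<^sup>*" "TI_word z" "TI_word z'"
  shows "z = z'"
proof -
  have *: "z = z'" if "(dyck_class (0 # z), dyck_class (0 # z')) \<in> NU\<^sup>*" "TI_word z" "TI_word z'" for z z'
  proof -
    have "E = dyck_class (0 # z) \<or> (\<exists>E'. (E', E) \<in> NU1)" if "(dyck_class (0 # z), E) \<in> NU\<^sup>*" for E
    proof -
      have "E \<in> tail_classes \<and> (E = dyck_class (0 # z) \<or> (\<exists>E'. (E', E) \<in> NU1))"
        using that by (induction rule: rtrancl_induct) (use \<open>TI_word z\<close> TI_word_tail tail_classes_NU in blast)+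
      then show ?thesis ..
    qed
    then have "dyck_class (0 # z') = dyck_class (0 # z)" using that TI_word_not_NU1_range by blast
    then show ?thesis using reduced_eqD[OF TI_word_reduced TI_word_reduced] that by blast
  qed
  have "single_valued NU" using NU_single_valued by (auto simp: single_valued_def)
  then show ?thesis using single_valued_confluent[OF _ assms(1,2)] * assms(3,4) by metis
qed

text \<open>Lift until the last entry is 0: the word then has the form 0 w 0, an image under
  \<open>NU1\<close>. The length bound excludes [0].\<close>

lemma last_nonpos_in_Domain_ND:
  assumes "is_QDV v" "length v \<ge> 2" "last v \<le> 0" shows "dyck_class v \<in> Domain ND"
proof -
  define u where "u = (lift ^^ nat (- last v)) v"
  have "v \<noteq> []" using assms by auto
  then have l: "last u = 0" "u \<noteq> []"
    unfolding u_def using last_funpow_lift[of v "nat (- last v)"] assms by auto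
  have q: "is_QDV u" "dyck_class u = dyck_class v"
    unfolding u_def using dyck_equiv_funpow_lift dyck_class_funpow_lift assms by auto
  have "length ((lift ^^ i) v) \<ge> length v" for i by (induction i) auto
  then have "length u \<ge> 2" unfolding u_def using assms(2) le_trans by blast
  then obtain w where "u = 0 # w @ [0]"
    using l q(1) by (cases u; cases "tl u" rule: rev_cases) (auto simp: is_QDV_Cons)
  then show ?thesis using NU1_word[of w] q by (auto simp: ND_def NU_def)
qed

lemma NU2_image_in_Domain_ND:
  "NU2_cond_a h A \<Longrightarrow> dyck_class (NU2_image_a h A) \<in> Domain ND"
  "NU2_cond_b k B \<Longrightarrow> dyck_class (NU2_image_b k B) \<in> Domain ND"
  using NU2_word_a NU2_word_b unfolding ND_def NU_def by blast+

section \<open>Flag words, and classes on which \<open>NU\<close> gets stuck\<close>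

definition flag_words :: "int list set" where
  "flag_words = {0 # 0 # 1 # W @ replicate e 1 |W e. band 1 W \<and> W \<noteq> [] \<and> hd W = 2 \<and> last W = 2 \<and> e \<le> 1}"

lemma flag_word_reduced: "v \<in> flag_words \<Longrightarrow> reduced v"
proof -
  assume "v \<in> flag_words"
  then obtain W e where "v = 0 # 0 # 1 # W @ replicate e 1" "band 1 W" "W \<noteq> []" "hd W = 2" "last W = 2" "e \<le> 1"
    by (auto simp: flag_words_def)
  then show ?thesis using band_rises[of 1 W] by (cases e) (auto simp: reduced_Cons rises_append rises_Cons)
qed

text \<open>The last entry excludes \<open>NU1\<close>. With two leading 0 and at most one trailing
  1, rule (a) lacks trailing 1, and rule (b) would need k = 1 and a 0 before the final 1, where
  \<open>W\<close> has a 2.\<close>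

lemma flag_word_terminal:
  assumes "v \<in> flag_words" shows "dyck_class v \<notin> Domain ND"
proof
  assume "dyck_class v \<in> Domain ND"
  then obtain C where C: "(C, dyck_class v) \<in> NU" by (auto simp: ND_def)
  from assms obtain W e where v: "v = 0 # 0 # 1 # W @ replicate e 1"
    and W: "band 1 W" "W \<noteq> []" "hd W = 2" "last W = 2" and e: "e \<le> 1"
    by (auto simp: flag_words_def)
  have "last v \<ge> 1" using v W by (cases e) auto
  then have "(C, dyck_class v) \<in> NU2"
    using C NU1_NU2_range_disjoint flag_word_reduced[OF assms] by (auto simp: NU_def)
  moreover have "lead 0 v = 2" by (simp add: v lead_def)
  moreover have "v = (0 # 0 # 1 # W) @ replicate e 1" using v by simp
  then have "trail 1 v = e" using W trail_append_replicate[of 1 "0 # 0 # 1 # W" e] trail_eq_0[of "0 # 0 # 1 # W" 1]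
    by simp
  moreover have "False" if "v = NU2_image_b 1 B" "e = 1" for B
  proof -
    have "(0 # 0 # 1 # W) @ [1] = (0 # 0 # B @ [0]) @ [1]" using that v by (simp add: NU2_image_b_def)
    then have "last (0 # 0 # 1 # W) = last (0 # 0 # B @ [0])" by (metis butlast_snoc)
    then show False using W by simp
  qed
  ultimately show False
  proof (cases rule: NU2_cases)
    case (a h A)
    then show ?thesis using NU2_image_a[OF a(1)] reduced_eqD flag_word_reduced[OF assms] e \<open>lead 0 v = 2\<close> \<open>trail 1 v = e\<close>
      by (metis not_less_eq_eq numeral_2_eq_2 One_nat_def order_trans)
  next
    case (b k B)
    then have "v = NU2_image_b k B" using NU2_image_b[OF b(1)] reduced_eqD flag_word_reduced[OF assms] by metis
    moreover from this have "k = e" using NU2_image_b(4)[OF b(1)] \<open>trail 1 v = e\<close> by simp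
    moreover have "k \<ge> 1" using b(1) by (simp add: NU2_cond_b_def)
    ultimately show ?thesis using e \<open>\<And>B. v = NU2_image_b 1 B \<Longrightarrow> e = 1 \<Longrightarrow> False\<close> by (metis le_antisym)
  qed
qed

lemma flag_word_reaches_TI:
  assumes "v \<in> flag_words"
  shows "\<exists>z. TI_word z \<and> (dyck_class v, dyck_class (0 # z)) \<in> NU\<^sup>*"
proof -
  from assms obtain W e where "v = 0 # 0 # 1 # W @ replicate e 1"
    "band 1 W" "W \<noteq> []" "last W = 2" "band 0 (replicate e 1)"
    by (auto simp: flag_words_def band_def)
  then show ?thesis using NU_reaches_TI_word[of W "replicate e 1"] by auto
qed

text \<open>After one step such a class leaves the domain of \<open>NU\<close>.\<close>

lemma large_entry_stuck:
  assumes v: "v = 0 # 0 # 1 # 2 # u" "is_QDV v" "\<forall>x\<in>set u. 0 \<le> x" "\<exists>x\<in>set u. x \<ge> 3"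
    and z: "TI_word z" and reach: "(dyck_class v, dyck_class (0 # z)) \<in> NU\<^sup>*"
  shows False
proof -
  have red: "reduced v" using v by (auto simp: reduced_Cons is_QDV_Cons)
  have "u \<noteq> []" using v(4) by auto
  then have u: "u \<noteq> []" "last u \<ge> 0" "rises_by_at_most_1 (2 # u)"
    using v last_in_set[of u] by (auto simp: is_QDV_Cons)
  let ?w = "0 # 1 # 2 # u @ [-1]"
  have qw: "is_QDV ?w" using u by (auto simp: is_QDV_Cons rises_append rises_Cons hd_append)
  have step: "(dyck_class v, dyck_class ?w) \<in> NU"
    using NU_rotate[of 0 "1 # 2 # u"] qw v(1) by simp
  have last_eq: "x = y" if "(x = (lift ^^ i) y)" "last x = -1" "last y = -1" "y \<noteq> []" for x y i
    using last_funpow_lift[of y i] that by simp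
  have lift_012: "\<exists>x. (lift ^^ i) ?w = 0 # 1 # 2 # x" for i
    by (induction i) (auto simp: lift_def)
  \<comment> \<open>For \<open>NU1\<close> the class would contain 0 1 w with
    \<open>hd w \<le> 1\<close>, but \<open>?w\<close> and its lifts start with 0 1 2, and the last
    entries prevent \<open>?w\<close> from being a proper lift of 0 1 w. For \<open>NU2\<close> the
    word of the class ending in -1 would have no entry above 2.\<close>
  have not_dom: "(dyck_class ?w, D) \<notin> NU" for D
  proof
    assume "(dyck_class ?w, D) \<in> NU"
    then consider "(dyck_class ?w, D) \<in> NU1" | "(dyck_class ?w, D) \<in> NU2" by (auto simp: NU_def)
    then show False
    proof cases
      case 1
      then obtain w where w: "dyck_class ?w = dyck_class (0 # 1 # w)" "is_QDV (0 # w @ [0])" "is_QDV (0 # 1 # w)"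
        by (rule NU1_cases)
      have hw: "w \<noteq> [] \<Longrightarrow> hd w \<le> 1" and lw: "last (0 # 1 # w) \<ge> -1"
        using w(2) by (auto simp: is_QDV_Cons rises_append)
      consider i where "0 # 1 # w = (lift ^^ i) ?w" | i where "?w = (lift ^^ i) (0 # 1 # w)"
        using dyck_class_eqD[OF qw w(3,1)] by blast
      then show False
      proof cases
        case (1 i) then show ?thesis using lift_012[of i] hw by auto
      next
        case (2 i)
        have "last ?w = last (0 # 1 # w) + int i" unfolding 2 using last_funpow_lift by blast
        then have "i = 0" using lw by simp
        then show ?thesis using 2 hw by auto
      qed
    next
      case 2
      then obtain x where x: "is_QDV (0 # 1 # 2 # x)" "\<forall>y\<in>set x. y \<le> 2" "x \<noteq> []" "last x = -1"
        "dyck_class ?w = dyck_class (0 # 1 # 2 # x)"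
        by (cases rule: NU2_cases) (metis NU2_tail_a(1-4), metis NU2_tail_b(1-4))
      have "last (0 # 1 # 2 # x) = -1" "last ?w = -1" using x by auto
      then have "?w = 0 # 1 # 2 # x" using dyck_class_eqD[OF qw x(1,5)] last_eq by blast
      then have "x = u @ [-1]" by simp
      then show False using x(2) v(4) by fastforce
    qed
  qed
  \<comment> \<open>\<open>NU\<close> never stops at a \<open>TI\<close> class, so this class can
    only be that of \<open>v\<close>, which contains a 2.\<close>
  have "dyck_class (0 # z) \<in> Domain NU" using tail_classes_step[OF TI_word_tail[OF z]] by (auto simp: NU_def)
  then have "dyck_class (0 # z) \<noteq> dyck_class ?w" using not_dom by auto
  moreover from reach have "dyck_class (0 # z) = dyck_class v \<or> dyck_class (0 # z) = dyck_class ?w"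
    using step not_dom NU_single_valued by (metis converse_rtranclE)
  ultimately have "0 # z = v" using reduced_eqD[OF TI_word_reduced[OF z] red] by blast
  then show False using v z by (auto simp: TI_word_def)
qed

section \<open>A lower bound for the deficit\<close>

text \<open>The pairs of positions that contribute to neither the area nor the dinv statistic of a word of
  nonnegative integers.\<close>

definition bad :: "int list \<Rightarrow> nat \<Rightarrow> nat \<Rightarrow> bool" where
  "bad v i j \<longleftrightarrow> i < j \<and> j < length v \<and>
     (v ! i > v ! j + 1 \<or> v ! i < v ! j \<and> (\<exists>k. i < k \<and> k < j \<and> v ! k = v ! i))"

definition bad_pairs :: "int list \<Rightarrow> (nat \<times> nat) set" where
  "bad_pairs v = {(i, j). bad v i j}"

lemma bad_less: "bad v i j \<Longrightarrow> i < j \<and> j < length v"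
  by (simp add: bad_def)

lemma finite_bad_pairs [simp]: "finite (bad_pairs v)"
  by (rule finite_subset[of _ "{..<length v} \<times> {..<length v}"]) (auto simp: bad_pairs_def dest: bad_less)

lemma bad_up: "i < k \<Longrightarrow> k < j \<Longrightarrow> j < length v \<Longrightarrow> v ! k = v ! i \<Longrightarrow> v ! i < v ! j \<Longrightarrow> bad v i j"
  by (auto simp: bad_def)

lemma bad_down: "i < j \<Longrightarrow> j < length v \<Longrightarrow> v ! j + 1 < v ! i \<Longrightarrow> bad v i j"
  by (auto simp: bad_def)

text \<open>Take the last position before \<open>j\<close> with an entry at most \<open>y\<close>:
  the next entry exceeds \<open>y\<close> and is at most 1 larger, so the entry is exactly
  \<open>y\<close>.\<close>

lemma last_occurrence:
  assumes v: "is_QDV v" and j: "j < length v" and y: "0 \<le> y" "y < v ! j"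
  obtains l where "l < j" "v ! l = y" "\<And>k. l < k \<Longrightarrow> k \<le> j \<Longrightarrow> y < v ! k"
proof -
  let ?K = "{k. k < j \<and> v ! k \<le> y}"
  have v0: "v ! 0 = 0" using v by (auto simp: is_QDV_def hd_conv_nth)
  then have "j \<noteq> 0" using y by (metis not_less)
  then have K: "finite ?K" "?K \<noteq> {}" using v0 y by auto
  define l where "l = Max ?K"
  have l: "l < j" "v ! l \<le> y" using Max_in[OF K] by (auto simp: l_def)
  have after: "y < v ! k" if "l < k" "k \<le> j" for k
    using Max_ge[OF K(1), of k] that y unfolding l_def[symmetric]
    by (cases "k = j"; cases "v ! k \<le> y") auto
  have "v ! Suc l \<le> v ! l + 1" using v l j by (auto simp: is_QDV_def rises_conv_nth)
  then have "v ! l = y" using after[of "Suc l"] l by auto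
  then show ?thesis by (rule that[OF l(1) _ after])
qed

lemma bad_snoc:
  assumes "j < length v" shows "bad (v @ w) i j \<longleftrightarrow> bad v i j"
proof (cases "i < j")
  case True
  have *: "(v @ w) ! k = v ! k" if "k \<le> j" for k using that assms by (simp add: nth_append)
  have "(\<exists>k. i < k \<and> k < j \<and> (v @ w) ! k = (v @ w) ! i) \<longleftrightarrow> (\<exists>k. i < k \<and> k < j \<and> v ! k = v ! i)"
    using * True by (intro ex_cong1) auto
  then show ?thesis using True assms by (simp add: bad_def *)
qed (simp add: bad_def)

lemma card_bad_pairs_snoc:
  "card (bad_pairs (v @ [x])) = card (bad_pairs v) + card {i. bad (v @ [x]) i (length v)}"
proof -
  let ?B = "{i. bad (v @ [x]) i (length v)}"
  have "bad_pairs (v @ [x]) = bad_pairs v \<union> (\<lambda>i. (i, length v)) ` ?B"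
  proof (intro set_eqI iffI; clarify)
    fix i j assume "(i, j) \<in> bad_pairs (v @ [x])" "(i, j) \<notin> (\<lambda>i. (i, length v)) ` ?B"
    then have b: "bad (v @ [x]) i j" "\<not> (i \<in> ?B \<and> j = length v)" by (auto simp: bad_pairs_def)
    then have "j < length v" using bad_less[OF b(1)] b by (cases "j = length v") auto
    with b(1) show "(i, j) \<in> bad_pairs v" by (simp add: bad_pairs_def bad_snoc)
  next
    fix i j assume "(i, j) \<in> bad_pairs v \<union> (\<lambda>i. (i, length v)) ` ?B"
    then consider "bad v i j" "j < length v" | "j = length v" "i \<in> ?B" using bad_less by (auto simp: bad_pairs_def)
    then show "(i, j) \<in> bad_pairs (v @ [x])"
      by cases (simp_all add: bad_pairs_def bad_snoc)
  qed
  moreover have "bad_pairs v \<inter> (\<lambda>i. (i, length v)) ` ?B = {}" using bad_less by (fastforce simp: bad_pairs_def)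
  moreover have "finite ?B" by (rule finite_subset[of _ "{..<length v}"]) (auto dest: bad_less)
  moreover have "card ((\<lambda>i. (i, length v)) ` ?B) = card ?B" by (rule card_image) (auto simp: inj_on_def)
  ultimately show ?thesis using card_Un_disjoint[of "bad_pairs v" "(\<lambda>i. (i, length v)) ` ?B"] by (simp only: finite_bad_pairs finite_imageI)
qed

lemma dinv_from_conv_card:
  "dinv_from (x + 1) v = int (card {i. i < length v \<and> (v ! i = x \<or> v ! i = x + 1)})"
proof (induction v rule: rev_induct)
  case (snoc y v)
  let ?S = "\<lambda>v. {i. i < length v \<and> (v ! i = x \<or> v ! i = x + 1)}"
  have "?S (v @ [y]) = (if y = x \<or> y = x + 1 then insert (length v) (?S v) else ?S v)"
    by (auto simp: nth_append)
  then show ?case using snoc by (auto simp: dinv_pair_def)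
qed simp

text \<open>Appending \<open>x\<close> splits the earlier positions into \<open>G\<close> (dinv
  pairs), \<open>B\<close> (bad) and \<open>R\<close> (last occurrences of smaller values). Each of
  the values 0, ..., x - 1 has a last occurrence, so \<open>R\<close> has at least \<open>x\<close>
  elements, and the increase \<open>?n - x - card G\<close> of the deficit pays for
  \<open>B\<close>.\<close>

lemma bad_pairs_le_deficit:
  assumes "is_QDV v" "\<forall>x\<in>set v. 0 \<le> x" shows "int (card (bad_pairs v)) \<le> word_deficit v"
  using assms
proof (induction v rule: rev_induct)
  case Nil
  then show ?case by (simp add: is_QDV_def)
next
  case (snoc x v)
  show ?case
  proof (cases "v = []")
    case True
    then have "bad_pairs (v @ [x]) = {}" using bad_less[of "[x]"] by (fastforce simp: bad_pairs_def)
    then show ?thesis using snoc.prems True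
      by (simp add: word_deficit_def word_size_def is_QDV_Cons)
  next
    case False
    let ?n = "length v" and ?u = "v @ [x]"
    have v: "is_QDV v" "\<forall>x\<in>set v. 0 \<le> x"
      using snoc.prems False by (auto simp: is_QDV_def rises_append)
    have x: "0 \<le> x" using snoc.prems by simp
    define G where "G = {i. i < ?n \<and> (v ! i = x \<or> v ! i = x + 1)}"
    define B where "B = {i. bad ?u i ?n}"
    define R where "R = {i. i < ?n \<and> v ! i < x \<and> (\<forall>k. i < k \<and> k < ?n \<longrightarrow> v ! k \<noteq> v ! i)}"
    have bad_last: "bad ?u i ?n \<longleftrightarrow> i < ?n \<and> (v ! i > x + 1 \<or> v ! i < x \<and> (\<exists>k. i < k \<and> k < ?n \<and> v ! k = v ! i))" for i
      unfolding bad_def by (auto simp: nth_append)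
    have "G \<union> B \<union> R = {..<?n}" unfolding G_def B_def R_def bad_last by auto
    moreover have "G \<inter> B = {}" "(G \<union> B) \<inter> R = {}" unfolding G_def B_def R_def bad_last by auto
    moreover have "G \<subseteq> {..<?n}" "B \<subseteq> {..<?n}" "R \<subseteq> {..<?n}" unfolding G_def B_def R_def bad_last by auto
    then have fin: "finite G" "finite B" "finite R" using finite_subset by blast+
    ultimately have sum: "card G + card B + card R = ?n"
      by (metis card_Un_disjoint card_lessThan finite_UnI)
    have "{0..<x} \<subseteq> (\<lambda>i. v ! i) ` R"
    proof
      fix y assume y: "y \<in> {0..<x}"
      then obtain l where "l < ?n" "?u ! l = y" "\<And>k. l < k \<Longrightarrow> k \<le> ?n \<Longrightarrow> y < ?u ! k"
        using last_occurrence[OF snoc.prems(1), of ?n y] by auto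
      then have "l \<in> R" "v ! l = y" using y by (auto simp: R_def nth_append split: if_splits) force
      then show "y \<in> (\<lambda>i. v ! i) ` R" by blast
    qed
    then have "card {0..<x} \<le> card R" using fin surj_card_le by blast
    then have "x \<le> int (card R)" using x by simp
    moreover have "(\<Sum>y\<leftarrow>?u. neg_weight y) = (\<Sum>y\<leftarrow>v. neg_weight y)" using x by (simp add: neg_weight_def)
    then have "word_deficit ?u = word_deficit v + int ?n - x - int (card G)"
      using dinv_from_conv_card[of x v] unfolding word_deficit_def
      by (simp add: word_size_def dinv_expand G_def)
    ultimately show ?thesis using snoc.IH[OF v] sum card_bad_pairs_snoc[of v x]
      unfolding B_def[symmetric] by linarith
  qed
qed

section \<open>Charging bad pairs to reference positions\<close>

definition adjacent :: "int list \<Rightarrow> nat \<Rightarrow> nat \<Rightarrow> bool" where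
  "adjacent v i r \<longleftrightarrow> bad v i r \<or> bad v r i"

definition covered :: "int list \<Rightarrow> nat list \<Rightarrow> nat \<Rightarrow> bool" where
  "covered v rs i \<longleftrightarrow> (\<exists>r s. r \<in> set rs \<and> s \<in> set rs \<and> r \<noteq> s \<and> adjacent v i r \<and> adjacent v i s)"

lemma coveredI: "r \<in> set rs \<Longrightarrow> s \<in> set rs \<Longrightarrow> r \<noteq> s \<Longrightarrow> adjacent v i r \<Longrightarrow> adjacent v i s \<Longrightarrow> covered v rs i"
  by (auto simp: covered_def)

text \<open>A position outside a set of reference positions is charged two bad pairs, each joining it to a
  reference position, so that no pair is charged twice.\<close>

lemma reference_bound:
  assumes rs: "distinct rs" "set rs \<subseteq> {..<length v}"
    and cov: "\<And>i. i < length v \<Longrightarrow> i \<notin> set rs \<Longrightarrow> covered v rs i"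
    and cs: "distinct cs" "\<forall>(i, j)\<in>set cs. bad v i j \<and> i \<in> set rs \<and> j \<in> set rs"
  shows "2 * length v + length cs \<le> card (bad_pairs v) + 2 * length rs"
proof -
  define I where "I = {..<length v} - set rs"
  have "\<forall>i\<in>I. \<exists>q. fst q \<in> set rs \<and> snd q \<in> set rs \<and> fst q \<noteq> snd q \<and>
      adjacent v i (fst q) \<and> adjacent v i (snd q)"
    using cov unfolding covered_def I_def by fastforce
  then obtain f where f: "\<forall>i\<in>I. fst (f i) \<in> set rs \<and> snd (f i) \<in> set rs \<and> fst (f i) \<noteq> snd (f i) \<and>
      adjacent v i (fst (f i)) \<and> adjacent v i (snd (f i))"
    using bchoice by metis
  define r s where "r = fst \<circ> f" and "s = snd \<circ> f"
  have rs': "r i \<in> set rs \<and> s i \<in> set rs \<and> r i \<noteq> s i \<and> adjacent v i (r i) \<and> adjacent v i (s i)"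
    if "i \<in> I" for i using f that by (simp add: r_def s_def)
  \<comment> \<open>A charged pair has exactly one end among the references; so it determines the
    charged position and the reference, and it differs from all pairs in \<open>cs\<close>.\<close>
  define p where "p i x = (min i x, max i x)" for i x :: nat
  have p: "p i x \<in> bad_pairs v" if "adjacent v i x" for i x
    using that by (auto simp: adjacent_def bad_pairs_def p_def bad_def min_def max_def)
  have p_eq: "i = i' \<and> x = x'" if "p i x = p i' x'" "i \<in> I" "i' \<in> I" "x \<in> set rs" "x' \<in> set rs" for i i' x x'
    using that by (auto simp: p_def I_def min_def max_def split: if_splits)
  have p_cs: "p i x \<notin> set cs" if "i \<in> I" "x \<in> set rs" for i x
    using that cs(2) by (auto simp: p_def I_def min_def max_def split: if_splits)
  let ?E = "(\<lambda>i. p i (r i)) ` I" and ?F = "(\<lambda>i. p i (s i)) ` I"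
  have fin: "finite I" by (simp add: I_def)
  have "card ?E = card I" "card ?F = card I"
    using p_eq rs' by (auto intro!: card_image inj_onI)
  moreover have "?E \<inter> ?F = {}" using p_eq rs' by blast
  moreover have "(?E \<union> ?F) \<inter> set cs = {}" using p_cs rs' by blast
  ultimately have "card (?E \<union> ?F \<union> set cs) = 2 * card I + length cs"
    using fin cs(1) by (simp add: card_Un_disjoint distinct_card)
  moreover have "?E \<subseteq> bad_pairs v" "?F \<subseteq> bad_pairs v" using p rs' by blast+
  moreover have "set cs \<subseteq> bad_pairs v" using cs(2) by (auto simp: bad_pairs_def)
  ultimately have "2 * card I + length cs \<le> card (bad_pairs v)"
    by (metis Un_least card_mono finite_bad_pairs)
  moreover have "card I = length v - length rs"
    unfolding I_def using rs by (simp add: card_Diff_subset distinct_card)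
  ultimately show ?thesis by linarith
qed

lemma bad_pairs_take_mono:
  assumes "\<And>j. m \<le> j \<Longrightarrow> j < n \<Longrightarrow> c \<le> card {i. bad v i j}" "m \<le> n" "n \<le> length v"
  shows "card (bad_pairs (take m v)) + c * (n - m) \<le> card (bad_pairs (take n v))"
  using assms(2,1,3)
proof (induction n rule: dec_induct)
  case (step n)
  have "take (Suc n) v = take n v @ [v ! n]" using step by (simp add: take_Suc_conv_app_nth)
  moreover have "bad (take (Suc n) v) i n = bad v i n" for i
    using step bad_snoc[of n "take (Suc n) v" "drop (Suc n) v" i] by simp
  then have "{i. bad (take n v @ [v ! n]) i (length (take n v))} = {i. bad v i n}"
    using step calculation by simp
  ultimately have "card (bad_pairs (take (Suc n) v)) = card (bad_pairs (take n v)) + card {i. bad v i n}"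
    using card_bad_pairs_snoc[of "take n v" "v ! n"] by simp
  moreover have "c \<le> card {i. bad v i n}" using step.prems(1)[of n] step.hyps by simp
  moreover have "card (bad_pairs (take m v)) + c * (n - m) \<le> card (bad_pairs (take n v))" using step by simp
  ultimately show ?case using Suc_diff_le[OF step.hyps(1)] by simp
qed simp

text \<open>Positions that are each the right end of two bad pairs can be appended at no cost: any
  bound of twice the length by the bad pairs plus a constant survives.\<close>

lemma bad_pairs_extend:
  assumes "\<And>j. m \<le> j \<Longrightarrow> j < length v \<Longrightarrow> \<exists>i i'. i \<noteq> i' \<and> bad v i j \<and> bad v i' j" "m \<le> length v"
  shows "card (bad_pairs (take m v)) + 2 * (length v - m) \<le> card (bad_pairs v)"
proof -
  have two: "2 \<le> card {i. bad v i j}" if j: "m \<le> j" "j < length v" for j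
  proof -
    obtain i i' where i: "i \<noteq> i'" "bad v i j" "bad v i' j" using assms(1)[OF j] by blast
    have "finite {i. bad v i j}" by (rule finite_subset[of _ "{..<j}"]) (auto dest: bad_less)
    then have "card {i, i'} \<le> card {i. bad v i j}" using i by (intro card_mono) auto
    then show ?thesis using i by simp
  qed
  show ?thesis using bad_pairs_take_mono[OF two assms(2) order_refl] by simp
qed

text \<open>Meant for nonnegative words starting 0 0. Among those of length at least 4, only the
  ones starting 0 0 1 2 without a further 0 are not \<open>wide\<close>.\<close>

definition wide :: "int list \<Rightarrow> bool" where
  "wide v \<longleftrightarrow> (\<exists>p\<ge>2. p < length v \<and> v ! p = 0) \<or> 3 < length v \<and> v ! 2 = 1 \<and> v ! 3 = 1"

text \<open>In both cases there are five references with four bad pairs among them, whence 10 - 4 =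
  6.\<close>

lemma wide_bound:
  assumes v: "is_QDV v" "\<forall>x\<in>set v. 0 \<le> x" "length v \<ge> 2" "v ! 1 = 0" "wide v" "last v \<ge> 2"
  shows "2 * length v \<le> card (bad_pairs v) + 6"
proof -
  let ?n = "length v"
  define j where "j = ?n - 1"
  have v0: "v ! 0 = 0" using v by (auto simp: is_QDV_def hd_conv_nth)
  have nn: "0 \<le> v ! i" if "i < ?n" for i using v(2) that by simp
  have j: "j < ?n" "v ! j \<ge> 2" using v by (auto simp: j_def last_conv_nth simp flip: length_0_conv)
  have jmax: "i < j" if "i < ?n" "i \<noteq> j" for i using that j_def by auto
  obtain l1 where l1: "l1 < j" "v ! l1 = 1" "\<And>k. l1 < k \<Longrightarrow> k \<le> j \<Longrightarrow> 1 < v ! k"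
    using last_occurrence[OF v(1) j(1), of 1] j by auto
  show ?thesis
  proof (cases "\<exists>p\<ge>2. p < ?n \<and> v ! p = 0")
    case True
    then obtain p where p: "2 \<le> p" "p < ?n" "v ! p = 0" by blast
    obtain l0 where l0: "l0 < j" "v ! l0 = 0" "\<And>k. l0 < k \<Longrightarrow> k \<le> j \<Longrightarrow> 0 < v ! k"
      using last_occurrence[OF v(1) j(1), of 0] j by auto
    have "\<not> l0 < p" using l0(3)[of p] p jmax[of p] j by (cases "p = j") auto
    then have l0_2: "2 \<le> l0" using p by simp
    have "\<not> l1 < l0" "l1 \<noteq> l0" using l1(3)[of l0] l0 l1 by auto
    then have l01: "l0 < l1" by simp
    \<comment> \<open>The references are the initial 0 0, the last 0, the last 1 and the end. A
      further 0 is charged to the last 1 and the end, a further 1 to position 0 and the end, a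
      larger entry to position 0 and to the last 0 or position 1, depending on its side of the last
      0.\<close>
    have "2 * length v + length [(0::nat, l1), (0, j), (1, l1), (1, j)] \<le> card (bad_pairs v) + 2 * length [0, 1, l0, l1, j]"
    proof (rule reference_bound)
      show "distinct [0, 1, l0, l1, j]" "set [0, 1, l0, l1, j] \<subseteq> {..<?n}"
        "distinct [(0::nat, l1), (0, j), (1, l1), (1, j)]"
        using l0_2 l01 l1 j v(3) by auto
      show "\<forall>(i, k)\<in>set [(0::nat, l1), (0, j), (1, l1), (1, j)]. bad v i k \<and> i \<in> set [0, 1, l0, l1, j] \<and> k \<in> set [0, 1, l0, l1, j]"
        using bad_up[of 0 1 l1] bad_up[of 0 1 j] bad_up[of 1 l0 l1] bad_up[of 1 l0 j] l0_2 l01 l1(1,2) l0(2) j v0 v(4)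
        by auto
      fix i assume i: "i < ?n" "i \<notin> set [0, 1, l0, l1, j]"
      then have ij: "i < j" "i > 1" using jmax by auto
      consider "v ! i = 0" | "v ! i = 1" | "v ! i \<ge> 2" using nn[OF i(1)] by linarith
      then show "covered v [0, 1, l0, l1, j] i"
      proof cases
        case 1
        then have "\<not> l0 < i" using l0(3)[of i] ij by auto
        then have "i < l0" using i(2) by auto
        then show ?thesis using 1 bad_up[of i l0 l1] bad_up[of i l0 j] l01 l1 l0(2) j
          by (intro coveredI[of l1 _ j]) (auto simp: adjacent_def)
      next
        case 2
        then have "\<not> l1 < i" using l1(3)[of i] ij by auto
        then have "i < l1" using i(2) by auto
        then show ?thesis using 2 bad_up[of i l1 j] bad_up[of 0 1 i] l1 v0 v(4) i ij j
          by (intro coveredI[of 0 _ j]) (auto simp: adjacent_def)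
      next
        case 3
        then have "adjacent v i 0" using bad_up[of 0 1 i] v0 v(4) i ij by (auto simp: adjacent_def)
        moreover have "adjacent v i l0 \<or> adjacent v i 1"
          using bad_down[of i l0] bad_up[of 1 l0 i] l0 l0_2 l01 l1 j i 3 v(4) by (cases "i < l0") (auto simp: adjacent_def)
        ultimately show ?thesis using l0_2 coveredI[of 0 "[0, 1, l0, l1, j]" l0 v i] coveredI[of 0 "[0, 1, l0, l1, j]" 1 v i] by auto
      qed
    qed
    then show ?thesis by simp
  next
    case False
    then have w: "3 < ?n" "v ! 2 = 1" "v ! 3 = 1" using v(5) by (auto simp: wide_def)
    have j3: "3 < j" using w j j_def by (cases "j = 3") auto
    have l1_3: "3 \<le> l1" using l1(3)[of 3] w j3 by (cases "l1 < 3") auto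
    \<comment> \<open>Without a third 0 the repeated 1 in positions 2 and 3 takes over: larger
      entries after it are bad with position 2.\<close>
    have "2 * length v + length [(0::nat, 2::nat), (0, l1), (0, j), (2, j)] \<le> card (bad_pairs v) + 2 * length [0, 1, 2, l1, j]"
    proof (rule reference_bound)
      show "distinct [0, 1, 2, l1, j]" "set [0, 1, 2, l1, j] \<subseteq> {..<?n}"
        "distinct [(0::nat, 2::nat), (0, l1), (0, j), (2, j)]"
        using l1_3 l1 j v(3) by auto
      show "\<forall>(i, k)\<in>set [(0::nat, 2::nat), (0, l1), (0, j), (2, j)]. bad v i k \<and> i \<in> set [0, 1, 2, l1, j] \<and> k \<in> set [0, 1, 2, l1, j]"
        using bad_up[of 0 1 2] bad_up[of 0 1 l1] bad_up[of 0 1 j] bad_up[of 2 3 j] l1_3 l1(1,2) j j3 w v0 v(4)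
        by auto
      fix i assume i: "i < ?n" "i \<notin> set [0, 1, 2, l1, j]"
      then have ij: "i < j" "i > 2" using jmax by auto
      then have "v ! i \<noteq> 0" using False i by auto
      then have i0: "adjacent v i 0" using bad_up[of 0 1 i] nn[OF i(1)] v0 v(4) i ij by (auto simp: adjacent_def)
      consider "v ! i = 1" | "v ! i \<ge> 2" using nn[OF i(1)] \<open>v ! i \<noteq> 0\<close> by linarith
      then show "covered v [0, 1, 2, l1, j] i"
      proof cases
        case 1
        then have "\<not> l1 < i" using l1(3)[of i] ij by auto
        then have "i < l1" using i(2) by auto
        then show ?thesis using 1 bad_up[of i l1 j] l1 i ij j i0
          by (intro coveredI[of 0 _ j]) (auto simp: adjacent_def)
      next
        case 2
        then have "i \<noteq> 3" using w by auto
        then show ?thesis using 2 bad_up[of 2 3 i] w i ij i0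
          by (intro coveredI[of 0 _ 2]) (auto simp: adjacent_def)
      qed
    qed
    then show ?thesis by simp
  qed
qed

section \<open>Terminal words of small deficit\<close>

lemma last_before:
  assumes "is_QDV v" "j < length v" "0 \<le> y" "y < v ! j"
  obtains l where "l < j" "v ! l = y" "\<And>i. i \<le> j \<Longrightarrow> v ! i \<le> y \<Longrightarrow> i \<le> l"
proof (rule last_occurrence[OF assms])
  fix l assume l: "l < j" "v ! l = y" "\<And>k. l < k \<Longrightarrow> k \<le> j \<Longrightarrow> y < v ! k"
  show thesis
  proof (rule that[OF l(1,2)])
    fix i assume "i \<le> j" "v ! i \<le> y"
    then show "i \<le> l" using l(3)[of i] by (cases "l < i") auto
  qed
qed

lemma adjacent_up: "i < k \<Longrightarrow> k < j \<Longrightarrow> j < length v \<Longrightarrow> v ! k = v ! i \<Longrightarrow> v ! i < v ! j \<Longrightarrow> adjacent v i j \<and> adjacent v j i"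
  using bad_up by (auto simp: adjacent_def)

lemma adjacent_down: "i < j \<Longrightarrow> j < length v \<Longrightarrow> v ! j + 1 < v ! i \<Longrightarrow> adjacent v i j \<and> adjacent v j i"
  using bad_down by (auto simp: adjacent_def)

text \<open>The initial 0 1, the last occurrences of 0, 1 and 2, and the end are six references with
  five bad pairs among them, whence 12 - 5 = 7.\<close>

lemma start01_bound_3:
  assumes v: "is_QDV v" "\<forall>x\<in>set v. 0 \<le> x" "length v \<ge> 2" "v ! 1 = 1" "last v \<ge> 3"
    and p: "2 \<le> p" "p < length v" "v ! p = 0"
  shows "2 * length v \<le> card (bad_pairs v) + 7"
proof -
  let ?n = "length v"
  define j where "j = ?n - 1"
  have v0: "v ! 0 = 0" using v by (auto simp: is_QDV_def hd_conv_nth)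
  have nn: "0 \<le> v ! i" if "i < ?n" for i using v(2) that by simp
  have j: "j < ?n" "v ! j \<ge> 3" using v by (auto simp: j_def last_conv_nth simp flip: length_0_conv)
  have ij: "i \<le> j" if "i < ?n" for i using that j_def by auto
  obtain l0 where l0: "l0 < j" "v ! l0 = 0" "\<And>i. i \<le> j \<Longrightarrow> v ! i \<le> 0 \<Longrightarrow> i \<le> l0"
    using last_before[OF v(1) j(1), of 0] j(2) by auto
  obtain l1 where l1: "l1 < j" "v ! l1 = 1" "\<And>i. i \<le> j \<Longrightarrow> v ! i \<le> 1 \<Longrightarrow> i \<le> l1"
    using last_before[OF v(1) j(1), of 1] j(2) by auto
  obtain l2 where l2: "l2 < j" "v ! l2 = 2" "\<And>i. i \<le> j \<Longrightarrow> v ! i \<le> 2 \<Longrightarrow> i \<le> l2"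
    using last_before[OF v(1) j(1), of 2] j(2) by auto
  have "p \<le> l0" "l0 \<le> l1" "l1 \<le> l2" "l0 \<noteq> l1" "l1 \<noteq> l2"
    using l0(3)[OF ij[OF p(2)]] p l1(3)[of l0] l2(3)[of l1] l0(1,2) l1(1,2) l2(1,2) by auto
  then have o: "2 \<le> l0" "l0 < l1" "l1 < l2" using p(1) by auto
  let ?rs = "[0, 1, l0, l1, l2, j]" and ?cs = "[(0 :: nat, l1), (0, l2), (0, j), (1, l2), (1, j)]"
  have "2 * length v + length ?cs \<le> card (bad_pairs v) + 2 * length ?rs"
  proof (rule reference_bound)
    show "distinct ?rs" "set ?rs \<subseteq> {..<?n}" "distinct ?cs" using o l2(1) j(1) by auto
    show "\<forall>(i, k)\<in>set ?cs. bad v i k \<and> i \<in> set ?rs \<and> k \<in> set ?rs"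
      using bad_up[of 0 l0 l1] bad_up[of 0 l0 l2] bad_up[of 0 l0 j] bad_up[of 1 l1 l2] bad_up[of 1 l1 j]
        o l0(2) l1(2) l2(1,2) j v0 v(4) by auto
    fix i assume i: "i < ?n" "i \<notin> set ?rs"
    then have i1: "1 < i" "i < j" using ij[of i] by auto
    consider "v ! i = 0" | "v ! i = 1" | "v ! i = 2" | "v ! i \<ge> 3" using nn[OF i(1)] by linarith
    then show "covered v ?rs i"
    proof cases
      case 1
      then have "i < l0" using l0(3)[of i] i i1 by (auto simp: le_less)
      then show ?thesis using 1 adjacent_up[of i l0 l1] adjacent_up[of i l0 j] o l0(2) l1(2) l2(1) j
        by (intro coveredI[of l1 _ j]) auto
    next
      case 2
      then have "i < l1" using l1(3)[of i] i i1 by (auto simp: le_less)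
      then show ?thesis using 2 adjacent_up[of i l1 l2] adjacent_up[of i l1 j] o l1(2) l2(1,2) j
        by (intro coveredI[of l2 _ j]) auto
    next
      case 3
      then have "i < l2" using l2(3)[of i] i i1 by (auto simp: le_less)
      then have ij: "adjacent v i j" using 3 adjacent_up[of i l2 j] l2(1,2) j by auto
      show ?thesis
      proof (cases "i < l0")
        case True
        then show ?thesis using 3 ij adjacent_down[of i l0] l0(1,2) j(1) o by (intro coveredI[of l0 _ j]) auto
      next
        case False
        then have "l0 < i" using i by auto
        then show ?thesis using 3 ij adjacent_up[of 0 l0 i] l0(1,2) i(1) o v0 j by (intro coveredI[of 0 _ j]) auto
      qed
    next
      case 4
      show ?thesis
      proof (cases "i < l0")
        case True
        then show ?thesis using 4 adjacent_down[of i l0] adjacent_down[of i l1] l0(1,2) l1(1,2) j(1) o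
          by (intro coveredI[of l0 _ l1]) auto
      next
        case False
        then have "l0 < i" using i by auto
        moreover obtain l where l: "l < i" "v ! l = 1" "\<And>k. k \<le> i \<Longrightarrow> v ! k \<le> 1 \<Longrightarrow> k \<le> l"
          using last_before[OF v(1) i(1), of 1] 4 by auto
        moreover have "l0 < l" using l(3)[of l0] \<open>l0 < i\<close> l0(2) l(2) by (auto simp: le_less)
        ultimately show ?thesis using 4 adjacent_up[of 0 l0 i] adjacent_up[of 1 l i] l0(1,2) i(1) o v0 v(4)
          by (intro coveredI[of 0 _ 1]) auto
      qed
    qed
  qed
  then show ?thesis by simp
qed

text \<open>With last entry 2 there is no separate last occurrence of 2 to refer to.
  \<open>alt\<close> supplies a substitute: an early second 0, a second 2 near the end, or an entry
  \<open>e\<close> of at least 3. The constant is 10 - 3, 12 - 5 or 14 - 7.\<close>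

lemma start01_bound_2:
  assumes v: "is_QDV v" "\<forall>x\<in>set v. 0 \<le> x" "length v \<ge> 3" "v ! 1 = 1" "last v = 2"
    and p: "2 \<le> p" "p < length v" "v ! p = 0"
    and alt: "v ! 2 = 0 \<or> v ! 2 = 1 \<and> (v ! (length v - 2) = 2 \<or> (\<exists>x\<in>set v. x \<ge> 3))"
  shows "2 * length v \<le> card (bad_pairs v) + 7"
proof -
  let ?n = "length v"
  define j where "j = ?n - 1"
  have v0: "v ! 0 = 0" using v by (auto simp: is_QDV_def hd_conv_nth)
  have nn: "0 \<le> v ! i" if "i < ?n" for i using v(2) that by simp
  have "v \<noteq> []" using v(3) by auto
  then have j: "j < ?n" "v ! j = 2" using v(5) by (auto simp: j_def last_conv_nth)
  have ij: "i \<le> j" if "i < ?n" for i using that j_def by auto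
  obtain l0 where l0: "l0 < j" "v ! l0 = 0" "\<And>i. i \<le> j \<Longrightarrow> v ! i \<le> 0 \<Longrightarrow> i \<le> l0"
    using last_before[OF v(1) j(1), of 0] j(2) by auto
  obtain l1 where l1: "l1 < j" "v ! l1 = 1" "\<And>i. i \<le> j \<Longrightarrow> v ! i \<le> 1 \<Longrightarrow> i \<le> l1"
    using last_before[OF v(1) j(1), of 1] j(2) by auto
  have "p \<le> l0" "l0 \<le> l1" "l0 \<noteq> l1"
    using l0(3)[OF ij[OF p(2)]] p l1(3)[of l0] l0(1,2) l1(1,2) by auto
  then have o: "2 \<le> l0" "l0 < l1" using p(1) by auto
  have b: "bad v 0 l1" "bad v 0 j" "bad v 1 j"
    using bad_up[of 0 l0 l1] bad_up[of 0 l0 j] bad_up[of 1 l1 j] o l0(2) l1(1,2) j v0 v(4) by auto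
  have adj_0: "adjacent v i l1 \<and> adjacent v i j" if "v ! i = 0" "i < ?n" "i \<noteq> l0" for i
  proof -
    have "i < l0" using l0(3)[of i] that ij by (auto simp: le_less)
    then show ?thesis using that adjacent_up[of i l0 l1] adjacent_up[of i l0 j] o l0(2) l1(1,2) j by auto
  qed
  have adj_1: "i < l1 \<and> adjacent v i j" if "v ! i = 1" "i < ?n" "i \<noteq> l1" for i
  proof -
    have "i < l1" using l1(3)[of i] that ij by (auto simp: le_less)
    then show ?thesis using that adjacent_up[of i l1 j] l1(1,2) j by auto
  qed
  have adj_big: "if i < l0 then adjacent v i l0 else adjacent v i 0" if "v ! i \<ge> 2" "i < ?n" for i
  proof -
    have "i \<noteq> l0" using that l0 by auto
    then show ?thesis using that adjacent_down[of i l0] adjacent_up[of 0 l0 i] l0(1,2) o j(1) v0 by auto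
  qed
  consider (a) "v ! 2 = 0" | (b) "v ! 2 = 1" "v ! (?n - 2) = 2" | (c) "v ! 2 = 1" "\<exists>x\<in>set v. x \<ge> 3"
    using alt by blast
  then show ?thesis
  proof cases
    case a
    let ?rs = "[0, 1, l0, l1, j]" and ?cs = "[(0 :: nat, l1), (0, j), (1, j)]"
    have "2 * length v + length ?cs \<le> card (bad_pairs v) + 2 * length ?rs"
    proof (rule reference_bound)
      show "distinct ?rs" "set ?rs \<subseteq> {..<?n}" "distinct ?cs" using o l1(1) j(1) by auto
      show "\<forall>(i, k)\<in>set ?cs. bad v i k \<and> i \<in> set ?rs \<and> k \<in> set ?rs" using b by auto
      fix i assume i: "i < ?n" "i \<notin> set ?rs"
      then have i1: "1 < i" "i < j" using ij[of i] by auto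
      consider "v ! i = 0" | "v ! i = 1" | "v ! i \<ge> 2" using nn[OF i(1)] by linarith
      then show "covered v ?rs i"
      proof cases
        case 1
        then show ?thesis using adj_0[of i] i l1(1) by (intro coveredI[of l1 _ j]) auto
      next
        case 2
        then have "2 < i" using a i1 by (cases "i = 2") auto
        then have "adjacent v i 0" using 2 i a v0 adjacent_up[of 0 2 i] by auto
        then show ?thesis using 2 adj_1[of i] i i1 by (intro coveredI[of 0 _ j]) auto
      next
        case 3
        then have "2 < i" using a i1 by (cases "i = 2") auto
        moreover obtain l where l: "l < i" "v ! l = 1" "\<And>k. k \<le> i \<Longrightarrow> v ! k \<le> 1 \<Longrightarrow> k \<le> l"
          using last_before[OF v(1) i(1), of 1] 3 by auto
        moreover have "2 \<le> l" using l(3)[of 2] \<open>2 < i\<close> a by auto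
        ultimately show ?thesis using 3 i a v0 v(4) adjacent_up[of 0 2 i] adjacent_up[of 1 l i]
          by (intro coveredI[of 0 _ 1]) auto
      qed
    qed
    then show ?thesis by simp
  next
    case b': b
    define m where "m = ?n - 2"
    have m: "l1 < m" "m < j" "v ! m = 2"
      using l1(1) l1(2) b' v(3) unfolding m_def j_def
      by (cases "l1 = ?n - 2"; auto)+
    let ?rs = "[0, 1, l0, l1, j, m]" and ?cs = "[(0 :: nat, l1), (0, j), (1, j), (0, m), (1, m)]"
    have "2 * length v + length ?cs \<le> card (bad_pairs v) + 2 * length ?rs"
    proof (rule reference_bound)
      show "distinct ?rs" "set ?rs \<subseteq> {..<?n}" "distinct ?cs" using o l1(1) j(1) m by auto
      show "\<forall>(i, k)\<in>set ?cs. bad v i k \<and> i \<in> set ?rs \<and> k \<in> set ?rs"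
        using b bad_up[of 0 l0 m] bad_up[of 1 l1 m] o l0(2) l1(2) m j v0 v(4) by auto
      fix i assume i: "i < ?n" "i \<notin> set ?rs"
      then have i1: "1 < i" "i < j" using ij[of i] by auto
      consider "v ! i = 0" | "v ! i = 1" | "v ! i \<ge> 2" using nn[OF i(1)] by linarith
      then show "covered v ?rs i"
      proof cases
        case 1
        then show ?thesis using adj_0[of i] i l1(1) by (intro coveredI[of l1 _ j]) auto
      next
        case 2
        then show ?thesis using adj_1[of i] i adjacent_up[of i l1 m] l1(2) m j by (intro coveredI[of j _ m]) auto
      next
        case 3
        then have "2 < i" using b' i1 by (cases "i = 2") auto
        then have "adjacent v i 1" using 3 i b' v(4) adjacent_up[of 1 2 i] by auto
        then show ?thesis using adj_big[of i] 3 i o coveredI[of l0 ?rs 1 v i] coveredI[of 0 ?rs 1 v i]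
          by (auto split: if_splits)
      qed
    qed
    then show ?thesis by simp
  next
    case c
    then obtain e where e: "e < ?n" "v ! e \<ge> 3" by (auto simp: in_set_conv_nth)
    have "e \<noteq> 0" "e \<noteq> 1" "e \<noteq> 2" using e c(1) v0 v(4) by (intro notI; simp)+
    then have e3: "2 < e" by linarith
    have ej: "e < j" "e \<noteq> l0" "e \<noteq> l1" using e ij[of e] j l0(2) l1(2) by (auto simp: le_less)
    have b1e: "bad v 1 e" using bad_up[of 1 2 e] e e3 c v(4) by auto
    obtain l where l: "l < e" "v ! l = 1" "\<And>k. k \<le> e \<Longrightarrow> v ! k \<le> 1 \<Longrightarrow> k \<le> l"
      using last_before[OF v(1) e(1), of 1] e(2) by auto
    have l2: "2 \<le> l" using l(3)[of 2] c e3 by auto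
    have big: "covered v rs i" if "v ! i \<ge> 2" "i < ?n" "2 < i" "{0, 1, l0} \<subseteq> set rs" for i rs
    proof -
      have "adjacent v i 1" using that c v(4) adjacent_up[of 1 2 i] by auto
      then show ?thesis using adj_big[OF that(1,2)] that(4) o coveredI[of l0 rs 1 v i] coveredI[of 0 rs 1 v i]
        by (auto split: if_splits)
    qed
    show ?thesis
    \<comment> \<open>If \<open>e\<close> precedes the last 0, position 0 need not be bad with
      \<open>e\<close>; instead \<open>e\<close> is bad with the last 0 and the last 1. The last 1
      before \<open>e\<close>, the only earlier 1 not bad with \<open>e\<close>, then has to be a
      reference itself.\<close>
    proof (cases "e < l0")
      case False
      then have el0: "l0 < e" using ej by auto
      then have ll0: "l0 < l" using l(3)[of l0] l0(2) l(2) by (auto simp: le_less)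
      let ?rs = "[0, 1, l0, l1, j, e]" and ?cs = "[(0 :: nat, l1), (0, j), (1, j), (0, e), (1, e)]"
      have "2 * length v + length ?cs \<le> card (bad_pairs v) + 2 * length ?rs"
      proof (rule reference_bound)
        show "distinct ?rs" "set ?rs \<subseteq> {..<?n}" "distinct ?cs" using o l1(1) j(1) e ej e3 by auto
        show "\<forall>(i, k)\<in>set ?cs. bad v i k \<and> i \<in> set ?rs \<and> k \<in> set ?rs"
          using b b1e bad_up[of 0 l0 e] o el0 l0(2) e v0 by auto
        fix i assume i: "i < ?n" "i \<notin> set ?rs"
        then have i1: "1 < i" "i < j" using ij[of i] by auto
        consider "v ! i = 0" | "v ! i = 1" | "v ! i \<ge> 2" using nn[OF i(1)] by linarith
        then show "covered v ?rs i"
        proof cases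
          case 1
          then show ?thesis using adj_0[of i] i l1(1) by (intro coveredI[of l1 _ j]) auto
        next
          case 2
          then have aj: "adjacent v i j" using adj_1[of i] i by auto
          show ?thesis
          proof (cases "i < l0")
            case True
            then show ?thesis using 2 aj ej e l(1,2) ll0 adjacent_up[of i l e] by (intro coveredI[of e _ j]) auto
          next
            case False
            then have "l0 < i" using i by auto
            then show ?thesis using 2 aj j i i1 l0(2) v0 o adjacent_up[of 0 l0 i] by (intro coveredI[of 0 _ j]) auto
          qed
        next
          case 3
          then show ?thesis using big[of i] i i1 c by (cases "i = 2") auto
        qed
      qed
      then show ?thesis by simp
    next
      case True
      let ?rs = "[0, 1, l0, l1, j, e, l]"
      let ?cs = "[(0 :: nat, l1), (0, j), (1, j), (1, e), (e, l0), (e, l1), (l, j)]"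
      have "2 * length v + length ?cs \<le> card (bad_pairs v) + 2 * length ?rs"
      proof (rule reference_bound)
        show "distinct ?rs" "set ?rs \<subseteq> {..<?n}" "distinct ?cs" using o l1(1) j(1) e ej e3 True l(1) l2 by auto
        have "bad v l j" using bad_up[of l l1 j] l(1,2) l1(1,2) True o j by auto
        then show "\<forall>(i, k)\<in>set ?cs. bad v i k \<and> i \<in> set ?rs \<and> k \<in> set ?rs"
          using b b1e bad_down[of e l0] bad_down[of e l1] True o l0(1,2) l1(1,2) e j by auto
        fix i assume i: "i < ?n" "i \<notin> set ?rs"
        then have i1: "1 < i" "i < j" using ij[of i] by auto
        consider "v ! i = 0" | "v ! i = 1" | "v ! i \<ge> 2" using nn[OF i(1)] by linarith
        then show "covered v ?rs i"
        proof cases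
          case 1
          then show ?thesis using adj_0[of i] i l1(1) by (intro coveredI[of l1 _ j]) auto
        next
          case 2
          then have aj: "adjacent v i j" using adj_1[of i] i by auto
          have "adjacent v i e"
          proof (cases "i < e")
            case True
            then have "i < l" using l(3)[of i] 2 i by (auto simp: le_less)
            then show ?thesis using 2 l(1,2) e adjacent_up[of i l e] by auto
          next
            case False
            then have "e < i" using i by auto
            then show ?thesis using 2 e i adjacent_down[of e i] by auto
          qed
          then show ?thesis using aj ej by (intro coveredI[of e _ j]) auto
        next
          case 3
          then show ?thesis using big[of i] i i1 c by (cases "i = 2") auto
        qed
      qed
      then show ?thesis by simp
    qed
  qed
qed

section \<open>Words ending in 1 that are not images of the second map\<close>

lemma lead_decomp: "v = replicate (lead c v) c @ dropWhile (\<lambda>x. x = c) v"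
proof -
  have "takeWhile (\<lambda>x. x = c) v = replicate (lead c v) c"
    unfolding lead_def by (rule replicate_eqI) (auto dest: set_takeWhileD)
  then show ?thesis by (metis takeWhile_dropWhile_id)
qed

lemma trail_decomp:
  obtains X where "v = X @ replicate (trail c v) c" "X = [] \<or> last X \<noteq> c"
proof -
  let ?Y = "dropWhile (\<lambda>x. x = c) (rev v)"
  have "v = rev (rev v)" by simp
  also have "rev v = replicate (trail c v) c @ ?Y" unfolding trail_def by (rule lead_decomp)
  finally have "v = rev ?Y @ replicate (trail c v) c" by simp
  moreover have "?Y \<noteq> [] \<Longrightarrow> hd ?Y \<noteq> c" by (rule hd_dropWhile)
  then have "rev ?Y = [] \<or> last (rev ?Y) \<noteq> c" by (auto simp: last_rev)
  ultimately show ?thesis by (rule that)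
qed

text \<open>With no more leading 0 than trailing 1 the word is an image under rule (a); with more,
  and a 0 before the trailing 1, under rule (b). What escapes is a 2 before the trailing 1, or a
  word 0^z 1^r with too few letters for the separating 1 of rule (a) or 0 of rule (b).\<close>

lemma terminal_tail:
  assumes red: "reduced v" and v: "length v \<ge> 2" "v ! 1 = 0" "\<forall>x\<in>set v. 0 \<le> x \<and> x \<le> 2" "last v = 1"
    and no_ND: "dyck_class v \<notin> Domain ND"
  obtains (flat) z r where "v = replicate z 0 @ replicate r 1" "r = z \<or> Suc r = z"
  | (two) X r where "v = X @ replicate r 1" "X \<noteq> []" "last X = 2" "1 \<le> r" "r < lead 0 v"
proof -
  define z where "z = lead 0 v"
  define r where "r = trail 1 v"
  define Y where "Y = dropWhile (\<lambda>x. x = 0) v"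
  have vY: "v = replicate z 0 @ Y" unfolding z_def Y_def by (rule lead_decomp)
  obtain X where vX: "v = X @ replicate r 1" and X: "X = [] \<or> last X \<noteq> 1" unfolding r_def by (rule trail_decomp)
  have q: "is_QDV v" using red by (simp add: reduced_def)
  then have r_v: "rises_by_at_most_1 v" by (simp add: is_QDV_def)
  obtain v' where v': "v = 0 # 0 # v'"
    using q v(1,2) by (cases v; cases "tl v") (auto simp: is_QDV_Cons)
  have z2: "2 \<le> z" by (simp add: z_def v' lead_def)
  have "Y \<noteq> []" using vY v(4) z2 by (cases z) (auto simp del: replicate.simps)
  moreover from this have "hd Y \<noteq> 0" unfolding Y_def by (rule hd_dropWhile)
  moreover have "hd Y \<le> 1" using r_v \<open>Y \<noteq> []\<close> z2 unfolding vY rises_append by auto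
  moreover have "hd Y \<ge> 0" using v(3) \<open>Y \<noteq> []\<close> hd_in_set[of Y] unfolding vY by auto
  ultimately obtain Y' where Y: "Y = 1 # Y'" by (cases Y) auto
  have r1: "1 \<le> r" using X v(4) vX v' by (cases r) auto
  have Xne: "X \<noteq> []" using vX v' r1 by (cases r) auto
  have image_a: False if "NU2_cond_a h A" "v = NU2_image_a h A" for h A
    using NU2_image_in_Domain_ND(1)[OF that(1)] no_ND that(2) by simp
  have image_b: False if "NU2_cond_b k B" "v = NU2_image_b k B" for k B
    using NU2_image_in_Domain_ND(2)[OF that(1)] no_ND that(2) by simp
  have zeros: "0 # replicate (m - 1) 0 @ xs = replicate m 0 @ xs" if "1 \<le> m" for m and xs :: "int list"
    using that by (cases m) auto
  show thesis
  proof (cases "length X \<le> z")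
    case True
    have "X = take (length X) v" using vX by simp
    also have "\<dots> = replicate (length X) 0" using vY True by (metis append_Nil2 diff_is_0_eq' length_replicate take0 take_append take_replicate min.absorb1)
    finally have X0: "X = replicate (length X) 0" .
    have "v ! length X = 1" using vX r1 by (simp add: nth_append)
    then have "length X = z" using vY True by (cases "length X < z") (auto simp: nth_append)
    then have flat_v: "v = replicate z 0 @ replicate r 1" using vX X0 by simp
    consider "r = z \<or> Suc r = z" | "z < r" | "r + 2 \<le> z" by linarith
    then show thesis
    proof cases
      case 1 then show thesis using flat flat_v by blast
    next
      case 2
      define d where "d = r - z - 1"
      have "r = Suc (d + z)" using 2 by (simp add: d_def)
      then have "v = NU2_image_a z (replicate d 1)"
        unfolding flat_v NU2_image_a_def using zeros[of z] z2 by (simp add: replicate_add)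
      moreover have "NU2_cond_a z (replicate d 1)" using z2 by (cases "d = 0") (auto simp: NU2_cond_a_def)
      ultimately show thesis using image_a by blast
    next
      case 3
      define d where "d = z - r - 2"
      have "z = Suc r + d + 1" using 3 by (simp add: d_def)
      then have "v = NU2_image_b r (replicate d 0)"
        unfolding flat_v NU2_image_b_def by (simp add: replicate_add replicate_append_same)
      moreover have "NU2_cond_b r (replicate d 0)" using r1 by (cases "d = 0") (auto simp: NU2_cond_b_def)
      ultimately show thesis using image_b by blast
    qed
  next
    case False
    define X' where "X' = drop (Suc z) X"
    have "take (Suc z) X = take (Suc z) v" using vX False by simp
    also have "\<dots> = replicate z 0 @ [1]" using vY Y by simp
    finally have X_eq: "X = replicate z 0 @ 1 # X'" unfolding X'_def
      by (metis append_take_drop_id append_assoc append_Cons append_Nil)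
    have rX: "rises_by_at_most_1 X" using r_v vX by (simp add: rises_append)
    have le: "\<forall>x\<in>set X'. 0 \<le> x \<and> x \<le> 2" using v(3) vX X_eq by auto
    show thesis
    proof (cases "z \<le> r")
      case True
      define d where "d = r - z"
      have rd: "r = d + z" using True by (simp add: d_def)
      have v_eq: "v = NU2_image_a z (X' @ replicate d 1)"
        unfolding NU2_image_a_def vX X_eq rd using zeros[of z] z2 by (simp add: replicate_add)
      have "v = (replicate z 0 @ [1]) @ (X' @ replicate d 1) @ replicate z 1"
        unfolding vX X_eq rd by (simp add: replicate_add)
      then have "rises_by_at_most_1 (X' @ replicate d 1)" using r_v by (metis rises_append)
      moreover have "X' @ replicate d 1 = [] \<or> last (X' @ replicate d 1) \<ge> 0"
      proof -
        have "\<forall>x\<in>set (X' @ replicate d 1). 0 \<le> x" using le by auto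
        then show ?thesis using last_in_set by blast
      qed
      ultimately have "NU2_cond_a z (X' @ replicate d 1)" using z2 le unfolding NU2_cond_a_def by auto
      then show thesis using image_a v_eq by blast
    next
      case False
      have "last X \<in> set v" using Xne vX by auto
      then have "last X \<ge> 0" "last X \<le> 2" using v(3) by auto
      moreover have "last X \<noteq> 1" using X Xne by simp
      ultimately have "last X = 0 \<or> last X = 2" by linarith
      then show thesis
      proof
        assume "last X = 2" then show thesis using two[OF vX Xne] r1 False by (simp add: z_def)
      next
        assume l: "last X = 0"
        then have "X' \<noteq> []" "last X' = 0" using X_eq by (auto split: if_splits)
        then obtain X'' where X'': "X' = X'' @ [0]" by (metis append_butlast_last_id)
        \<comment> \<open>Rule (b) uses up r + 1 of the leading 0; the other \<open>d\<close> go
          into its list.\<close>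
        define d where "d = z - r - 1"
        have zd: "z = Suc r + d" using False by (simp add: d_def)
        let ?B = "replicate d 0 @ 1 # X''"
        have v_eq: "v = NU2_image_b r ?B"
          unfolding NU2_image_b_def vX X_eq X'' zd by (simp add: replicate_add)
        have "v = replicate (Suc r) 0 @ ?B @ (0 # replicate r 1)"
          unfolding vX X_eq X'' zd by (simp add: replicate_add)
        then have "rises_by_at_most_1 ?B" using r_v by (metis rises_append)
        moreover have "\<forall>x\<in>set ?B. x \<le> 2" "\<forall>x\<in>set ?B. 0 \<le> x" using le X'' by auto
        moreover have "last ?B \<ge> -1" using last_in_set[of ?B] calculation(3) by fastforce
        moreover have "hd ?B \<le> 1" by (cases d) auto
        ultimately have "NU2_cond_b r ?B" using r1 by (simp add: NU2_cond_b_def)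
        then show thesis using image_b v_eq by blast
      qed
    qed
  qed
qed

text \<open>\<open>wide_bound\<close> gives the constant 6 for \<open>X\<close>. A single appended 1
  brings at least one bad pair and so costs at most 1. With more of them there is a third leading 0,
  and each appended 1 is bad with positions 0 and 1, at no cost.\<close>

lemma two_tail_bound:
  assumes v: "is_QDV v" "\<forall>x\<in>set v. 0 \<le> x" "v = X @ replicate r 1" "1 \<le> r" "r < lead 0 v"
    and X: "length X \<ge> 2" "X ! 1 = 0" "wide X" "last X = 2"
  shows "2 * length v \<le> card (bad_pairs v) + 7"
proof -
  have "X \<noteq> []" using X(1) by auto
  then have qX: "is_QDV X" "\<forall>x\<in>set X. 0 \<le> x" using v by (auto simp: is_QDV_def rises_append)
  have b: "2 * length X \<le> card (bad_pairs X) + 6" using wide_bound[OF qX] X by simp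
  have v01: "v ! 0 = 0" "v ! 1 = 0" using v(1,3) X by (auto simp: is_QDV_def hd_conv_nth nth_append)
  show ?thesis
  proof (cases "r = 1")
    case True
    have "finite {i. bad v i (length X)}" by (rule finite_subset[of _ "{..<length X}"]) (auto dest: bad_less)
    moreover have "bad v 0 (length X)" using bad_up[of 0 1 "length X" v] v01 X(1) v(3) True by simp
    ultimately have "card {i. bad v i (length X)} \<ge> 1" by (metis One_nat_def Suc_leI card_gt_0_iff empty_iff mem_Collect_eq)
    then show ?thesis using card_bad_pairs_snoc[of X 1] b v(3) True by simp
  next
    case False
    then have r: "2 \<le> r" using v(4) by simp
    have "v ! 2 = 0"
    proof -
      have "v = replicate (lead 0 v) 0 @ dropWhile (\<lambda>x. x = 0) v" by (rule lead_decomp)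
      then show ?thesis using v(5) r by (metis nth_append length_replicate nth_replicate less_le_trans le_less_trans)
    qed
    have lX: "length X \<ge> 3"
    proof (rule ccontr)
      assume "\<not> length X \<ge> 3"
      then have "length X = 2" using X(1) by simp
      then have "last X = X ! 1" using \<open>X \<noteq> []\<close> by (simp add: last_conv_nth)
      then show False using X by simp
    qed
    have "card (bad_pairs (take (length X) v)) + 2 * (length v - length X) \<le> card (bad_pairs v)"
    proof (rule bad_pairs_extend)
      fix j assume j: "length X \<le> j" "j < length v"
      then have "v ! j = 1" using v(3) by (simp add: nth_append)
      then have "bad v 0 j" "bad v 1 j"
        using bad_up[of 0 1 j v] bad_up[of 1 2 j v] j lX v01 \<open>v ! 2 = 0\<close> by auto
      then show "\<exists>i i'. i \<noteq> i' \<and> bad v i j \<and> bad v i' j" by (metis zero_neq_one)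
    qed (use v(3) in simp)
    then show ?thesis using b v(3) by simp
  qed
qed

lemma wideI:
  assumes "4 \<le> length v" "v ! 2 = 0 \<or> v ! 3 = 0 \<or> v ! 2 = 1 \<and> v ! 3 = 1" shows "wide v"
  using assms(2)
proof (elim disjE)
  assume "v ! 2 = 0" then show ?thesis using assms(1) by (auto simp: wide_def intro!: exI[of _ 2])
next
  assume "v ! 3 = 0" then show ?thesis using assms(1) by (auto simp: wide_def intro!: exI[of _ 3])
qed (use assms(1) in \<open>simp add: wide_def\<close>)

text \<open>Cut after the last entry of at least 3. The prefix falls under
  \<open>wide_bound\<close>, and every later entry, being at most 2, is the right end of two bad
  pairs.\<close>

lemma large_entry_bound:
  assumes v: "is_QDV v" "\<forall>x\<in>set v. 0 \<le> x" "length v \<ge> 4" "v ! 1 = 0" "\<exists>x\<in>set v. x \<ge> 3"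
    and w: "v ! 2 = 0 \<or> v ! 3 = 0 \<or> v ! 2 = 1 \<and> v ! 3 = 1"
  shows "2 * length v \<le> card (bad_pairs v) + 6"
proof -
  let ?n = "length v" and ?E = "{i. i < length v \<and> v ! i \<ge> 3}"
  have E: "finite ?E" "?E \<noteq> {}" using v(5) by (auto simp: in_set_conv_nth)
  define e where "e = Max ?E"
  have e: "e < ?n" "v ! e \<ge> 3" using Max_in[OF E] by (auto simp: e_def)
  have after: "v ! j \<le> 2" if "e < j" "j < ?n" for j
    using Max_ge[OF E(1), of j] that unfolding e_def[symmetric] by (cases "v ! j \<le> 2") auto
  have v0: "v ! 0 = 0" using v by (auto simp: is_QDV_def hd_conv_nth)
  have nn: "0 \<le> v ! i" if "i < ?n" for i using v(2) that by simp
  have e4: "4 \<le> e"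
  proof (rule ccontr)
    assume "\<not> 4 \<le> e"
    then have "e = 0 \<or> e = 1 \<or> e = 2 \<or> e = 3" by linarith
    moreover have "v ! 2 \<le> 1" "v ! 3 \<le> 2"
      using rises_nth_le[of v 1 2] rises_nth_le[of v 1 3] v by (auto simp: is_QDV_def)
    ultimately show False using e v0 v(4) by auto
  qed
  let ?u = "take (Suc e) v"
  have "wide ?u"
  proof -
    have "?u ! 2 = v ! 2" "?u ! 3 = v ! 3" "4 \<le> length ?u" using e4 e by auto
    then show ?thesis using w by (intro wideI) auto
  qed
  moreover have "is_QDV ?u"
    using v(1) rises_append[of ?u "drop (Suc e) v"] by (simp add: is_QDV_def hd_take)
  moreover have "last ?u = v ! e" using e by (simp add: take_Suc_conv_app_nth)
  moreover have "\<forall>x\<in>set ?u. 0 \<le> x" using v(2) by (meson in_set_takeD)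
  ultimately have b: "2 * length ?u \<le> card (bad_pairs ?u) + 6" using wide_bound[of ?u] e4 e v(4) by simp
  obtain l where l: "l < e" "v ! l = 2" using last_before[OF v(1) e(1), of 2] e(2) by auto
  have "card (bad_pairs ?u) + 2 * (?n - Suc e) \<le> card (bad_pairs v)"
  proof (rule bad_pairs_extend)
    fix j assume j: "Suc e \<le> j" "j < ?n"
    have n: "(0 :: nat) \<noteq> e" "(0 :: nat) \<noteq> 1" "(0 :: nat) \<noteq> 2" "l \<noteq> e" using e4 l by auto
    consider "v ! j = 0" | "v ! j = 1" | "v ! j = 2" using nn[OF j(2)] after[of j] j by fastforce
    then show "\<exists>i i'. i \<noteq> i' \<and> bad v i j \<and> bad v i' j"
    proof cases
      case 1
      then have "bad v l j" "bad v e j" using bad_down[of l j v] bad_down[of e j v] j l e by auto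
      then show ?thesis using n by blast
    next
      case 2
      then have "bad v 0 j" "bad v e j" using bad_up[of 0 1 j v] bad_down[of e j v] j e e4 v0 v(4) by auto
      then show ?thesis using n by blast
    next
      case 3
      then have "bad v 0 j" using bad_up[of 0 1 j v] j e4 v0 v(4) by auto
      moreover have "bad v 1 j \<or> bad v 2 j"
        using w bad_up[of 1 2 j v] bad_up[of 1 3 j v] bad_up[of 2 3 j v] 3 j e4 v(4) by auto
      ultimately show ?thesis using n by blast
    qed
  qed (use e in simp)
  then show ?thesis using b e by simp
qed

lemma flat_deficit: "word_deficit (replicate z 0 @ replicate r 1) = int r * (int z - 1)"
proof -
  have tri: "triangle (z + r) = triangle z + triangle r + int z * int r"
    by (induction r) (simp_all add: distrib_left)
  show ?thesis unfolding word_deficit_def word_size_def length_append length_replicate tri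
    by (simp add: dinv_expand algebra_simps)
qed

lemma flat_deficit_large:
  assumes "r = z \<or> Suc r = z"
  shows "2 * int (z + r) < word_deficit (replicate z 0 @ replicate r 1) + 8"
proof -
  \<comment> \<open>Completed squares: for r = z - 1 the claim is (z - 3)^2 + 2 > 0, and for r = z
    four times the difference is (2z - 5)^2 + 7.\<close>
  have "0 \<le> (int z - 3) * (int z - 3)" "0 \<le> (2 * int z - 5) * (2 * int z - 5)" by simp_all
  then show ?thesis using assms unfolding flat_deficit by (auto simp: algebra_simps)
qed

text \<open>A terminal word ends in at least 1. A \<open>wide\<close> word ending in 2 or more has
  too many bad pairs; for one ending in 1, \<open>terminal_tail\<close> passes the count to the part
  before the trailing 1. So the start is 0 0 1 2, and if no entry exceeds 2 there is no further 0
  and only flag words remain.\<close>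

lemma terminal_start00:
  assumes red: "reduced v" and v: "\<forall>x\<in>set v. 0 \<le> x" "length v \<ge> 2" "v ! 1 = 0"
    and no_ND: "dyck_class v \<notin> Domain ND" and small_deficit: "word_deficit v + 8 \<le> 2 * int (length v)"
  shows "v \<in> flag_words \<or> (\<exists>u. v = 0 # 0 # 1 # 2 # u \<and> (\<exists>x\<in>set u. x \<ge> 3))"
proof (rule ccontr)
  assume neg: "\<not> ?thesis"
  let ?n = "length v"
  have q: "is_QDV v" using red by (simp add: reduced_def)
  have D: "int (card (bad_pairs v)) + 8 \<le> 2 * int ?n" using bad_pairs_le_deficit[OF q v(1)] small_deficit by linarith
  then have n4: "4 \<le> ?n" by linarith
  have v0: "v ! 0 = 0" using q by (auto simp: is_QDV_def hd_conv_nth)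
  have vne: "v \<noteq> []" using n4 by auto
  have last1: "last v \<ge> 1" using last_nonpos_in_Domain_ND[OF q v(2)] no_ND by (cases "last v \<le> 0") auto
  have not_wide: "\<not> wide v" if "last v \<ge> 2" using wide_bound[OF q v(1,2,3)] that D by linarith
  obtain c d u where v_eq: "v = 0 # 0 # c # d # u"
    using n4 v0 v(3) by (cases v; cases "tl v"; cases "tl (tl v)"; cases "tl (tl (tl v))") auto
  then have cd: "0 \<le> c" "c \<le> 1" "0 \<le> d" "d \<le> c + 1" using q v(1) by (auto simp: is_QDV_Cons)
  have tail: False if small: "\<forall>x\<in>set v. x \<le> 2" and l1: "last v = 1"
    and wide: "\<And>X r. v = X @ replicate r 1 \<Longrightarrow> last X = 2 \<Longrightarrow> X \<noteq> [] \<Longrightarrow> 1 \<le> r \<Longrightarrow> r < lead 0 v \<Longrightarrow> wide X"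
  proof -
    have "\<forall>x\<in>set v. 0 \<le> x \<and> x \<le> 2" using v(1) small by blast
    from red v(2,3) this l1 no_ND show False
    proof (cases rule: terminal_tail)
      case (flat z r)
      then show ?thesis using flat_deficit_large[of r z] small_deficit by simp
    next
      case (two X r)
      have "length X \<ge> 2"
      proof (rule ccontr)
        assume "\<not> length X \<ge> 2"
        then obtain x where "X = [x]" using two(2) by (cases X) (auto simp: Suc_le_eq)
        then show False using two v0 by simp
      qed
      moreover from this have "X ! 1 = 0" using two(1) v(3) by (simp add: nth_append)
      ultimately show ?thesis using two_tail_bound[OF q v(1) two(1,4,5)] wide[OF two(1,3,2,4,5)] two(3) D by linarith
    qed
  qed
  show False
  proof (cases "c = 1 \<and> d = 2")
    case False
    then have alt: "v ! 2 = 0 \<or> v ! 3 = 0 \<or> v ! 2 = 1 \<and> v ! 3 = 1" using cd v_eq by auto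
    then have "wide v" using n4 by (intro wideI)
    then have l1: "last v = 1" using not_wide last1 by linarith
    have small: "\<forall>x\<in>set v. x \<le> 2" using large_entry_bound[OF q v(1) n4 v(3) _ alt] D by fastforce
    show False
    proof (rule tail[OF small l1])
      fix X r assume X: "v = X @ replicate r 1" "last X = 2" "X \<noteq> []" "1 \<le> r" "r < lead 0 v"
      have "length X - 1 < length X" using X(3) by simp
      then have lv: "v ! (length X - 1) = 2" "length X - 1 < ?n" using X by (auto simp: nth_append last_conv_nth)
      have "length X \<ge> 4"
      proof (rule ccontr)
        assume "\<not> length X \<ge> 4"
        then have "length X - 1 = 0 \<or> length X - 1 = 1 \<or> length X - 1 = 2" by linarith
        then show False using lv v0 v(3) cd v_eq by auto
      qed
      moreover from this have "X ! 2 = v ! 2" "X ! 3 = v ! 3" using X(1) by (auto simp: nth_append)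
      ultimately show "wide X" using alt by (intro wideI) auto
    qed
  next
    case True
    have small: "\<forall>x\<in>set u. x \<le> 2" using neg v_eq True by force
    show False
    proof (cases "0 \<in> set u")
      case True': True
      then obtain p where p: "p < length u" "u ! p = 0" by (auto simp: in_set_conv_nth)
      then have "v ! (p + 4) = 0" "p + 4 < ?n" using v_eq by auto
      then have "wide v" unfolding wide_def by (intro disjI1 exI[of _ "p + 4"]) auto
      then have l1: "last v = 1" using not_wide last1 by linarith
      show False
      proof (rule tail[OF _ l1])
        show "\<forall>x\<in>set v. x \<le> 2" using small v_eq True by auto
        fix X r assume X: "v = X @ replicate r 1" "last X = 2" "X \<noteq> []" "1 \<le> r" "r < lead 0 v"
        have "p + 4 < length X" using \<open>v ! (p + 4) = 0\<close> \<open>p + 4 < ?n\<close> X(1)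
          by (cases "p + 4 < length X") (auto simp: nth_append)
        moreover from this have "X ! (p + 4) = 0" using \<open>v ! (p + 4) = 0\<close> X(1) by (simp add: nth_append)
        ultimately show "wide X" unfolding wide_def by (intro disjI1 exI[of _ "p + 4"]) auto
      qed
    next
      case False
      have "x = 1 \<or> x = 2" if x: "x \<in> set u" for x
      proof -
        have "0 \<le> x" "x \<le> 2" "x \<noteq> 0" using v(1) small False v_eq x by auto
        then show ?thesis by linarith
      qed
      then have bu: "band 1 (2 # u)" by (auto simp: band_def)
      have l12: "last v = 1 \<or> last v = 2" using band_hd_last(2)[OF bu] v_eq True by (auto split: if_splits)
      have lead: "lead 0 v = 2" using v_eq True by (simp add: lead_def)
      have "\<forall>x\<in>set v. 0 \<le> x \<and> x \<le> 2" using v(1) small v_eq True by auto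
      show False
      proof (cases "last v = 1")
        case l1: True
        from red v(2,3) \<open>\<forall>x\<in>set v. 0 \<le> x \<and> x \<le> 2\<close> l1 no_ND show False
        proof (cases rule: terminal_tail)
          case (flat z r)
          have "2 \<in> set v" using v_eq True by simp
          then show ?thesis using flat(1) by (auto simp del: replicate.simps)
        next
          case (two X r)
          then have r: "r = 1" using lead by simp
          then have "v = X @ [1]" using two(1) by simp
          then have "X = butlast v" by simp
          then have X: "X = 0 # 0 # 1 # butlast (2 # u)" "u \<noteq> []"
            using v_eq True l1 by (auto split: if_splits)
          define W where "W = butlast (2 # u)"
          have "v = 0 # 0 # 1 # W @ replicate 1 1" using \<open>v = X @ [1]\<close> X(1) by (simp add: W_def)
          moreover have "band 1 W" using bu unfolding W_def band_def by (meson in_set_butlastD)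
          moreover have "W \<noteq> []" "hd W = 2" using X(2) by (auto simp: W_def)
          moreover have "last W = 2" using two(3) X(1) \<open>W \<noteq> []\<close> by (simp add: W_def)
          ultimately have "v \<in> flag_words" unfolding flag_words_def by blast
          then show ?thesis using neg by blast
        qed
      next
        case False
        then have "last (2 # u) = 2" using l12 v_eq True by (cases "u = []") auto
        then have "v \<in> flag_words" unfolding flag_words_def using bu v_eq True
          by (intro CollectI exI[of _ "2 # u"] exI[of _ 0]) auto
        then show False using neg by blast
      qed
    qed
  qed
qed

text \<open>If \<open>v\<close> ends in 3 or more, \<open>start01_bound_3\<close> applies. Otherwise
  there is a single lift and \<open>w\<close> ends in 1; if moreover \<open>alt\<close> of
  \<open>start01_bound_2\<close> fails, \<open>w\<close> has the form 0 0 B 0 1, a rule (b) image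
  with k = 1.\<close>

lemma terminal_start01:
  assumes red: "reduced w" and v: "v = (lift ^^ i) w" "i \<ge> 1" "\<forall>x\<in>set v. 0 \<le> x"
    and p: "2 \<le> p" "p < length v" "v ! p = 0"
    and no_ND: "dyck_class w \<notin> Domain ND" and small_deficit: "word_deficit v + 8 \<le> 2 * int (length v)"
  shows False
proof -
  let ?n = "length v"
  have qw: "is_QDV w" using red by (simp add: reduced_def)
  have q: "is_QDV v" using dyck_equiv_funpow_lift[OF qw] v(1) by simp
  have D: "int (card (bad_pairs v)) + 8 \<le> 2 * int ?n" using bad_pairs_le_deficit[OF q v(3)] small_deficit by linarith
  obtain i' where i': "i = Suc i'" using v(2) by (cases i) auto
  obtain u where u: "(lift ^^ i') w = 0 # u" using dyck_equiv_funpow_lift[OF qw, of i'] is_QDV_E by metis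
  have v_eq: "v = 0 # 1 # raise u" using v(1) i' u by (simp add: lift_def)
  have v1: "v ! 1 = 1" using v_eq by simp
  have n3: "3 \<le> ?n" using p by simp
  have wne: "w \<noteq> []" using qw by (simp add: is_QDV_def)
  have lv: "last v = last w + int i" using last_funpow_lift[OF wne] v(1) by simp
  have w2: "length w \<ge> 2"
  proof (rule ccontr)
    assume "\<not> length w \<ge> 2"
    then have "w = [0]" using qw wne by (cases w) (auto simp: is_QDV_Cons Suc_le_eq)
    \<comment> \<open>The lifts of [0] are the words 0 1 2 ... m, which have no second 0.\<close>
    then have "(lift ^^ m) w = map int [0..<Suc m]" for m
      by (induction m) (auto simp: lift_def raise_def map_Suc_upt[symmetric] upt_conv_Cons simp del: upt_Suc)
    then have "v ! p = int p" using v(1) p by (metis length_map length_upt minus_nat.diff_0 nth_map nth_upt add_0)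
    then show False using p by simp
  qed
  have lw: "last w \<ge> 1" using last_nonpos_in_Domain_ND[OF qw w2] no_ND by (cases "last w \<le> 0") auto
  show False
  proof (cases "last v \<ge> 3")
    case True
    then show ?thesis using start01_bound_3[OF q v(3) _ v1 _ p] n3 D by linarith
  next
    case False
    then have i1: "i = 1" "last w = 1" "last v = 2" using lv lw v(2) by auto
    then have vw: "v = lift w" using v(1) by simp
    obtain w' where w_eq: "w = 0 # w'" using is_QDV_E[OF qw] by blast
    moreover have "w' \<noteq> []" using w2 w_eq by auto
    ultimately have w': "w = 0 # w'" "w' \<noteq> []" "hd w' \<le> 0" "rises_by_at_most_1 w'"
      using red by (auto simp: reduced_Cons)
    have v2: "v ! 2 = hd w' + 1" using vw w' by (cases w') (auto simp: lift_def numeral_2_eq_2)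
    have "0 \<le> v ! 2" using v(3) n3 by (simp add: Suc_le_eq numeral_3_eq_3 numeral_2_eq_2)
    have "v ! 2 = 0 \<or> v ! 2 = 1 \<and> (v ! (?n - 2) = 2 \<or> (\<exists>x\<in>set v. x \<ge> 3))"
    proof (rule ccontr)
      assume neg: "\<not> ?thesis"
      then have h: "hd w' = 0" and small: "\<forall>x\<in>set v. x \<le> 2" and n2: "v ! (?n - 2) \<noteq> 2"
        using v2 \<open>0 \<le> v ! 2\<close> w'(3) by auto
      have p3: "3 \<le> p" using p v2 h by (cases "p = 2") auto
      have pn: "p < ?n - 1"
      proof (rule ccontr)
        assume "\<not> p < ?n - 1"
        then have "p = ?n - 1" using p by simp
        then have "last v = v ! p" using v_eq by (simp add: last_conv_nth)
        then show False using p i1 by simp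
      qed
      have lw': "length w' = ?n - 2" using vw w'(1) by simp
      have nth: "v ! (k + 2) = w' ! k + 1" if "k < length w'" for k
        using vw w'(1) that by (simp add: lift_def numeral_2_eq_2)
      obtain a where a: "w' = a @ [1]" using w'(1,2) i1(2) by (metis append_butlast_last_id last.simps)
      have "length a \<ge> 2" using lw' a p3 pn by simp
      then obtain b c where bc: "a = b @ [c]" "b \<noteq> []" by (cases a rule: rev_cases) force+
      have "c = v ! (?n - 2) - 1"
      proof -
        have "w' ! length b = c" using a bc by (simp add: nth_append)
        moreover have "length b + 2 = ?n - 2" using lw' a bc by simp
        ultimately show ?thesis using nth[of "length b"] a bc by simp
      qed
      moreover have "v ! (?n - 2) \<le> 2" using small n3 by simp
      moreover have "0 \<le> c" using w'(4) a bc by (simp add: rises_append)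
      \<comment> \<open>The entry before the final 1 is at least 0 by the rise condition, and less
        than 1 since its lift is not 2.\<close>
      ultimately have c: "c = 0" using n2 by linarith
      obtain B where B: "b = 0 # B" using bc a h by (cases b) auto
      have w_eq: "w = NU2_image_b 1 B" using w'(1) a bc B c by (simp add: NU2_image_b_def)
      have "rises_by_at_most_1 B" "B \<noteq> [] \<Longrightarrow> hd B \<le> 1" "B \<noteq> [] \<Longrightarrow> last B \<ge> -1"
        using w'(4) a bc B c by (auto simp: rises_append rises_Cons)
      moreover have "\<forall>x\<in>set B. x \<le> 2"
      proof
        fix x assume "x \<in> set B"
        then have "x \<in> set w" using w'(1) a bc B by auto
        then have "x + 1 \<in> set v" using vw by (auto simp: lift_def raise_def)
        then show "x \<le> 2" using small by fastforce
      qed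
      ultimately have "NU2_cond_b 1 B" by (auto simp: NU2_cond_b_def)
      then show False using NU2_image_in_Domain_ND(2) w_eq no_ND by blast
    qed
    then show False using start01_bound_2[OF q v(3) n3 v1 i1(3) p] D by linarith
  qed
qed

section \<open>Words and partitions\<close>

text \<open>The boundary path of a partition with parts in increasing order: each 1 is a part, and
  the number of 0 before it, counted from \<open>c\<close>, is its value. Zero parts are allowed.
  For a partition \<open>\<mu>\<close>, \<open>part_word 0 (rev \<mu>)\<close> is
  \<open>B_word \<mu>\<close>.\<close>

fun part_word :: "nat \<Rightarrow> nat list \<Rightarrow> int list" where
  "part_word c [] = []"
| "part_word c (s # ss) = replicate (s - c) 0 @ 1 # part_word s ss"

text \<open>Reads the parts back from the path. Final 0 leave no trace, hence the condition on the
  last letter in \<open>part_word_heights\<close>.\<close>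

fun heights :: "nat \<Rightarrow> int list \<Rightarrow> nat list" where
  "heights c [] = []"
| "heights c (x # z) = (if x = 0 then heights (Suc c) z else c # heights c z)"

lemma heights_replicate_0: "heights c (replicate k 0 @ z) = heights (c + k) z"
  by (induction k arbitrary: c) auto

lemma heights_append_replicate_0: "heights c (z @ replicate k 0) = heights c z"
proof (induction z arbitrary: c)
  case Nil show ?case using heights_replicate_0[of c k "[]"] by simp
qed auto

lemma heights_part_word: "sorted (c # ss) \<Longrightarrow> heights c (part_word c ss) = ss"
  by (induction ss arbitrary: c) (auto simp: heights_replicate_0)

lemma sorted_heights: "sorted (c # heights c z)"
proof (induction z arbitrary: c)
  case (Cons x z)
  then show ?case using Cons[of "Suc c"] Cons[of c] by (auto dest: Suc_leD)
qed simp

lemma part_word_Suc: "ss \<noteq> [] \<Longrightarrow> Suc c \<le> hd ss \<Longrightarrow> part_word c ss = 0 # part_word (Suc c) ss"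
  by (cases ss) (auto simp: Suc_diff_le[symmetric] simp flip: replicate_Suc)

lemma heights_eq_Nil: "heights c z = [] \<Longrightarrow> \<forall>x\<in>set z. x = 0"
  by (induction z arbitrary: c) (auto split: if_splits)

lemma part_word_heights:
  "band 0 z \<Longrightarrow> z = [] \<or> last z = 1 \<Longrightarrow> part_word c (heights c z) = z"
proof (induction z arbitrary: c)
  case (Cons x z)
  show ?case
  proof (cases "x = 0")
    case True
    then have z: "z \<noteq> []" "last z = 1" using Cons.prems by (auto split: if_splits)
    then have ne: "heights (Suc c) z \<noteq> []" using heights_eq_Nil[of "Suc c" z] last_in_set[of z] by force
    moreover have "Suc c \<le> hd (heights (Suc c) z)" using sorted_heights[of "Suc c" z] hd_in_set[OF ne] by simp
    ultimately show ?thesis using part_word_Suc[OF ne] Cons z True by simp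
  next
    case False
    then have "x = 1" using Cons.prems by simp
    then show ?thesis using Cons by (auto split: if_splits)
  qed
qed simp

lemma band_part_word: "band 0 (part_word c ss)"
  by (induction ss arbitrary: c) (auto simp: band_def)

lemma last_part_word: "ss \<noteq> [] \<Longrightarrow> last (part_word c ss) = 1"
proof (induction ss arbitrary: c)
  case (Cons s ss)
  then show ?case by (cases ss) (auto simp del: part_word.simps(2) simp: part_word.simps(2)[of c s])
qed simp

lemma part_word_eq_Nil [simp]: "part_word c ss = [] \<longleftrightarrow> ss = []"
  by (cases ss) auto

lemma length_part_word: "sorted (c # ss) \<Longrightarrow> length (part_word c ss) + c = length ss + last (c # ss)"
proof (induction ss arbitrary: c)
  case (Cons s ss)
  then have "length (part_word s ss) + s = length ss + last (s # ss)" "c \<le> s" by auto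
  then show ?case by (simp del: last.simps add: last_ConsR)
qed simp

lemma count_list_eq_0: "\<forall>x\<in>set ss. x \<noteq> i \<Longrightarrow> count_list ss i = 0"
  by (induction ss) auto

text \<open>Groups the path by equal parts, the form in which \<open>B_word\<close> is given; parts
  equal to \<open>c\<close> make an initial block without a 0.\<close>

lemma part_word_blocks:
  assumes "sorted (c # ss)"
  shows "part_word c ss = replicate (count_list ss c) 1 @
    concat (map (\<lambda>i. 0 # replicate (count_list ss i) 1) [Suc c..<Suc (last (c # ss))])"
  using assms
proof (induction ss arbitrary: c)
  case (Cons s ss)
  have s: "sorted (s # ss)" "c \<le> s" using Cons.prems by auto
  have IH: "part_word s ss = replicate (count_list ss s) 1 @
      concat (map (\<lambda>i. 0 # replicate (count_list ss i) 1) [Suc s..<Suc (last (s # ss))])"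
    using Cons.IH[OF s(1)] .
  have block: "concat (map (\<lambda>i. 0 # replicate (count_list (s # ss) i) (1 :: int)) [Suc s..<Suc (last (s # ss))])
      = concat (map (\<lambda>i. 0 # replicate (count_list ss i) 1) [Suc s..<Suc (last (s # ss))])"
    by (intro arg_cong[of _ _ concat] map_cong) auto
  have last: "last (c # s # ss) = last (s # ss)" by simp
  show ?case
  proof (cases "s = c")
    case True
    then show ?thesis using IH block unfolding last by (simp del: upt_Suc)
  next
    case False
    then have cs: "c < s" using s by simp
    have sl: "s \<le> last (s # ss)" using s(1) last_in_set[of ss] by (cases "ss = []") auto
    have "[Suc c..<Suc (last (s # ss))] = [Suc c..<s] @ s # [Suc s..<Suc (last (s # ss))]"
      using cs sl upt_add_eq_append[of "Suc c" s "Suc (last (s # ss)) - s"]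
      by (simp add: upt_conv_Cons del: upt_Suc last.simps)
    moreover have "concat (map (\<lambda>i. 0 # replicate (count_list (s # ss) i) (1 :: int)) [Suc c..<s])
        = replicate (s - Suc c) 0"
    proof -
      have "map (\<lambda>i. 0 # replicate (count_list (s # ss) i) (1 :: int)) [Suc c..<s] = map (\<lambda>i. [0]) [Suc c..<s]"
        using s(1) by (intro map_cong) (auto intro!: count_list_eq_0)
      moreover have "concat (map (\<lambda>i. [0 :: int]) xs) = replicate (length xs) 0" for xs :: "nat list"
        by (induction xs) auto
      ultimately show ?thesis by (simp only: length_upt)
    qed
    moreover have "count_list (s # ss) c = 0" using s(1) cs by (intro count_list_eq_0) auto
    moreover have "replicate (s - c) (0 :: int) = replicate (s - Suc c) 0 @ [0]"
      using cs by (metis Suc_diff_Suc replicate_Suc replicate_append_same)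
    ultimately show ?thesis using IH block unfolding last by (simp del: upt_Suc)
  qed
qed simp

lemma is_partition_iff_rev: "is_partition \<mu> \<longleftrightarrow> sorted (rev \<mu>) \<and> (\<forall>x\<in>set \<mu>. 0 < x)"
  by (auto simp: is_partition_def sorted_wrt_rev gr0_conv_Suc) (metis not0_implies_Suc)

lemma B_word_eq:
  assumes "is_partition \<mu>" shows "B_word \<mu> = part_word 0 (rev \<mu>)"
proof (cases "\<mu> = []")
  case False
  have s: "sorted (0 # rev \<mu>)" "\<forall>x\<in>set (rev \<mu>). x \<noteq> 0" using assms by (auto simp: is_partition_iff_rev)
  show ?thesis using part_word_blocks[OF s(1)] count_list_eq_0[OF s(2)] False
    by (simp add: B_word_def last_rev del: upt_Suc)
qed (simp add: B_word_def)

lemma TI_eq: "is_partition \<mu> \<Longrightarrow> TI \<mu> = dyck_class (0 # part_word 0 (rev \<mu>))"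
  by (simp add: TI_def B_word_eq)

lemma TI_word_part_word:
  assumes "is_partition \<mu>" shows "TI_word (part_word 0 (rev \<mu>))"
proof (cases "rev \<mu>")
  case (Cons s ss)
  then have "s \<in> set \<mu>" by (metis list.set_intros(1) set_rev)
  then have "0 < s" using assms by (auto simp: is_partition_iff_rev)
  then show ?thesis using band_part_word[of 0 "rev \<mu>"] last_part_word[of "rev \<mu>" 0] Cons
    by (cases s) (auto simp: TI_word_def)
qed (simp add: TI_word_def)

lemma TI_word_ex_partition:
  assumes "TI_word z" obtains \<mu> where "is_partition \<mu>" "z = part_word 0 (rev \<mu>)"
proof
  let ?ss = "heights 0 z"
  have "\<forall>x\<in>set ?ss. 0 < x"
  proof (cases z)
    case (Cons x z')
    then have "?ss = heights 1 z'" using assms by (auto simp: TI_word_def)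
    then show ?thesis using sorted_heights[of 1 z'] by auto
  qed simp
  then show "is_partition (rev ?ss)" using sorted_heights[of 0 z] by (simp add: is_partition_iff_rev)
  show "z = part_word 0 (rev (rev ?ss))" using part_word_heights[of z 0] assms by (auto simp: TI_word_def)
qed

lemma part_word_rev_inj:
  assumes "is_partition \<mu>" "is_partition \<nu>" "part_word 0 (rev \<mu>) = part_word 0 (rev \<nu>)" shows "\<mu> = \<nu>"
proof -
  have "sorted (0 # rev \<mu>)" "sorted (0 # rev \<nu>)" using assms by (auto simp: is_partition_iff_rev)
  then have "rev \<mu> = rev \<nu>" using heights_part_word assms(3) by metis
  then show ?thesis by simp
qed

text \<open>In a word over 0 and 1 the only pairs missed by \<open>dinv_pairs\<close> are a 0 before
  a 1. The heights count exactly these, plus \<open>c\<close> for each 1.\<close>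

lemma sum_heights:
  "band 0 z \<Longrightarrow> int (sum_list (heights c z)) = triangle (length z) - dinv_pairs z + int c * sum_list z"
proof (induction z arbitrary: c)
  case (Cons x z)
  have z: "band 0 z" using Cons.prems by simp
  have "dinv_from 1 z = int (length z)" "dinv_from 0 z = int (length z) - sum_list z"
    using z by (induction z) (auto simp: dinv_pair_def)
  then show ?case using Cons.prems Cons.IH[OF z, of c] Cons.IH[OF z, of "Suc c"]
    by (auto simp: algebra_simps)
qed simp

lemma neg_weight_band: "band 0 z \<Longrightarrow> (\<Sum>y\<leftarrow>z. neg_weight y) = 0"
  by (induction z) auto

lemma word_deficit_binary: "band 0 z \<Longrightarrow> word_deficit (0 # z) = int (sum_list (heights 0 z))"
proof -
  assume z: "band 0 z"
  have "dinv_from 0 z = int (length z) - sum_list z"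
    using z by (induction z) (auto simp: dinv_pair_def)
  then show ?thesis using sum_heights[OF z, of 0] neg_weight_band[OF z]
    by (simp add: word_deficit_def word_size_def)
qed

text \<open>In terms of the whole word, the deficit is the size j of the encoded partition plus the
  length minus 2. With deficit n the length is n - j + 2, and n + 8 \<le> 2 (n - j + 2) says 2 j + 4
  \<le> n.\<close>

lemma word_deficit_flag:
  assumes z: "band 0 z"
  shows "word_deficit (0 # 0 # 1 # raise z) = int (sum_list (heights 0 z)) + int (length z) + 1"
proof -
  have "dinv_from 0 (raise z) = 0" "dinv_from 1 (raise z) = int (length z) - sum_list z"
    "(\<Sum>y\<leftarrow>raise z. neg_weight y) = 0"
    using z by (induction z) (auto simp: dinv_pair_def)
  then show ?thesis using sum_heights[OF z, of 0]
    by (simp add: word_deficit_def word_size_def sum_list_raise dinv_pair_numerals)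
qed

section \<open>Counting\<close>

lemma length_le_sum_list: "0 \<notin> set \<nu> \<Longrightarrow> length \<nu> \<le> sum_list (\<nu> :: nat list)"
  by (induction \<nu>) (auto simp: Suc_le_eq)

lemma finite_partitions_of: "finite (partitions_of n)"
proof (rule finite_subset)
  show "partitions_of n \<subseteq> {\<nu>. set \<nu> \<subseteq> {..n} \<and> length \<nu> \<le> n}"
    by (auto simp: partitions_of_def is_partition_def member_le_sum_list length_le_sum_list)
qed (simp add: finite_lists_length_le)

definition large_flag_words :: "nat \<Rightarrow> int list set" where
  "large_flag_words n = {v \<in> flag_words. word_deficit v = int n \<and> n + 8 \<le> 2 * length v}"

text \<open>The \<open>a\<close> zero parts are the leading 2 of \<open>W\<close>; they pad the word
  to a prescribed length without changing the partition, and at least one is needed for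
  \<open>W\<close> to start with 2. The \<open>e\<close> final 0 become the optional 1 after
  raising.\<close>

definition flag_word_of :: "nat \<Rightarrow> nat list \<Rightarrow> nat \<Rightarrow> int list" where
  "flag_word_of a \<nu> e = 0 # 0 # 1 # raise (part_word 0 (replicate a 0 @ rev \<nu>) @ replicate e 0)"

text \<open>\<open>last (0 # rev \<nu>)\<close> is the largest part, or 0 if there is none. The path
  has one 1 per part, zero parts included, and as many 0 as the largest part.\<close>

lemma flag_word_of_stats:
  assumes "is_partition \<nu>" "1 \<le> a" "e \<le> 1"
  defines "v \<equiv> flag_word_of a \<nu> e"
  shows "v \<in> flag_words" "length v = a + length \<nu> + last (0 # rev \<nu>) + e + 3"
    "word_deficit v = int (sum_list \<nu> + a + length \<nu> + last (0 # rev \<nu>) + e + 1)"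
proof -
  define ss where "ss = replicate a 0 @ rev \<nu>"
  define z where "z = part_word 0 ss"
  have s: "sorted (0 # ss)" "ss \<noteq> []" "hd ss = 0"
    using assms(1,2) by (cases a; auto simp: ss_def is_partition_iff_rev sorted_append)+
  have last: "last (0 # ss) = last (0 # rev \<nu>)" using assms(2) by (cases "\<nu> = []") (auto simp: ss_def)
  have z: "band 0 z" "z \<noteq> []" "last z = 1" "hd z = 1"
    using band_part_word[of 0 ss] last_part_word[OF s(2), of 0] s by (auto simp: z_def) (cases ss, auto)
  have lz: "length z = a + length \<nu> + last (0 # rev \<nu>)"
    using length_part_word[OF s(1)] last by (simp add: z_def ss_def)
  have v: "v = 0 # 0 # 1 # raise (z @ replicate e 0)" by (simp add: v_def flag_word_of_def z_def ss_def)
  have "v = 0 # 0 # 1 # raise z @ replicate e 1" using v by simp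
  moreover have "band 1 (raise z)" using z(1) by (auto simp: band_def raise_def)
  moreover have "raise z \<noteq> []" "hd (raise z) = 2" "last (raise z) = 2"
    using z hd_last_raise_lower(1,2)[OF z(2)] by auto
  ultimately show "v \<in> flag_words" unfolding flag_words_def using assms(3) by blast
  show "length v = a + length \<nu> + last (0 # rev \<nu>) + e + 3" using v lz by simp
  have "band 0 (z @ replicate e 0)" using z(1) by (auto simp: band_def)
  moreover have "sum_list (heights 0 (z @ replicate e 0)) = sum_list \<nu>"
    unfolding heights_append_replicate_0 z_def heights_part_word[OF s(1)] by (simp add: ss_def sum_list_rev sum_list_replicate)
  ultimately show "word_deficit v = int (sum_list \<nu> + a + length \<nu> + last (0 # rev \<nu>) + e + 1)"
    using v lz word_deficit_flag[of "z @ replicate e 0"] by simp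
qed

lemma flag_word_of_inj:
  assumes "is_partition \<nu>" "1 \<le> a" "is_partition \<nu>'" "1 \<le> a'"
    "flag_word_of a \<nu> e = flag_word_of a' \<nu>' e'"
  shows "\<nu> = \<nu>' \<and> e = e'"
proof -
  let ?z = "\<lambda>a \<nu>. part_word 0 (replicate a 0 @ rev \<nu>)"
  have eq: "?z a \<nu> @ replicate e 0 = ?z a' \<nu>' @ replicate e' 0"
  proof -
    have "raise (?z a \<nu> @ replicate e 0) = raise (?z a' \<nu>' @ replicate e' 0)"
      using assms(5) unfolding flag_word_of_def by (simp only: list.inject)
    then have "lower (raise (?z a \<nu> @ replicate e 0)) = lower (raise (?z a' \<nu>' @ replicate e' 0))"
      by (rule arg_cong)
    then show ?thesis by (simp only: lower_simps(5))
  qed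
  have tr: "trail 0 (?z a \<nu> @ replicate e 0) = e" if "1 \<le> a" for a \<nu> e
    using that last_part_word[of "replicate a 0 @ rev \<nu>" 0]
    by (simp add: trail_append_replicate trail_eq_0)
  then have e: "e = e'" using eq assms by metis
  have "sorted (0 # replicate a 0 @ rev \<nu>)" if "is_partition \<nu>" for a \<nu>
    using that by (auto simp: is_partition_iff_rev sorted_append)
  then have "replicate a 0 @ rev \<nu> = replicate a' 0 @ rev \<nu>'"
    using eq e heights_part_word assms(1,3) by (metis append_same_eq)
  then have "filter (\<lambda>x. 0 < x) (replicate a 0 @ rev \<nu>) = filter (\<lambda>x. 0 < x) (replicate a' 0 @ rev \<nu>')" by simp
  moreover have "filter (\<lambda>x. 0 < x) (replicate a 0 @ rev \<nu>) = rev \<nu>" if "is_partition \<nu>" for a \<nu>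
    using that by (simp add: is_partition_iff_rev)
  ultimately show ?thesis using e assms(1,3) by (metis rev_rev_ident)
qed

lemma sorted_nat_decomp: "sorted ss \<Longrightarrow> ss = replicate (count_list ss 0) (0 :: nat) @ filter (\<lambda>x. 0 < x) ss"
proof (induction ss)
  case (Cons s ss)
  show ?case
  proof (cases "s = 0")
    case False
    then have "\<forall>x\<in>set (s # ss). 0 < x" using Cons.prems by fastforce
    then show ?thesis using count_list_eq_0[of "s # ss" 0] by (simp add: filter_True)
  qed (use Cons in simp)
qed simp

lemma flag_words_ex:
  assumes "v \<in> flag_words"
  obtains a \<nu> e where "is_partition \<nu>" "1 \<le> a" "e \<le> 1" "v = flag_word_of a \<nu> e"
proof -
  from assms obtain W e where W: "v = 0 # 0 # 1 # W @ replicate e 1" "band 1 W" "W \<noteq> []" "hd W = 2" "last W = 2" "e \<le> 1"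
    by (auto simp: flag_words_def)
  define z where "z = lower W"
  have z: "band 0 z" "z \<noteq> []" "last z = 1" "hd z = 1"
    using band_lower[OF W(2)] W hd_last_raise_lower by (auto simp: z_def)
  define ss where "ss = heights 0 z"
  have "part_word 0 ss = z" using part_word_heights z by (simp add: ss_def)
  have ss: "sorted ss" "0 \<in> set ss"
    using sorted_heights[of 0 z] z by (auto simp: ss_def) (cases z, auto)
  define \<nu> where "\<nu> = rev (filter (\<lambda>x. 0 < x) ss)"
  have dec: "ss = replicate (count_list ss 0) 0 @ rev \<nu>" unfolding \<nu>_def using sorted_nat_decomp[OF ss(1)] by simp
  have "is_partition \<nu>" using ss(1) by (auto simp: \<nu>_def is_partition_iff_rev sorted_filter[of id, simplified])
  moreover have "1 \<le> count_list ss 0" using ss(2) count_list_0_iff[of ss 0] by (simp add: Suc_le_eq)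
  moreover have "v = flag_word_of (count_list ss 0) \<nu> e"
    unfolding flag_word_of_def dec[symmetric] \<open>part_word 0 ss = z\<close> using W(1) by (simp add: z_def)
  ultimately show ?thesis using that W(6) by blast
qed

text \<open>Every part but the largest adds at least 1 to the sum. This leaves room for
  \<open>a \<ge> 1\<close> in the count.\<close>

lemma length_plus_largest_part:
  assumes "is_partition \<nu>" shows "length \<nu> + last (0 # rev \<nu>) \<le> sum_list \<nu> + 1"
proof (cases \<nu>)
  case (Cons x xs)
  have "length xs \<le> sum_list xs" using assms Cons by (intro length_le_sum_list) (auto simp: is_partition_def)
  then show ?thesis using Cons by simp
qed simp

lemma card_large_flag_words:
  "card (large_flag_words n) = (\<Sum>j\<in>{j. 2 * j + 4 \<le> n}. 2 * num_partitions j)"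
proof -
  let ?J = "{j. 2 * j + 4 \<le> n}"
  let ?I = "SIGMA j:?J. {0, 1 :: nat} \<times> partitions_of j"
  \<comment> \<open>The padding is solved from the deficit formula; 2 j + 4 \<le> n keeps the
    truncated subtraction at least 1.\<close>
  define f where "f = (\<lambda>(j, e, \<nu>). flag_word_of (n - 1 - e - j - length \<nu> - last (0 # rev \<nu>)) \<nu> e)"
  have a: "1 \<le> n - 1 - e - j - length \<nu> - last (0 # rev \<nu>)"
    "n - 1 - e - j - length \<nu> - last (0 # rev \<nu>) + length \<nu> + last (0 # rev \<nu>) + e + j + 1 = n"
    if "j \<in> ?J" "e \<in> {0, 1}" "\<nu> \<in> partitions_of j" for j e \<nu>
    using that length_plus_largest_part[of \<nu>] by (auto simp: partitions_of_def)
  have "inj_on f ?I"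
  proof (rule inj_onI)
    fix x y assume xy: "x \<in> ?I" "y \<in> ?I" "f x = f y"
    obtain j e \<nu> j' e' \<nu>' where x: "x = (j, e, \<nu>)" "y = (j', e', \<nu>')" by (metis prod.exhaust)
    then have "\<nu> = \<nu>' \<and> e = e'" using xy a(1)[of j e \<nu>] a(1)[of j' e' \<nu>']
      by (intro flag_word_of_inj) (auto simp: f_def partitions_of_def)
    then show "x = y" using xy x by (auto simp: partitions_of_def)
  qed
  moreover have "f ` ?I = large_flag_words n"
  proof (intro set_eqI iffI)
    fix v assume "v \<in> f ` ?I"
    then obtain j e \<nu> where x: "j \<in> ?J" "e \<in> {0, 1}" "\<nu> \<in> partitions_of j" "v = f (j, e, \<nu>)" by auto
    then have "is_partition \<nu>" "e \<le> 1" "sum_list \<nu> = j" by (auto simp: partitions_of_def)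
    then show "v \<in> large_flag_words n" using flag_word_of_stats[of \<nu> _ e, OF _ a(1)[OF x(1-3)]] a(2)[OF x(1-3)] x(1,4)
      by (simp add: large_flag_words_def f_def)
  next
    fix v assume v: "v \<in> large_flag_words n"
    then have "v \<in> flag_words" by (simp add: large_flag_words_def)
    then obtain a \<nu> e where *: "is_partition \<nu>" "1 \<le> a" "e \<le> 1" "v = flag_word_of a \<nu> e"
      by (rule flag_words_ex)
    note st = flag_word_of_stats[OF *(1-3)]
    have n: "n = sum_list \<nu> + a + length \<nu> + last (0 # rev \<nu>) + e + 1"
      using v st(3) *(4) by (simp add: large_flag_words_def del: last.simps)
    moreover have "n + 8 \<le> 2 * (a + length \<nu> + last (0 # rev \<nu>) + e + 3)"
      using v st(2) *(4) by (simp add: large_flag_words_def del: last.simps)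
    ultimately have "sum_list \<nu> \<in> ?J" by simp
    moreover have "v = f (sum_list \<nu>, e, \<nu>)" using n *(4) by (simp add: f_def del: last.simps)
    moreover have "e \<in> {0, 1}" using *(3) by auto
    ultimately show "v \<in> f ` ?I" using *(1) by (force simp: partitions_of_def)
  qed
  ultimately have "card (large_flag_words n) = card ?I" by (metis card_image)
  also have "\<dots> = (\<Sum>j\<in>?J. card ({0, 1 :: nat} \<times> partitions_of j))"
  proof (rule card_SigmaI)
    show "finite ?J" by (rule finite_subset[of _ "{..n}"]) auto
  qed (simp add: finite_partitions_of)
  also have "\<dots> = (\<Sum>j\<in>?J. 2 * num_partitions j)"
  proof (rule sum.cong[OF refl])
    fix j
    have "card {0, 1 :: nat} = 2" by simp
    then show "card ({0, 1 :: nat} \<times> partitions_of j) = 2 * num_partitions j"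
      unfolding card_cartesian_product num_partitions_def by (rule arg_cong)
  qed
  finally show ?thesis .
qed

section \<open>Shortest nonnegative words, and the bijection with flagpole partitions\<close>

lemma min_Delta_reduced:
  assumes "reduced v" "\<forall>x\<in>set v. 0 \<le> x"
  shows "min_Delta (partition_of_class (dyck_class v)) = length v"
proof -
  have q: "is_QDV v" using assms by (simp add: reduced_def)
  let ?\<nu> = "word_partition v"
  have \<nu>: "is_partition ?\<nu>" using q by (rule is_partition_word_partition)
  have "min_Delta ?\<nu> = length v" unfolding min_Delta_def
  proof (rule Least_equality)
    show "length ?\<nu> < length v \<and> (\<forall>x\<in>set (QDV (length v) ?\<nu>). 0 \<le> x)"
      using length_word_partition[OF q] QDV_word_partition[OF q] assms(2) by simp
    fix m assume m: "length ?\<nu> < m \<and> (\<forall>x\<in>set (QDV m ?\<nu>). 0 \<le> x)"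
    show "length v \<le> m"
    proof (rule ccontr)
      assume "\<not> length v \<le> m"
      then obtain i where i: "length v = m + Suc i" by (metis less_imp_Suc_add not_le add_Suc_right)
      have qm: "is_QDV (QDV m ?\<nu>)" using is_QDV_QDV \<nu> m by blast
      have "(lift ^^ Suc i) (QDV m ?\<nu>) = v"
        using funpow_lift_eq_QDV[OF qm, of "Suc i"] word_partition_QDV[OF \<nu>, of m] m i QDV_word_partition[OF q] by simp
      then have "v = lift ((lift ^^ i) (QDV m ?\<nu>))" by simp
      moreover have "is_QDV ((lift ^^ i) (QDV m ?\<nu>))" using dyck_equiv_funpow_lift[OF qm] by blast
      ultimately show False using not_reduced_lift assms(1) by metis
    qed
  qed
  then show ?thesis using dyck_class_eq[OF q] partition_of_class_of_partition[OF \<nu>] by simp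
qed

text \<open>The shortest nonnegative word of a class is reduced or contains a second \<open>0\<close>.\<close>

lemma min_Delta_word:
  assumes "reduced w"
  obtains v i where "v = (lift ^^ i) w" "length v = min_Delta (partition_of_class (dyck_class w))"
    "\<forall>x\<in>set v. 0 \<le> x" "i \<ge> 1 \<longrightarrow> (\<exists>p\<ge>2. p < length v \<and> v ! p = 0)"
proof -
  have q: "is_QDV w" using assms by (simp add: reduced_def)
  let ?\<nu> = "word_partition w"
  have \<nu>: "is_partition ?\<nu>" using q by (rule is_partition_word_partition)
  have pc: "partition_of_class (dyck_class w) = ?\<nu>" using dyck_class_eq[OF q] partition_of_class_of_partition[OF \<nu>] by simp
  define P where "P n \<longleftrightarrow> length ?\<nu> < n \<and> (\<forall>x\<in>set (QDV n ?\<nu>). 0 \<le> x)" for n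
  define N where "N = min_Delta ?\<nu>"
  have N_eq: "N = (LEAST n. P n)" by (simp add: N_def min_Delta_def P_def)
  \<comment> \<open>At this length an index below the largest part belongs to a zero part, and any
    other index is at least as large as every part.\<close>
  have "P (length ?\<nu> + part ?\<nu> 1 + 1)"
  proof -
    let ?n = "length ?\<nu> + part ?\<nu> 1 + 1"
    have "int (part ?\<nu> (?n - i)) \<le> int i" if "i < ?n" for i
    proof (cases "i < part ?\<nu> 1")
      case True
      then have "\<not> ?n - i \<le> length ?\<nu>" by linarith
      then have "part ?\<nu> (?n - i) = 0" unfolding part_def by (simp only: if_False simp_thms)
      then show ?thesis by simp
    next
      case False
      have "1 \<le> ?n - i" using that by simp
      then have "part ?\<nu> (?n - i) \<le> part ?\<nu> 1" by (rule part_antimono[OF \<nu> order_refl])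
      then show ?thesis using False by linarith
    qed
    then show ?thesis by (auto simp: P_def in_set_conv_nth)
  qed
  then have PN: "P N" unfolding N_eq by (rule LeastI)
  have least: "\<not> P m" if "m < N" for m using that not_less_Least unfolding N_eq by blast
  define v where "v = QDV N ?\<nu>"
  have qv: "is_QDV v" "word_partition v = ?\<nu>" "length v = N"
    using is_QDV_QDV[OF \<nu>] word_partition_QDV[OF \<nu>] PN by (auto simp: v_def P_def)
  have "dyck_class v = dyck_class w" using dyck_class_eq_iff[OF qv(1) q] qv(2) by simp
  then obtain i where "v = (lift ^^ i) w \<or> w = (lift ^^ i) v" using dyck_class_eqD[OF qv(1) q] by blast
  moreover have "i = 0" if "w = (lift ^^ i) v"
  proof (cases i)
    case (Suc i')
    then show ?thesis using that not_reduced_lift dyck_equiv_funpow_lift[OF qv(1), of i'] assms by auto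
  qed
  ultimately obtain i where i: "v = (lift ^^ i) w" by (metis funpow_0)
  have "\<exists>p\<ge>2. p < length v \<and> v ! p = 0" if i1: "i \<ge> 1"
  proof -
    obtain i' where i': "i = Suc i'" using i1 by (cases i) auto
    let ?u = "(lift ^^ i') w"
    have vu: "v = lift ?u" using i i' by simp
    have qu: "is_QDV ?u" using dyck_equiv_funpow_lift[OF q] by simp
    have "word_partition ?u = ?\<nu>" using dyck_class_eq_iff[OF qu q] dyck_class_funpow_lift[OF q] by simp
    then have "QDV (N - 1) ?\<nu> = ?u" "length ?\<nu> < N - 1"
      using QDV_word_partition[OF qu] length_word_partition[OF qu] vu qv(3) by auto
    \<comment> \<open>By minimality the word before the last lift has a negative entry. One lift
      makes it nonnegative, so it becomes the required 0; it is not the initial entry, so its new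
      position is at least 2.\<close>
    moreover have "\<not> P (N - 1)" using least[of "N - 1"] vu qv(3) by fastforce
    ultimately obtain k where k: "k < length ?u" "?u ! k < 0" by (auto simp: P_def in_set_conv_nth not_le)
    have "?u ! 0 = 0" using qu by (elim is_QDV_E) simp
    then have "k \<noteq> 0" using k by (intro notI) simp
    have "v ! Suc k = ?u ! k + 1" using vu k by (simp add: lift_def)
    moreover have "0 \<le> v ! Suc k" using PN vu k unfolding P_def v_def[symmetric] by simp
    ultimately have "v ! Suc k = 0" using k by linarith
    then show ?thesis using k vu \<open>k \<noteq> 0\<close> by (intro exI[of _ "Suc k"]) auto
  qed
  moreover have "\<forall>x\<in>set v. 0 \<le> x" using PN by (simp add: P_def v_def)
  ultimately show ?thesis using that[of v i] i qv(3) pc by (simp add: N_def)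
qed

lemma ND_rtrancl_iff: "(C, D) \<in> ND\<^sup>* \<longleftrightarrow> (D, C) \<in> NU\<^sup>*"
  by (simp add: ND_def rtrancl_converse)

lemma ND_rtrancl_class:
  assumes "(dyck_class v, D) \<in> ND\<^sup>*" "is_QDV v" obtains w where "reduced w" "D = dyck_class w"
proof -
  have "\<exists>w. is_QDV w \<and> D = dyck_class w"
    using assms(1)
  proof (induction rule: rtrancl_induct)
    case (step C D)
    then have "(D, C) \<in> NU" by (simp add: ND_def)
    then show ?case by (metis NU_words)
  qed (use assms(2) in blast)
  then obtain w where "is_QDV w" "D = dyck_class w" by blast
  then show ?thesis using that reduced_ex[of w] dyck_class_funpow_lift by (metis reduced_def)
qed

text \<open>The shortest nonnegative word of the terminal class is not a proper lift by
  \<open>terminal_start01\<close>. So it is reduced and starts 0 0, and an entry of at least 3 would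
  keep \<open>NU\<close> from ever reaching \<open>TI \<mu>\<close>.\<close>

lemma TI2_flagpole:
  assumes \<mu>: "\<mu> \<in> partitions_of n" and "flagpole \<mu>"
  shows "TI2 \<mu> \<in> dyck_class ` large_flag_words n"
proof -
  have part: "is_partition \<mu>" "sum_list \<mu> = n" using \<mu> by (auto simp: partitions_of_def)
  let ?z = "part_word 0 (rev \<mu>)"
  have TI: "TI \<mu> = dyck_class (0 # ?z)" and z: "TI_word ?z"
    using TI_eq TI_word_part_word part by auto
  have qz: "is_QDV (0 # ?z)" using TI_word_reduced[OF z] by (simp add: reduced_def)
  obtain w where w: "reduced w" "TI2 \<mu> = dyck_class w" using TI2(1)[of \<mu>] TI ND_rtrancl_class qz by metis
  have qw: "is_QDV w" using w by (simp add: reduced_def)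
  have no_ND: "dyck_class w \<notin> Domain ND" using TI2(2)[of \<mu>] w by simp
  have "word_deficit w = word_deficit (0 # ?z)"
    using ND_rtrancl_deficit[OF TI2(1)[of \<mu>]] TI w class_stat_eq[OF qw] class_stat_eq[OF qz] by simp
  also have "\<dots> = int n"
    using word_deficit_binary[OF band_part_word] heights_part_word[of 0 "rev \<mu>"] part
    by (simp add: is_partition_iff_rev sum_list_rev)
  finally have defw: "word_deficit w = int n" .
  obtain v i where v: "v = (lift ^^ i) w" "length v = min_Delta (partition_of_class (dyck_class w))"
    "\<forall>x\<in>set v. 0 \<le> x" "i \<ge> 1 \<longrightarrow> (\<exists>p\<ge>2. p < length v \<and> v ! p = 0)"
    using min_Delta_word[OF w(1)] by metis
  have "word_deficit ((lift ^^ i) w) = word_deficit w" by (induction i) auto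
  then have defv: "word_deficit v = int n" using v defw by simp
  have large: "n + 8 \<le> 2 * length v" using \<open>flagpole \<mu>\<close> part w v by (simp add: flagpole_def)
  have "i = 0"
  proof (rule ccontr)
    assume "i \<noteq> 0"
    then obtain p where "2 \<le> p" "p < length v" "v ! p = 0" using v(4) by auto
    then show False using terminal_start01[OF w(1) v(1) _ v(3) _ _ _ no_ND] \<open>i \<noteq> 0\<close> large defv by simp
  qed
  then have vw: "v = w" using v by simp
  obtain w' where w': "w = 0 # w'" using is_QDV_E[OF qw] by blast
  have "length w \<ge> 2" using large unfolding vw by linarith
  then have "w' \<noteq> []" using w' by auto
  then have "w ! 1 = 0" using w' w(1) v(3) vw by (cases w') (auto simp: reduced_Cons)
  then have "w \<in> flag_words \<or> (\<exists>u. w = 0 # 0 # 1 # 2 # u \<and> (\<exists>x\<in>set u. x \<ge> 3))"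
    using terminal_start00[OF w(1) _ \<open>length w \<ge> 2\<close> _ no_ND] v(3) vw large defw by simp
  moreover have "(dyck_class w, dyck_class (0 # ?z)) \<in> NU\<^sup>*"
    using TI2(1)[of \<mu>] TI w by (simp add: ND_rtrancl_iff)
  then have "\<not> (\<exists>u. w = 0 # 0 # 1 # 2 # u \<and> (\<exists>x\<in>set u. x \<ge> 3))"
    using large_entry_stuck[OF _ qw _ _ z] v(3) vw by fastforce
  ultimately show ?thesis using w defw large vw by (auto simp: large_flag_words_def)
qed

text \<open>The class is terminal and \<open>NU\<close> leads from it to some
  \<open>TI \<mu>\<close>, so it is the end of the \<open>ND\<close> orbit there; the size of
  \<open>\<mu>\<close> is read off from the invariant deficit.\<close>

lemma large_flag_word_TI2:
  assumes "v \<in> large_flag_words n"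
  shows "\<exists>\<mu>\<in>partitions_of n. flagpole \<mu> \<and> TI2 \<mu> = dyck_class v"
proof -
  have v: "v \<in> flag_words" "word_deficit v = int n" "n + 8 \<le> 2 * length v"
    using assms by (auto simp: large_flag_words_def)
  have red: "reduced v" "is_QDV v" using flag_word_reduced[OF v(1)] by (auto simp: reduced_def)
  have nn: "\<forall>x\<in>set v. 0 \<le> x" using v(1) by (fastforce simp: flag_words_def band_def)
  obtain z where z: "TI_word z" "(dyck_class v, dyck_class (0 # z)) \<in> NU\<^sup>*"
    using flag_word_reaches_TI[OF v(1)] by blast
  obtain \<mu> where \<mu>: "is_partition \<mu>" "z = part_word 0 (rev \<mu>)" using TI_word_ex_partition[OF z(1)] by blast
  have ND: "(TI \<mu>, dyck_class v) \<in> ND\<^sup>*" using z \<mu> TI_eq by (simp add: ND_rtrancl_iff)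
  then have TI2: "TI2 \<mu> = dyck_class v" using TI2_eqI flag_word_terminal[OF v(1)] by blast
  have qz: "is_QDV (0 # z)" using TI_word_reduced[OF z(1)] by (simp add: reduced_def)
  have "word_deficit (0 # z) = int n"
    using ND_rtrancl_deficit[OF ND] TI_eq[OF \<mu>(1)] \<mu>(2) class_stat_eq[OF red(2)] class_stat_eq[OF qz] v(2) by simp
  then have "sum_list \<mu> = n"
    using word_deficit_binary[OF band_part_word] heights_part_word[of 0 "rev \<mu>"] \<mu>
    by (simp add: is_partition_iff_rev sum_list_rev)
  then show ?thesis using \<mu> TI2 min_Delta_reduced[OF red(1) nn] v(3)
    by (auto simp: partitions_of_def flagpole_def)
qed

text \<open>Both \<open>TI\<close> classes lie on the forward \<open>NU\<close> orbit of their
  common terminal class.\<close>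

lemma inj_TI2: "inj_on TI2 (Collect is_partition)"
proof (rule inj_onI)
  fix \<mu> \<nu> assume "\<mu> \<in> Collect is_partition" "\<nu> \<in> Collect is_partition" and eq: "TI2 \<mu> = TI2 \<nu>"
  then have *: "is_partition \<mu>" "is_partition \<nu>" by auto
  have "(TI2 \<mu>, dyck_class (0 # part_word 0 (rev \<mu>))) \<in> NU\<^sup>*"
    using TI2(1)[of \<mu>] TI_eq[OF *(1)] by (simp add: ND_rtrancl_iff)
  moreover have "(TI2 \<mu>, dyck_class (0 # part_word 0 (rev \<nu>))) \<in> NU\<^sup>*"
    using TI2(1)[of \<nu>] TI_eq[OF *(2)] unfolding eq by (simp add: ND_rtrancl_iff)
  ultimately have "part_word 0 (rev \<mu>) = part_word 0 (rev \<nu>)"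
    using TI_word_orbit_unique TI_word_part_word * by blast
  then show "\<mu> = \<nu>" using part_word_rev_inj * by blast
qed

theorem theorem4p9:
  fixes n :: nat
  shows "card {\<mu> \<in> partitions_of n. flagpole \<mu>} =
         (\<Sum>j\<in>{0..\<lfloor>(real n - 4) / 2\<rfloor>}. 2 * num_partitions (nat j))"
proof -
  let ?S = "{\<mu> \<in> partitions_of n. flagpole \<mu>}"
  have "TI2 ` ?S = dyck_class ` large_flag_words n"
  proof
    show "TI2 ` ?S \<subseteq> dyck_class ` large_flag_words n" using TI2_flagpole by auto
    show "dyck_class ` large_flag_words n \<subseteq> TI2 ` ?S"
    proof (rule image_subsetI)
      fix v assume "v \<in> large_flag_words n"
      then obtain \<mu> where "\<mu> \<in> ?S" "TI2 \<mu> = dyck_class v" using large_flag_word_TI2[of v n] by auto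
      then show "dyck_class v \<in> TI2 ` ?S" by (metis image_eqI)
    qed
  qed
  moreover have "inj_on TI2 ?S"
    by (rule inj_on_subset[OF inj_TI2]) (auto simp: partitions_of_def)
  moreover have "inj_on dyck_class (large_flag_words n)"
    using reduced_eqD flag_word_reduced by (auto simp: inj_on_def large_flag_words_def)
  ultimately have "card ?S = card (large_flag_words n)" by (metis card_image)
  also have "\<dots> = (\<Sum>j\<in>{j. 2 * j + 4 \<le> n}. 2 * num_partitions j)" by (rule card_large_flag_words)
  also have "\<dots> = (\<Sum>j\<in>int ` {j. 2 * j + 4 \<le> n}. 2 * num_partitions (nat j))"
    by (subst sum.reindex) auto
  \<comment> \<open>For \<open>n < 4\<close> the floor is negative and both sets are empty, since
    the subtraction takes place in the reals.\<close>
  also have "int ` {j. 2 * j + 4 \<le> n} = {0..\<lfloor>(real n - 4) / 2\<rfloor>}"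
  proof (intro set_eqI iffI)
    fix x assume "x \<in> {0..\<lfloor>(real n - 4) / 2\<rfloor>}"
    then have x: "0 \<le> x" "real_of_int x \<le> (real n - 4) / 2" by (auto simp: le_floor_iff)
    from x(1) obtain m where m: "x = int m" by (rule nonneg_int_cases)
    then have "real (2 * m + 4) \<le> real n" using x(2) by simp
    then have "2 * m + 4 \<le> n" by (simp only: of_nat_le_iff)
    then show "x \<in> int ` {j. 2 * j + 4 \<le> n}" using m by simp
  qed (auto simp: le_floor_iff)
  finally show ?thesis .
qed

end
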